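(* Let $1\le q\le p\le 2$, $0<\rho<1$, let $N\ge1$ be an integer and $s=\dim\mathcal{T}_N$, where $\mathcal{T}_N=\bigoplus_{l=0}^N\mathcal{H}_l$, and let $d_l=\dim\mathcal{H}_l$. Let $\lambda:[0,\infty)\to\mathbb{R}$ be a positive non-increasing function (so $\lambda(t)\ne0$ for $t\ge0$), and let $\Lambda$ be the multiplier operator associated with the sequence $\lambda_{m,n}=\lambda(\max\{m,n\})$. Then there is an absolute constant $C>0$ such that $$\min\{d_{[\rho s-1]}(\Lambda U_p,L^q),\,d^{[\rho s-1]}(\Lambda U_p,L^q)\}\ \ge\ C(1-\rho)^{1/2}s^{1/2}\Big(\sum_{l=1}^N(\lambda(l))^{-2}d_l\Big)^{-1/2}\vartheta_{q,s},$$ where $\vartheta_{q,s}=(1-1/q)^{1/2}$ if $q>1$, $\vartheta_{q,s}=(\ln s)^{-1/2}$ if $q=1$, and $[\rho s-1]$ is the integer part of $\rho s-1$.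
   Context: $\mathbb{N}=\{0,1,2,\dots\}$; $d\ge2$ is a fixed integer. $\Omega_d$ is the unit sphere of $\mathbb{C}^d$ with surface measure $\sigma_d$ (the Lebesgue surface measure of $S^{2d-1}\subset\mathbb{R}^{2d}$ under $\mathbb{C}^d\cong\mathbb{R}^{2d}$, not normalized). $L^p=L^p(\Omega_d)$ is the usual space of complex-valued functions, with closed unit ball $U_p$. $\mathcal{H}_{m,n}$ ($m,n\in\mathbb{N}$) is the space of restrictions to $\Omega_d$ of polynomials in $z,\bar z$ homogeneous of degree $m$ in $z$ and degree $n$ in $\bar z$ and in the kernel of $4\sum_j\partial^2/\partial z_j\partial\bar z_j$. For $l\in\mathbb{N}$, $\mathcal{H}_l=\bigoplus_{\max\{m,n\}=l}\mathcal{H}_{m,n}$. Let $Z_w^{(m,n)}\in\mathcal{H}_{m,n}$ be the reproducing kernel of $\mathcal{H}_{m,n}$ at $w\in\Omega_d$, and $(\varphi*\widetilde Z^{(m,n)})(w)=\int_{\Omega_d}\varphi\,\overline{Z_w^{(m,n)}}\,d\sigma_d$ (the orthogonal projection of $\varphi$ onto $\mathcal{H}_{m,n}$ when $\varphi\in L^2$). The multiplier operator $\Lambda$ associated with $\{\lambda_{m,n}\}$ is bounded from $L^p$ to $L^q$ if every $\varphi\in L^p$ has an image $f=\Lambda\varphi\in L^q$ with formal expansion $f\sim\sum_{m,n}\lambda_{m,n}\varphi*\widetilde Z^{(m,n)}$ and $\sup_{\varphi\in U_p}\|\Lambda\varphi\|_q<\infty$. Standing assumption: $\Lambda$ is bounded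 from $L^p$ to $L^q$ when the set $\Lambda U_p\subset L^q$ is considered. For a convex centrally symmetric subset $A$ of a Banach space $X$: Kolmogorov width $d_n(A,X)=\inf_{X_n}\sup_{x\in A}\inf_{y\in X_n}\|x-y\|$ over subspaces $X_n$ of dimension $n$; Gelfand width $d^n(A,X)=\inf_{L^n}\sup_{x\in A\cap L^n}\|x\|$ over subspaces $L^n$ of codimension $n$. The inequality is understood for $\rho s\ge1$, so that the width index is non-negative. *)

theory Defs
  imports "HOL-Analysis.Analysis" "HOL-Library.Function_Algebras"
begin

section \<open>Complex-valued functions as a complex vector space\<close>

definition cscale :: "complex \<Rightarrow> ('a \<Rightarrow> complex) \<Rightarrow> 'a \<Rightarrow> complex"
  where "cscale c f = (\<lambda>x. c * f x)"

interpretation cfun: vector_space "cscale :: complex \<Rightarrow> ('a \<Rightarrow> complex) \<Rightarrow> 'a \<Rightarrow> complex"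
  by unfold_locales (simp_all add: cscale_def fun_eq_iff algebra_simps)

text \<open>The quotient space \<open>V / W\<close> has complex dimension \<open>n\<close>: there is a complement of \<open>W\<close> in \<open>V\<close>
  of dimension \<open>n\<close>.\<close>

definition has_quotient_dim :: "('a \<Rightarrow> complex) set \<Rightarrow> ('a \<Rightarrow> complex) set \<Rightarrow> nat \<Rightarrow> bool"
  where "has_quotient_dim V W n \<longleftrightarrow>
    cfun.subspace V \<and> cfun.subspace W \<and> W \<subseteq> V \<and>
    (\<exists>B. finite B \<and> card B = n \<and> cfun.independent B \<and>
         cfun.span B \<inter> W = {0} \<and> V = {b + w | b w. b \<in> cfun.span B \<and> w \<in> W})"

section \<open>Widths\<close>

text \<open>A normed space is presented by a space \<open>X\<close> of functions and a seminorm \<open>N\<close> on it; the normed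
  space meant is \<open>X / null_part X N\<close>. Its subspaces correspond to the subspaces of \<open>X\<close> that contain
  \<open>null_part X N\<close>, and dimension and codimension are those in the quotient. In the
  Gelfand width the subspaces of codimension \<open>n\<close> are not required to be closed. Both widths may be
  infinite.\<close>

definition null_part :: "('a \<Rightarrow> complex) set \<Rightarrow> (('a \<Rightarrow> complex) \<Rightarrow> real) \<Rightarrow> ('a \<Rightarrow> complex) set"
  where "null_part X N = {f \<in> X. N f = 0}"

definition kolmogorov_width ::
    "nat \<Rightarrow> ('a \<Rightarrow> complex) set \<Rightarrow> ('a \<Rightarrow> complex) set \<Rightarrow> (('a \<Rightarrow> complex) \<Rightarrow> real) \<Rightarrow> ennreal"
  where "kolmogorov_width n A X N =
    (INF V \<in> {V. V \<subseteq> X \<and> has_quotient_dim V (null_part X N) n}.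
       SUP x \<in> A. INF y \<in> V. ennreal (N (x - y)))"

definition gelfand_width ::
    "nat \<Rightarrow> ('a \<Rightarrow> complex) set \<Rightarrow> ('a \<Rightarrow> complex) set \<Rightarrow> (('a \<Rightarrow> complex) \<Rightarrow> real) \<Rightarrow> ennreal"
  where "gelfand_width n A X N =
    (INF L \<in> {L. null_part X N \<subseteq> L \<and> has_quotient_dim X L n}.
       SUP x \<in> A \<inter> L. ennreal (N x))"

section \<open>The complex sphere and its Lebesgue spaces\<close>

text \<open>Unnormalised surface measure of the unit sphere of \<open>complex ^ 'd\<close>, by polar coordinates:
  the measure of \<open>A\<close> is the real dimension \<open>2 d\<close> times the Lebesgue measure of the part of the unit
  ball lying on rays through \<open>A\<close>; see \<open>emeasure_surface_measure\<close>.\<close>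

definition surface_measure :: "(complex ^ 'd) measure"
  where "surface_measure =
    scale_measure (ennreal (2 * real CARD('d)))
      (distr (restrict_space lborel (cball 0 1 - {0})) (restrict_space borel (sphere 0 1))
        (\<lambda>x. x /\<^sub>R norm x))"

lemma space_surface_measure [simp]:
  "space (surface_measure :: (complex ^ 'd) measure) = sphere 0 1"
  by (simp add: surface_measure_def space_scale_measure space_restrict_space)

lemma sets_surface_measure:
  "sets (surface_measure :: (complex ^ 'd) measure) = sets (restrict_space borel (sphere 0 1))"
  by (simp add: surface_measure_def)

lemma emeasure_surface_measure:
  fixes A :: "(complex ^ 'd) set"
  assumes "A \<in> sets borel" "A \<subseteq> sphere 0 1"
  shows "emeasure surface_measure A =
    ennreal (2 * real CARD('d)) *
      emeasure lborel {x \<in> cball 0 1 - {0}. x /\<^sub>R norm x \<in> A}"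
proof -
  have m: "(\<lambda>x. x /\<^sub>R norm x) \<in>
      restrict_space lborel (cball 0 1 - {0}) \<rightarrow>\<^sub>M restrict_space borel (sphere 0 (1::real) :: (complex ^ 'd) set)"
    by (rule measurable_restrict_space2)
       (auto simp: space_restrict_space intro!: measurable_restrict_space1)
  have A: "A \<in> sets (restrict_space borel (sphere 0 1))"
    using assms by (subst sets_restrict_space_iff) auto
  have eq: "(\<lambda>x. x /\<^sub>R norm x) -` A \<inter> space (restrict_space lborel (cball 0 1 - {0}))
      = {x \<in> cball 0 1 - {0}. x /\<^sub>R norm x \<in> A}"
    by (auto simp: space_restrict_space)
  show ?thesis
    unfolding surface_measure_def emeasure_scale_measure emeasure_distr[OF m A] eq
    by (subst emeasure_restrict_space) auto
qed

definition Lp_space :: "real \<Rightarrow> (complex ^ 'd \<Rightarrow> complex) set"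
  where "Lp_space p = {f \<in> borel_measurable surface_measure.
    integrable surface_measure (\<lambda>z. norm (f z) powr p)}"

definition Lp_norm :: "real \<Rightarrow> (complex ^ 'd \<Rightarrow> complex) \<Rightarrow> real"
  where "Lp_norm p f = (\<integral>z. norm (f z) powr p \<partial>surface_measure) powr (1 / p)"

definition Lp_ball :: "real \<Rightarrow> (complex ^ 'd \<Rightarrow> complex) set"
  where "Lp_ball p = {f \<in> Lp_space p. Lp_norm p f \<le> 1}"

section \<open>Spherical harmonics\<close>

definition bimonomial :: "('d \<Rightarrow> nat) \<Rightarrow> ('d \<Rightarrow> nat) \<Rightarrow> complex ^ 'd \<Rightarrow> complex"
  where "bimonomial \<alpha> \<beta> z = (\<Prod>j\<in>UNIV. (z $ j) ^ \<alpha> j * cnj (z $ j) ^ \<beta> j)"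

definition bihomogeneous :: "nat \<Rightarrow> nat \<Rightarrow> (complex ^ 'd \<Rightarrow> complex) set"
  where "bihomogeneous m n =
    cfun.span {bimonomial \<alpha> \<beta> | \<alpha> \<beta>. sum \<alpha> UNIV = m \<and> sum \<beta> UNIV = n}"

definition wirtinger :: "'d \<Rightarrow> (complex ^ 'd \<Rightarrow> complex) \<Rightarrow> complex ^ 'd \<Rightarrow> complex"
  where "wirtinger j f z =
    (frechet_derivative f (at z) (axis j 1) - \<i> * frechet_derivative f (at z) (axis j \<i>)) / 2"

definition wirtinger_bar :: "'d \<Rightarrow> (complex ^ 'd \<Rightarrow> complex) \<Rightarrow> complex ^ 'd \<Rightarrow> complex"
  where "wirtinger_bar j f z =
    (frechet_derivative f (at z) (axis j 1) + \<i> * frechet_derivative f (at z) (axis j \<i>)) / 2"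

definition complex_laplacian :: "(complex ^ 'd \<Rightarrow> complex) \<Rightarrow> complex ^ 'd \<Rightarrow> complex"
  where "complex_laplacian f z = 4 * (\<Sum>j\<in>UNIV. wirtinger j (wirtinger_bar j f) z)"

text \<open>A function on the sphere is represented by its extension by \<open>0\<close>, so that linear
  independence and dimension are those of functions on the sphere.\<close>

definition sphere_restrict :: "(complex ^ 'd \<Rightarrow> complex) \<Rightarrow> complex ^ 'd \<Rightarrow> complex"
  where "sphere_restrict f = (\<lambda>z. if z \<in> sphere 0 1 then f z else 0)"

definition harmonics :: "nat \<Rightarrow> nat \<Rightarrow> (complex ^ 'd \<Rightarrow> complex) set"
  where "harmonics m n =
    sphere_restrict ` {P \<in> bihomogeneous m n. \<forall>z. complex_laplacian P z = 0}"

text \<open>The sums of the spaces \<open>harmonics m n\<close> are direct (the summands are pairwise orthogonal),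
  so the internal direct sums are the linear spans of the unions.\<close>

definition harmonics_level :: "nat \<Rightarrow> (complex ^ 'd \<Rightarrow> complex) set"
  where "harmonics_level l = cfun.span (\<Union>(m, n) \<in> {(m, n). max m n = l}. harmonics m n)"

definition harmonics_upto :: "nat \<Rightarrow> (complex ^ 'd \<Rightarrow> complex) set"
  where "harmonics_upto N = cfun.span (\<Union>l\<le>N. harmonics_level l)"

definition zonal :: "nat \<Rightarrow> nat \<Rightarrow> complex ^ 'd \<Rightarrow> complex ^ 'd \<Rightarrow> complex"
  where "zonal m n w = (THE Z. Z \<in> harmonics m n \<and>
    (\<forall>f \<in> harmonics m n. f w = (\<integral>z. f z * cnj (Z z) \<partial>surface_measure)))"

definition conv_zonal :: "(complex ^ 'd \<Rightarrow> complex) \<Rightarrow> nat \<Rightarrow> nat \<Rightarrow> complex ^ 'd \<Rightarrow> complex"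
  where "conv_zonal \<phi> m n w = (\<integral>z. \<phi> z * cnj (zonal m n w z) \<partial>surface_measure)"

section \<open>Multiplier operators\<close>

text \<open>\<open>f\<close> represents the image of \<open>\<phi>\<close> in \<open>L\<^sup>q\<close> under the multiplier operator of \<open>a\<close>: its formal
  expansion is the sum of the \<open>a m n * conv_zonal \<phi> m n\<close>. This determines \<open>f\<close> almost everywhere.\<close>

definition multiplier_image ::
    "(nat \<Rightarrow> nat \<Rightarrow> complex) \<Rightarrow> real \<Rightarrow> (complex ^ 'd \<Rightarrow> complex) \<Rightarrow> (complex ^ 'd \<Rightarrow> complex) \<Rightarrow> bool"
  where "multiplier_image a q \<phi> f \<longleftrightarrow> f \<in> Lp_space q \<and>
    (\<forall>m n. \<forall>w \<in> sphere 0 1. conv_zonal f m n w = a m n * conv_zonal \<phi> m n w)"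

definition multiplier_ball ::
    "(nat \<Rightarrow> nat \<Rightarrow> complex) \<Rightarrow> real \<Rightarrow> real \<Rightarrow> (complex ^ 'd \<Rightarrow> complex) set"
  where "multiplier_ball a p q = {f. \<exists>\<phi> \<in> Lp_ball p. multiplier_image a q \<phi> f}"

definition bounded_multiplier ::
    "'d::finite itself \<Rightarrow> (nat \<Rightarrow> nat \<Rightarrow> complex) \<Rightarrow> real \<Rightarrow> real \<Rightarrow> bool"
  where "bounded_multiplier _ a p q \<longleftrightarrow>
    (\<forall>\<phi> \<in> (Lp_space p :: (complex ^ 'd \<Rightarrow> complex) set). \<exists>f. multiplier_image a q \<phi> f) \<and>
    bdd_above (Lp_norm q ` (multiplier_ball a p q :: (complex ^ 'd \<Rightarrow> complex) set))"

definition vartheta :: "real \<Rightarrow> nat \<Rightarrow> real"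
  where "vartheta q s = (if q > 1 then (1 - 1 / q) powr (1 / 2) else (ln (real s)) powr (- 1 / 2))"

end

theory Submission
  imports Defs
begin

text \<open>
  Both widths are bounded below by the same pair of polynomials. Since \<open>p \<le> 2\<close>, the unit ball of
  \<open>L\<^sup>p\<close> contains a multiple of the unit ball of \<open>L\<^sup>2\<close>. On the polynomials of level at most \<open>N\<close> the
  multiplier operator is diagonal in an orthonormal basis \<open>b\<^sub>i\<close> that consists of bases of the
  levels (\<open>graded_basis\<close>), with eigenvalue \<open>\<mu>\<^sub>i\<close> equal to \<open>\<lambda>\<close> at the level of \<open>b\<^sub>i\<close>. For a coefficient
  vector \<open>c\<close> put \<open>x = \<Sum> \<mu>\<^sub>i c\<^sub>i b\<^sub>i\<close> and \<open>y = \<Sum> (c\<^sub>i / \<mu>\<^sub>i) b\<^sub>i\<close>. Then \<open>x\<close> is the image of a function of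
  \<open>L\<^sup>2\<close>-norm \<open>\<bar>c\<bar>\<close>, and the inner product of \<open>x\<close> and \<open>y\<close> is \<open>\<bar>c\<bar>\<^sup>2\<close>, whatever the eigenvalues are. For
  the Gelfand width, \<open>k\<close> linear conditions on \<open>c\<close> force \<open>x\<close> into a given subspace of codimension
  \<open>k\<close>; for the Kolmogorov width, \<open>k\<close> linear conditions force \<open>y\<close> to annihilate a given subspace of
  dimension \<open>k\<close>. In both cases duality bounds the width below by \<open>\<bar>c\<bar>\<close> divided by the norm of \<open>y\<close> in
  the dual exponent \<open>q'\<close>, up to a factor that depends on \<open>d\<close> only
  (\<open>test_element\<close>, \<open>widths_multiplier_ball_ge\<close>).

  It remains to find \<open>c\<close> in a subspace of dimension \<open>m = s - k\<close> for which \<open>y\<close> is small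
  (\<open>good_coefficients\<close>). Take an orthonormal basis \<open>v\<^sub>1, \<dots>, v\<^sub>m\<close> of the subspace and
  \<open>c = \<Sum> \<plusminus>v\<^sub>r\<close>; every choice of signs gives \<open>\<bar>c\<bar>\<^sup>2 = m\<close>. At a point \<open>z\<close> of the sphere \<open>y\<close> is a signed
  sum of numbers whose squares add up, by Bessel's inequality, to at most \<open>\<Sum> \<bar>b\<^sub>i z\<bar>\<^sup>2 / \<mu>\<^sub>i\<^sup>2\<close>. The
  diagonal of the reproducing kernel of a level is constant (\<open>kernel_diagonal\<close>), so this is
  \<open>\<Sum> d\<^sub>l / \<lambda>(l)\<^sup>2\<close> divided by the area of the sphere. For suitable signs the
  root of order \<open>2 j\<close> of the moment of \<open>y\<close> of order \<open>2 j\<close> exceeds the square root of that number by a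
  factor of the order of \<open>\<surd>j\<close> at most (\<open>good_signs_exist\<close>). With \<open>2 j\<close> close to \<open>q'\<close> this accounts for
  \<open>\<surd>(1 - 1 / q)\<close>. For \<open>q = 1\<close> the supremum of \<open>y\<close> is needed; with \<open>j\<close> close to \<open>ln s\<close> it is at most
  a constant times the root of the moment of order \<open>2 j\<close> (\<open>sup_le_moment\<close>), and this accounts for \<open>1 / \<surd>(ln s)\<close>. The inequality
  \<open>m \<ge> (1 - \<rho>) s\<close> gives the remaining factors, and monotonicity of \<open>\<lambda>\<close> absorbs the term of level \<open>0\<close>.

  The facts on spherical harmonics come from the infinitesimal action of the unitary group, that is,
  from the first-order operators \<open>rot j k\<close>. They annihilate integrals over the sphere, because the
  surface measure is invariant (\<open>surface_integral_rot\<close>), and they preserve the harmonic polynomials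
  of a given bidegree (\<open>harm_rot\<close>). Their Casimir operator has eigenvalues that separate the
  bidegrees \<open>(m, n)\<close> with a given difference \<open>m - n\<close>, whence orthogonality (\<open>harm_orthogonal\<close>); and a
  polynomial annihilated by all of them is constant on the sphere, whence the constant diagonal.
\<close>

section \<open>Polynomials in the coordinates and their conjugates\<close>

text \<open>An inductive presentation: an identity between derivations needs to be checked on the constants and
the coordinates only.\<close>

inductive polyfun :: "(complex ^ 'd \<Rightarrow> complex) \<Rightarrow> bool" where
  const: "polyfun (\<lambda>z. c)"
| coord: "polyfun (\<lambda>z. z $ j)"
| cnj_coord: "polyfun (\<lambda>z. cnj (z $ j))"
| add: "polyfun f \<Longrightarrow> polyfun g \<Longrightarrow> polyfun (\<lambda>z. f z + g z)"
| mult: "polyfun f \<Longrightarrow> polyfun g \<Longrightarrow> polyfun (\<lambda>z. f z * g z)"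

lemma polyfun_uminus: "polyfun f \<Longrightarrow> polyfun (\<lambda>z. - f z)"
  using polyfun.mult[OF polyfun.const[of "-1"], of f] by simp

lemma polyfun_diff: "polyfun f \<Longrightarrow> polyfun g \<Longrightarrow> polyfun (\<lambda>z. f z - g z)"
  using polyfun.add[OF _ polyfun_uminus, of f g] by simp

lemma polyfun_sum:
  "(\<And>i. i \<in> I \<Longrightarrow> polyfun (f i)) \<Longrightarrow> polyfun (\<lambda>z. \<Sum>i\<in>I. f i z)"
  by (induction I rule: infinite_finite_induct) (auto intro: polyfun.intros)

lemma polyfun_power: "polyfun f \<Longrightarrow> polyfun (\<lambda>z. f z ^ n)"
  by (induction n) (auto intro: polyfun.intros)

lemma polyfun_cnj: "polyfun f \<Longrightarrow> polyfun (\<lambda>z. cnj (f z))"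
  by (induction rule: polyfun.induct) (auto intro: polyfun.intros)

lemma polyfun_differentiable: "polyfun f \<Longrightarrow> f differentiable (at z)"
proof (induction rule: polyfun.induct)
  case (coord j)
  show ?case
    using bounded_linear_imp_has_derivative[OF bounded_linear_vec_nth] by (auto simp: differentiable_def)
next
  case (cnj_coord j)
  show ?case
    using bounded_linear_imp_has_derivative[OF bounded_linear_compose[OF bounded_linear_cnj bounded_linear_vec_nth]]
    by (auto simp: differentiable_def)
qed (auto intro: derivative_intros)

lemma polyfun_continuous: "polyfun f \<Longrightarrow> continuous_on S f"
  by (meson differentiable_imp_continuous_within continuous_at_imp_continuous_on polyfun_differentiable)

lemma wirtinger_eqI:
  assumes "(f has_derivative f') (at z)"
  shows "wirtinger j f z = (f' (axis j 1) - \<i> * f' (axis j \<i>)) / 2"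
    and "wirtinger_bar j f z = (f' (axis j 1) + \<i> * f' (axis j \<i>)) / 2"
  unfolding wirtinger_def wirtinger_bar_def frechet_derivative_at[OF assms, symmetric] by simp_all

lemma wirtinger_const [simp]: "wirtinger j (\<lambda>z. c) = (\<lambda>z. 0)"
  and wirtinger_bar_const [simp]: "wirtinger_bar j (\<lambda>z. c) = (\<lambda>z. 0)"
  by (simp_all add: fun_eq_iff wirtinger_eqI[OF has_derivative_const])

lemma wirtinger_coord [simp]: "wirtinger j (\<lambda>z. z $ k) = (\<lambda>z. if j = k then 1 else 0)"
  and wirtinger_bar_coord [simp]: "wirtinger_bar j (\<lambda>z. z $ k) = (\<lambda>z. 0)"
  by (simp_all add: fun_eq_iff axis_def
     wirtinger_eqI[OF bounded_linear_imp_has_derivative[OF bounded_linear_vec_nth]])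

lemma wirtinger_cnj_coord [simp]: "wirtinger j (\<lambda>z. cnj (z $ k)) = (\<lambda>z. 0)"
  and wirtinger_bar_cnj_coord [simp]:
    "wirtinger_bar j (\<lambda>z. cnj (z $ k)) = (\<lambda>z. if j = k then 1 else 0)"
  by (simp_all add: fun_eq_iff axis_def
     wirtinger_eqI[OF bounded_linear_imp_has_derivative[OF bounded_linear_compose[OF bounded_linear_cnj bounded_linear_vec_nth]]])

context
  fixes f g :: "complex ^ 'd \<Rightarrow> complex"
  assumes f: "polyfun f" and g: "polyfun g"
begin

lemma wirtinger_add: "wirtinger j (\<lambda>z. f z + g z) = (\<lambda>z. wirtinger j f z + wirtinger j g z)"
  and wirtinger_bar_add: "wirtinger_bar j (\<lambda>z. f z + g z) = (\<lambda>z. wirtinger_bar j f z + wirtinger_bar j g z)"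
proof -
  have *: "((\<lambda>z. f z + g z) has_derivative
      (\<lambda>h. frechet_derivative f (at z) h + frechet_derivative g (at z) h)) (at z)" for z
    by (intro has_derivative_add f g polyfun_differentiable frechet_derivative_works[THEN iffD1])
  show "wirtinger j (\<lambda>z. f z + g z) = (\<lambda>z. wirtinger j f z + wirtinger j g z)"
    "wirtinger_bar j (\<lambda>z. f z + g z) = (\<lambda>z. wirtinger_bar j f z + wirtinger_bar j g z)"
    by (auto simp: fun_eq_iff wirtinger_eqI[OF *] wirtinger_def wirtinger_bar_def field_simps)
qed

lemma wirtinger_mult:
    "wirtinger j (\<lambda>z. f z * g z) = (\<lambda>z. wirtinger j f z * g z + f z * wirtinger j g z)"
  and wirtinger_bar_mult:
    "wirtinger_bar j (\<lambda>z. f z * g z) = (\<lambda>z. wirtinger_bar j f z * g z + f z * wirtinger_bar j g z)"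
proof -
  have *: "((\<lambda>z. f z * g z) has_derivative
      (\<lambda>h. f z * frechet_derivative g (at z) h + frechet_derivative f (at z) h * g z)) (at z)" for z
    by (intro has_derivative_mult f g polyfun_differentiable frechet_derivative_works[THEN iffD1])
  show "wirtinger j (\<lambda>z. f z * g z) = (\<lambda>z. wirtinger j f z * g z + f z * wirtinger j g z)"
    "wirtinger_bar j (\<lambda>z. f z * g z) = (\<lambda>z. wirtinger_bar j f z * g z + f z * wirtinger_bar j g z)"
    by (auto simp: fun_eq_iff wirtinger_eqI[OF *] wirtinger_def wirtinger_bar_def field_simps)
qed

end

lemma wirtinger_cmult:
  assumes "polyfun f"
  shows "wirtinger j (\<lambda>z. c * f z) = (\<lambda>z. c * wirtinger j f z)"
    and "wirtinger_bar j (\<lambda>z. c * f z) = (\<lambda>z. c * wirtinger_bar j f z)"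
  using wirtinger_mult[OF polyfun.const assms] wirtinger_bar_mult[OF polyfun.const assms] by simp_all

lemma wirtinger_diff:
  assumes f: "polyfun f" and g: "polyfun g"
  shows "wirtinger j (\<lambda>z. f z - g z) = (\<lambda>z. wirtinger j f z - wirtinger j g z)"
    and "wirtinger_bar j (\<lambda>z. f z - g z) = (\<lambda>z. wirtinger_bar j f z - wirtinger_bar j g z)"
  using wirtinger_add[OF f polyfun_uminus[OF g]] wirtinger_bar_add[OF f polyfun_uminus[OF g]]
    wirtinger_cmult[OF g, of _ "-1"]
  by simp_all

lemma wirtinger_sum:
  assumes "\<And>i. i \<in> I \<Longrightarrow> polyfun (f i)"
  shows "wirtinger j (\<lambda>z. \<Sum>i\<in>I. f i z) = (\<lambda>z. \<Sum>i\<in>I. wirtinger j (f i) z)"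
    and "wirtinger_bar j (\<lambda>z. \<Sum>i\<in>I. f i z) = (\<lambda>z. \<Sum>i\<in>I. wirtinger_bar j (f i) z)"
proof -
  have "wirtinger j (\<lambda>z. \<Sum>i\<in>I. f i z) = (\<lambda>z. \<Sum>i\<in>I. wirtinger j (f i) z) \<and>
      wirtinger_bar j (\<lambda>z. \<Sum>i\<in>I. f i z) = (\<lambda>z. \<Sum>i\<in>I. wirtinger_bar j (f i) z)"
    using assms
    by (induction I rule: infinite_finite_induct)
       (simp_all add: wirtinger_add wirtinger_bar_add polyfun_sum)
  then show "wirtinger j (\<lambda>z. \<Sum>i\<in>I. f i z) = (\<lambda>z. \<Sum>i\<in>I. wirtinger j (f i) z)"
    "wirtinger_bar j (\<lambda>z. \<Sum>i\<in>I. f i z) = (\<lambda>z. \<Sum>i\<in>I. wirtinger_bar j (f i) z)" by simp_all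
qed

lemma polyfun_wirtinger: "polyfun f \<Longrightarrow> polyfun (wirtinger j f)"
  and polyfun_wirtinger_bar: "polyfun f \<Longrightarrow> polyfun (wirtinger_bar j f)"
proof -
  have "polyfun f \<Longrightarrow> polyfun (wirtinger j f) \<and> polyfun (wirtinger_bar j f)"
    by (induction rule: polyfun.induct)
       (auto simp: wirtinger_add wirtinger_bar_add wirtinger_mult wirtinger_bar_mult
         intro: polyfun.intros)
  then show "polyfun f \<Longrightarrow> polyfun (wirtinger j f)" "polyfun f \<Longrightarrow> polyfun (wirtinger_bar j f)"
    by simp_all
qed

lemmas polyfun_intros = polyfun.intros polyfun_uminus polyfun_diff polyfun_sum polyfun_power
  polyfun_cnj polyfun_wirtinger polyfun_wirtinger_bar

lemmas wirtinger_rules = wirtinger_add wirtinger_bar_add wirtinger_mult wirtinger_bar_mult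
  wirtinger_diff polyfun_intros

lemma wirtinger_commute:
  assumes "polyfun f"
  shows "wirtinger j (wirtinger k f) = wirtinger k (wirtinger j f)"
    and "wirtinger_bar j (wirtinger_bar k f) = wirtinger_bar k (wirtinger_bar j f)"
    and "wirtinger j (wirtinger_bar k f) = wirtinger_bar k (wirtinger j f)"
  using assms
proof (induction rule: polyfun.induct)
  case (mult f g)
  { case 1 then show ?case using mult by (simp add: wirtinger_rules algebra_simps) }
  { case 2 then show ?case using mult by (simp add: wirtinger_rules algebra_simps) }
  { case 3 then show ?case using mult by (simp add: wirtinger_rules algebra_simps) }
qed (auto simp: wirtinger_rules if_distrib)

lemma wirtinger_cnj:
  assumes "polyfun f"
  shows "wirtinger j (\<lambda>z. cnj (f z)) = (\<lambda>z. cnj (wirtinger_bar j f z))"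
    and "wirtinger_bar j (\<lambda>z. cnj (f z)) = (\<lambda>z. cnj (wirtinger j f z))"
  using assms
  by (induction rule: polyfun.induct) (auto simp: wirtinger_rules fun_eq_iff)

text \<open>A vector is the real combination of the vectors \<open>e\<^sub>k\<close> and \<open>\<i> e\<^sub>k\<close> with the real and imaginary parts of
its entries as coefficients; regrouping turns these parts into the entries and their conjugates.\<close>

lemma polyfun_has_derivative:
  fixes f :: "complex ^ 'd \<Rightarrow> complex"
  assumes "polyfun f"
  shows "(f has_derivative (\<lambda>v. \<Sum>k\<in>UNIV. v $ k * wirtinger k f z + cnj (v $ k) * wirtinger_bar k f z)) (at z)"
proof -
  let ?D = "frechet_derivative f (at z)"
  have D: "(f has_derivative ?D) (at z)"
    using polyfun_differentiable[OF assms] frechet_derivative_works by blast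
  then have lin: "linear ?D" by (rule has_derivative_linear)
  have eq: "?D = (\<lambda>v. \<Sum>k\<in>UNIV. v $ k * wirtinger k f z + cnj (v $ k) * wirtinger_bar k f z)"
  proof
    fix v :: "complex ^ 'd"
    have "v = (\<Sum>k\<in>UNIV. Re (v $ k) *\<^sub>R axis k 1 + Im (v $ k) *\<^sub>R axis k \<i>)"
      by (simp add: vec_eq_iff axis_def if_distrib complex_eq_iff cong: if_cong)
    from arg_cong[OF this, of ?D]
    have "?D v = (\<Sum>k\<in>UNIV. Re (v $ k) *\<^sub>R ?D (axis k 1) + Im (v $ k) *\<^sub>R ?D (axis k \<i>))"
      by (simp only: linear_sum[OF lin] linear_add[OF lin] linear_cmul[OF lin])
    also have "\<dots> = (\<Sum>k\<in>UNIV. v $ k * wirtinger k f z + cnj (v $ k) * wirtinger_bar k f z)"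
    proof (rule sum.cong, simp)
      fix k
      show "Re (v $ k) *\<^sub>R ?D (axis k 1) + Im (v $ k) *\<^sub>R ?D (axis k \<i>)
        = v $ k * wirtinger k f z + cnj (v $ k) * wirtinger_bar k f z"
        by (simp add: wirtinger_def wirtinger_bar_def complex_eq_iff field_simps)
    qed
    finally show "?D v = (\<Sum>k\<in>UNIV. v $ k * wirtinger k f z + cnj (v $ k) * wirtinger_bar k f z)" .
  qed
  show ?thesis using D unfolding eq .
qed

section \<open>Bihomogeneous polynomials and the infinitesimal unitary action\<close>

text \<open>The vector field \<open>z\<^sub>j \<partial>/\<partial>z\<^sub>k - cnj z\<^sub>k \<partial>/\<partial>cnj z\<^sub>j\<close>: the action of a matrix unit in the complexified Lie
algebra of the unitary group. It is a derivation and respects the bidegree.\<close>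

definition rot :: "'d \<Rightarrow> 'd \<Rightarrow> (complex ^ 'd \<Rightarrow> complex) \<Rightarrow> complex ^ 'd \<Rightarrow> complex" where
  "rot j k f = (\<lambda>z. z $ j * wirtinger k f z - cnj (z $ k) * wirtinger_bar j f z)"

lemma polyfun_rot: "polyfun f \<Longrightarrow> polyfun (rot j k f)"
  unfolding rot_def by (intro polyfun_intros)

lemma rot_const: "rot j k (\<lambda>z. c) = (\<lambda>z. 0)"
  by (simp add: rot_def)

lemma rot_add:
  "polyfun f \<Longrightarrow> polyfun g \<Longrightarrow> rot j k (\<lambda>z. f z + g z) = (\<lambda>z. rot j k f z + rot j k g z)"
  by (simp add: rot_def wirtinger_rules algebra_simps)

lemma rot_mult:
  "polyfun f \<Longrightarrow> polyfun g \<Longrightarrow> rot j k (\<lambda>z. f z * g z) = (\<lambda>z. rot j k f z * g z + f z * rot j k g z)"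
  by (simp add: rot_def wirtinger_rules algebra_simps)

lemma rot_cmult: "polyfun f \<Longrightarrow> rot j k (\<lambda>z. c * f z) = (\<lambda>z. c * rot j k f z)"
  by (simp add: rot_def wirtinger_cmult algebra_simps)

lemma rot_sum:
  "(\<And>i. i \<in> I \<Longrightarrow> polyfun (f i)) \<Longrightarrow> rot j k (\<lambda>z. \<Sum>i\<in>I. f i z) = (\<lambda>z. \<Sum>i\<in>I. rot j k (f i) z)"
  by (simp add: rot_def wirtinger_sum sum_distrib_left sum_subtractf)

lemma rot_cnj: "polyfun f \<Longrightarrow> rot j k (\<lambda>z. cnj (f z)) = (\<lambda>z. - cnj (rot k j f z))"
  by (simp add: rot_def wirtinger_cnj)

text \<open>The space \<open>bihomogeneous m n\<close> as an inductive predicate (see \<open>bihomogeneous_iff\<close>), so that statements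
about derivations go by rule induction instead of computation with multi-indices.\<close>

inductive bihom :: "nat \<Rightarrow> nat \<Rightarrow> (complex ^ 'd \<Rightarrow> complex) \<Rightarrow> bool" where
  zero: "bihom m n (\<lambda>z. 0)"
| const: "bihom 0 0 (\<lambda>z. c)"
| coord: "bihom 1 0 (\<lambda>z. z $ j)"
| cnj_coord: "bihom 0 1 (\<lambda>z. cnj (z $ j))"
| add: "bihom m n f \<Longrightarrow> bihom m n g \<Longrightarrow> bihom m n (\<lambda>z. f z + g z)"
| mult: "bihom m n f \<Longrightarrow> bihom m' n' g \<Longrightarrow> bihom (m + m') (n + n') (\<lambda>z. f z * g z)"

lemma bihom_polyfun: "bihom m n f \<Longrightarrow> polyfun f"
  by (induction rule: bihom.induct) (auto intro: polyfun_intros)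

lemma bihom_cmult: "bihom m n f \<Longrightarrow> bihom m n (\<lambda>z. c * f z)"
  using bihom.mult[OF bihom.const] by force

lemma bihom_power: "bihom m n f \<Longrightarrow> bihom (k * m) (k * n) (\<lambda>z. f z ^ k)"
  by (induction k) (auto intro: bihom.intros)

lemma bihom_prod:
  "(\<And>i. i \<in> I \<Longrightarrow> bihom (a i) (b i) (f i)) \<Longrightarrow> bihom (sum a I) (sum b I) (\<lambda>z. \<Prod>i\<in>I. f i z)"
  by (induction I rule: infinite_finite_induct) (auto intro: bihom.intros)

lemma bihom_cnj: "bihom m n f \<Longrightarrow> bihom n m (\<lambda>z. cnj (f z))"
  by (induction rule: bihom.induct) (auto intro: bihom.intros simp del: One_nat_def)

lemma bihom_rot: "bihom m n f \<Longrightarrow> bihom m n (rot j k f)"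
proof (induction rule: bihom.induct)
  case (coord i)
  have "rot j k (\<lambda>z. z $ i) = (\<lambda>z. if k = i then z $ j else 0)"
    by (auto simp: rot_def)
  then show ?case using bihom.coord[of j] bihom.zero[of 1 0] by (cases "k = i") simp_all
next
  case (cnj_coord i)
  have "rot j k (\<lambda>z. cnj (z $ i)) = (\<lambda>z. if j = i then (- 1) * cnj (z $ k) else 0)"
    by (auto simp: rot_def)
  then show ?case using bihom_cmult[OF bihom.cnj_coord[of k], of "-1"] bihom.zero[of 0 1]
    by (cases "j = i") simp_all
qed (auto simp: rot_const rot_add rot_mult bihom_polyfun intro: bihom.intros)

lemma bihom_euler:
  fixes f :: "complex ^ 'd \<Rightarrow> complex"
  assumes "bihom m n f"
  shows "(\<Sum>j\<in>UNIV. z $ j * wirtinger j f z) = of_nat m * f z"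
  using assms
proof (induction rule: bihom.induct)
  case (mult m n f m' n' g)
  have "(\<Sum>j\<in>UNIV. z $ j * wirtinger j (\<lambda>z. f z * g z) z)
     = (\<Sum>j\<in>UNIV. z $ j * wirtinger j f z) * g z + f z * (\<Sum>j\<in>UNIV. z $ j * wirtinger j g z)"
    by (simp add: wirtinger_mult mult.hyps[THEN bihom_polyfun] sum_distrib_left sum_distrib_right
        sum.distrib algebra_simps)
  with mult.IH show ?case by (simp add: algebra_simps)
qed (auto simp: if_distrib wirtinger_add bihom_polyfun sum.distrib algebra_simps cong: if_cong)

lemma bihom_euler_bar:
  fixes f :: "complex ^ 'd \<Rightarrow> complex"
  assumes "bihom m n f"
  shows "(\<Sum>j\<in>UNIV. cnj (z $ j) * wirtinger_bar j f z) = of_nat n * f z"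
  using arg_cong[OF bihom_euler[OF bihom_cnj[OF assms], of z], of cnj]
  by (simp add: wirtinger_cnj bihom_polyfun[OF assms])

lemma bimonomial_mult:
  "bimonomial \<alpha> \<beta> z * bimonomial \<alpha>' \<beta>' z = bimonomial (\<lambda>j. \<alpha> j + \<alpha>' j) (\<lambda>j. \<beta> j + \<beta>' j) z"
  by (simp add: bimonomial_def power_add prod.distrib[symmetric] algebra_simps)

lemma bihom_bimonomial:
  fixes \<alpha> \<beta> :: "'d::finite \<Rightarrow> nat"
  shows "bihom (sum \<alpha> UNIV) (sum \<beta> UNIV) (bimonomial \<alpha> \<beta>)"
proof -
  have "bihom (\<alpha> j) (\<beta> j) (\<lambda>z. (z $ j) ^ \<alpha> j * cnj (z $ j) ^ \<beta> j)" for j :: 'd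
    using bihom.mult[OF bihom_power[OF bihom.coord[of j], of "\<alpha> j"] bihom_power[OF bihom.cnj_coord[of j], of "\<beta> j"]]
    by simp
  then have "bihom (sum \<alpha> UNIV) (sum \<beta> UNIV) (\<lambda>z. \<Prod>j\<in>UNIV. (z $ j) ^ \<alpha> j * cnj (z $ j) ^ \<beta> j)"
    by (intro bihom_prod)
  then show ?thesis unfolding bimonomial_def .
qed

text \<open>Induction over a span, with sums and multiples written pointwise.\<close>

lemma span_cfun_induct [consumes 1, case_names zero step]:
  assumes "f \<in> cfun.span S" and "P (\<lambda>z. 0)"
    and "\<And>c g h. g \<in> S \<Longrightarrow> P h \<Longrightarrow> P (\<lambda>z. c * g z + h z)"
  shows "P f"
  using assms(1)
proof (induction rule: cfun.span_induct_alt)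
  case base
  then show ?case using assms(2) by (simp add: zero_fun_def)
next
  case (step c x y)
  then show ?case using assms(3)[of x y c] by (simp add: cscale_def plus_fun_def)
qed

lemma subspace_add_fun: "cfun.subspace V \<Longrightarrow> f \<in> V \<Longrightarrow> g \<in> V \<Longrightarrow> (\<lambda>z. f z + g z) \<in> V"
  and subspace_cmult_fun: "cfun.subspace V \<Longrightarrow> f \<in> V \<Longrightarrow> (\<lambda>z. c * f z) \<in> V"
  and subspace_diff_fun: "cfun.subspace V \<Longrightarrow> f \<in> V \<Longrightarrow> g \<in> V \<Longrightarrow> (\<lambda>z. f z - g z) \<in> V"
  using cfun.subspace_add[of V f g] cfun.subspace_scale[of V f c] cfun.subspace_diff[of V f g]
  by (simp_all add: plus_fun_def cscale_def fun_diff_def)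

lemma subspace_zero_fun: "cfun.subspace V \<Longrightarrow> (\<lambda>z. 0) \<in> V"
  using cfun.subspace_0[of V] by (simp add: zero_fun_def)

lemma subspace_sum_fun:
  "cfun.subspace V \<Longrightarrow> (\<And>i. i \<in> I \<Longrightarrow> f i \<in> V) \<Longrightarrow> (\<lambda>z. \<Sum>i\<in>I. c i * f i z) \<in> V"
  by (induction I rule: infinite_finite_induct)
    (auto intro!: subspace_zero_fun subspace_add_fun intro: subspace_cmult_fun)

text \<open>Products of monomials are monomials, so the spans of the monomials of fixed bidegree satisfy the
closure rules of \<open>bihom\<close>.\<close>

lemma bihomogeneous_iff: "f \<in> bihomogeneous m n \<longleftrightarrow> bihom m n f"
proof
  assume "f \<in> bihomogeneous m n"
  then show "bihom m n f"
    unfolding bihomogeneous_def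
    by (induction rule: span_cfun_induct)
       (auto intro!: bihom.intros bihom_cmult bihom_bimonomial)
next
  have sub: "cfun.subspace (bihomogeneous m n)" for m n
    unfolding bihomogeneous_def by (rule cfun.subspace_span)
  have mono: "bimonomial \<alpha> \<beta> \<in> bihomogeneous (sum \<alpha> UNIV) (sum \<beta> UNIV)" for \<alpha> \<beta> :: "'a \<Rightarrow> nat"
    unfolding bihomogeneous_def by (rule cfun.span_base) auto
  have mm: "(\<lambda>z. f z * g z) \<in> bihomogeneous (m + m') (n + n')"
    if f: "f \<in> bihomogeneous m n" and g: "g \<in> bihomogeneous m' n'"
    for m n m' n' and f g :: "complex ^ 'a \<Rightarrow> complex"
    using f[unfolded bihomogeneous_def]
  proof (induction rule: span_cfun_induct)
    case zero
    show ?case using subspace_zero_fun[OF sub] by simp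
  next
    case (step c x h)
    then obtain \<alpha> \<beta> where x: "x = bimonomial \<alpha> \<beta>" "sum \<alpha> UNIV = m" "sum \<beta> UNIV = n" by auto
    have "(\<lambda>z. x z * g z) \<in> bihomogeneous (m + m') (n + n')"
      using g[unfolded bihomogeneous_def]
    proof (induction rule: span_cfun_induct)
      case zero
      show ?case using subspace_zero_fun[OF sub] by simp
    next
      case (step c y h)
      then obtain \<gamma> \<delta> where y: "y = bimonomial \<gamma> \<delta>" "sum \<gamma> UNIV = m'" "sum \<delta> UNIV = n'" by auto
      have "(\<lambda>z. x z * y z) \<in> bihomogeneous (m + m') (n + n')"
        using mono[of "\<lambda>j. \<alpha> j + \<gamma> j" "\<lambda>j. \<beta> j + \<delta> j"] x y
        by (simp add: bimonomial_mult sum.distrib)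
      from subspace_add_fun[OF sub subspace_cmult_fun[OF sub this, of c] step.IH]
      show ?case by (simp add: algebra_simps)
    qed
    from subspace_add_fun[OF sub subspace_cmult_fun[OF sub this, of c] step.IH]
    show ?case by (simp add: algebra_simps)
  qed
  assume "bihom m n f"
  then show "f \<in> bihomogeneous m n"
  proof (induction rule: bihom.induct)
    case (const c)
    have "bimonomial (\<lambda>_. 0) (\<lambda>_. 0) = (\<lambda>z :: complex ^ 'a. 1)" by (auto simp: bimonomial_def)
    then show ?case
      using subspace_cmult_fun[OF sub mono[of "\<lambda>_. 0" "\<lambda>_. 0"], of c] by simp
  next
    case (coord j)
    have "bimonomial (\<lambda>i. if i = j then 1 else 0) (\<lambda>_. 0) = (\<lambda>z. z $ j)"
      by (auto simp: fun_eq_iff bimonomial_def if_distrib[of "power _"] cong: if_cong)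
    then show ?case using mono[of "\<lambda>i. if i = j then 1 else 0" "\<lambda>_. 0"] by simp
  next
    case (cnj_coord j)
    have "bimonomial (\<lambda>_. 0) (\<lambda>i. if i = j then 1 else 0) = (\<lambda>z. cnj (z $ j))"
      by (auto simp: fun_eq_iff bimonomial_def if_distrib[of "power _"] cong: if_cong)
    then show ?case using mono[of "\<lambda>_. 0" "\<lambda>i. if i = j then 1 else 0"] by simp
  qed (auto intro: subspace_zero_fun subspace_add_fun mm sub)
qed

section \<open>Harmonic polynomials and the Casimir operator\<close>

definition harm :: "nat \<Rightarrow> nat \<Rightarrow> (complex ^ 'd \<Rightarrow> complex) \<Rightarrow> bool" where
  "harm m n f \<longleftrightarrow> bihom m n f \<and> (\<lambda>z. \<Sum>j\<in>UNIV. wirtinger j (wirtinger_bar j f) z) = (\<lambda>z. 0)"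

lemma harmonics_eq: "harmonics m n = sphere_restrict ` {f. harm m n f}"
  by (simp add: harmonics_def harm_def bihomogeneous_iff complex_laplacian_def fun_eq_iff)

lemma harm_polyfun: "harm m n f \<Longrightarrow> polyfun f"
  by (auto simp: harm_def dest: bihom_polyfun)

text \<open>The commutator of the Laplacian with either summand of \<open>rot j k\<close> is the mixed derivative in \<open>z\<^sub>k\<close> and
\<open>cnj z\<^sub>j\<close>, and the two contributions cancel.\<close>

lemma harm_rot:
  assumes "harm m n f"
  shows "harm m n (rot j k f)"
proof -
  have p: "polyfun f" using assms by (rule harm_polyfun)
  have L: "(\<lambda>z. \<Sum>i\<in>UNIV. wirtinger i (wirtinger_bar i f) z) = (\<lambda>z. 0)"
    using assms by (simp add: harm_def)
  have 1: "(\<Sum>i\<in>UNIV. wirtinger i (wirtinger_bar i (wirtinger k f)) z) = 0" for z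
  proof -
    have "(\<Sum>i\<in>UNIV. wirtinger i (wirtinger_bar i (wirtinger k f)) z)
       = wirtinger k (\<lambda>z. \<Sum>i\<in>UNIV. wirtinger i (wirtinger_bar i f) z) z"
      by (simp add: wirtinger_sum polyfun_intros p wirtinger_commute)
    then show ?thesis by (simp add: L)
  qed
  have 2: "(\<Sum>i\<in>UNIV. wirtinger i (wirtinger_bar i (wirtinger_bar j f)) z) = 0" for z
  proof -
    have "(\<Sum>i\<in>UNIV. wirtinger i (wirtinger_bar i (wirtinger_bar j f)) z)
       = wirtinger_bar j (\<lambda>z. \<Sum>i\<in>UNIV. wirtinger i (wirtinger_bar i f) z) z"
      by (simp add: wirtinger_sum polyfun_intros p wirtinger_commute)
    then show ?thesis by (simp add: L)
  qed
  have "(\<Sum>i\<in>UNIV. wirtinger i (wirtinger_bar i (rot j k f)) z) =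
     (\<Sum>i\<in>UNIV. (if i = j then wirtinger_bar i (wirtinger k f) z else 0)
        - (if i = k then wirtinger i (wirtinger_bar j f) z else 0)
        + (z $ j * wirtinger i (wirtinger_bar i (wirtinger k f)) z
        - cnj (z $ k) * wirtinger i (wirtinger_bar i (wirtinger_bar j f)) z))" for z
    unfolding rot_def
    by (rule sum.cong)
       (auto simp: wirtinger_rules p if_distrib[of "\<lambda>f. f _"] algebra_simps wirtinger_commute)
  also have "\<dots> z = 0" for z
    by (simp only: sum.distrib sum_subtractf sum_distrib_left[symmetric] 1 2)
       (simp add: wirtinger_commute p)
  finally show ?thesis
    using assms bihom_rot by (auto simp: harm_def)
qed

lemma harm_cnj:
  assumes "harm m n f"
  shows "harm n m (\<lambda>z. cnj (f z))"
proof -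
  have p: "polyfun f" using assms by (rule harm_polyfun)
  have "(\<Sum>j\<in>UNIV. wirtinger j (wirtinger_bar j (\<lambda>z. cnj (f z))) z)
     = cnj (\<Sum>j\<in>UNIV. wirtinger j (wirtinger_bar j f) z)" for z
    by (simp add: wirtinger_cnj p polyfun_intros wirtinger_commute)
  moreover have "(\<Sum>j\<in>UNIV. wirtinger j (wirtinger_bar j f) z) = 0" for z
    using assms by (simp add: harm_def fun_eq_iff)
  ultimately show ?thesis
    using assms by (simp only: harm_def bihom_cnj complex_cnj_zero simp_thms)
qed

lemma rot_trace:
  assumes "bihom m n f"
  shows "(\<Sum>j\<in>UNIV. rot j j f z) = (of_nat m - of_nat n) * f z"
  using bihom_euler[OF assms, of z] bihom_euler_bar[OF assms, of z] by (simp add: rot_def sum_subtractf algebra_simps)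

text \<open>Differentiate Euler's identity and apply it once more.\<close>

lemma bihom_euler2:
  fixes f :: "complex ^ 'd \<Rightarrow> complex"
  assumes "bihom m n f"
  shows "(\<Sum>j\<in>UNIV. \<Sum>k\<in>UNIV. z $ j * z $ k * wirtinger j (wirtinger k f) z) = of_nat m * (of_nat m - 1) * f z"
proof -
  have p: "polyfun f" using assms by (rule bihom_polyfun)
  have *: "(\<Sum>k\<in>UNIV. z $ k * wirtinger j (wirtinger k f) z) = (of_nat m - 1) * wirtinger j f z" for j
  proof -
    have "(\<lambda>z. \<Sum>k\<in>UNIV. z $ k * wirtinger k f z) = (\<lambda>z. of_nat m * f z)"
      using bihom_euler[OF assms] by auto
    then have "wirtinger j (\<lambda>z. \<Sum>k\<in>UNIV. z $ k * wirtinger k f z) z = of_nat m * wirtinger j f z"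
      by (simp add: wirtinger_cmult p)
    moreover have "wirtinger j (\<lambda>z. \<Sum>k\<in>UNIV. z $ k * wirtinger k f z) z
        = (\<Sum>k\<in>UNIV. (if j = k then wirtinger k f z else 0) + z $ k * wirtinger j (wirtinger k f) z)"
      by (simp add: wirtinger_sum wirtinger_rules p) (rule sum.cong, auto)
    ultimately show ?thesis by (simp add: sum.distrib algebra_simps)
  qed
  have "(\<Sum>j\<in>UNIV. \<Sum>k\<in>UNIV. z $ j * z $ k * wirtinger j (wirtinger k f) z)
    = (\<Sum>j\<in>UNIV. z $ j * (\<Sum>k\<in>UNIV. z $ k * wirtinger j (wirtinger k f) z))"
    by (simp add: sum_distrib_left mult.assoc)
  also have "\<dots> = (of_nat m - 1) * (\<Sum>j\<in>UNIV. z $ j * wirtinger j f z)"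
    by (simp add: * sum_distrib_left algebra_simps)
  finally show ?thesis by (simp add: bihom_euler[OF assms])
qed

lemma bihom_euler2_bar:
  fixes f :: "complex ^ 'd \<Rightarrow> complex"
  assumes "bihom m n f"
  shows "(\<Sum>j\<in>UNIV. \<Sum>k\<in>UNIV. cnj (z $ j) * cnj (z $ k) * wirtinger_bar j (wirtinger_bar k f) z)
    = of_nat n * (of_nat n - 1) * f z"
  using arg_cong[OF bihom_euler2[OF bihom_cnj[OF assms], of z], of cnj]
  by (simp add: wirtinger_cnj polyfun_wirtinger_bar bihom_polyfun[OF assms])

definition casimir_value :: "nat \<Rightarrow> nat \<Rightarrow> nat \<Rightarrow> complex" where
  "casimir_value d m n = of_nat m * (of_nat m - 1 + of_nat d) + of_nat n * (of_nat n - 1 + of_nat d)"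

text \<open>By the product rule \<open>rot j k (rot k j f)\<close> is a sum of six terms. Summed over \<open>j\<close> and \<open>k\<close>, the two with
mixed second derivatives are multiples of the Laplacian of \<open>f\<close>, and Euler's identities evaluate the
other four.\<close>

lemma casimir:
  fixes f :: "complex ^ 'd \<Rightarrow> complex"
  assumes "harm m n f"
  shows "(\<Sum>j\<in>UNIV. \<Sum>k\<in>UNIV. rot j k (rot k j f) z) = casimir_value CARD('d) m n * f z"
proof -
  have p: "polyfun f" using assms by (rule harm_polyfun)
  have b: "bihom m n f" using assms by (simp add: harm_def)
  have L: "(\<Sum>i\<in>UNIV. wirtinger i (wirtinger_bar i f) z) = 0" for z
    using assms by (simp add: harm_def fun_eq_iff)
  have "rot j k (rot k j f) z =
      z $ j * wirtinger j f z + cnj (z $ k) * wirtinger_bar k f z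
      + z $ j * z $ k * wirtinger j (wirtinger k f) z
      + cnj (z $ j) * cnj (z $ k) * wirtinger_bar j (wirtinger_bar k f) z
      - z $ j * cnj (z $ j) * wirtinger k (wirtinger_bar k f) z
      - z $ k * cnj (z $ k) * wirtinger j (wirtinger_bar j f) z" for j k
    using p by (simp add: rot_def wirtinger_rules algebra_simps wirtinger_commute)
  then have "(\<Sum>j\<in>UNIV. \<Sum>k\<in>UNIV. rot j k (rot k j f) z) =
      of_nat CARD('d) * (\<Sum>j\<in>UNIV. z $ j * wirtinger j f z)
      + of_nat CARD('d) * (\<Sum>k\<in>UNIV. cnj (z $ k) * wirtinger_bar k f z)
      + (\<Sum>j\<in>UNIV. \<Sum>k\<in>UNIV. z $ j * z $ k * wirtinger j (wirtinger k f) z)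
      + (\<Sum>j\<in>UNIV. \<Sum>k\<in>UNIV. cnj (z $ j) * cnj (z $ k) * wirtinger_bar j (wirtinger_bar k f) z)
      - (\<Sum>j\<in>UNIV. z $ j * cnj (z $ j) * (\<Sum>k\<in>UNIV. wirtinger k (wirtinger_bar k f) z))
      - (\<Sum>k\<in>UNIV. z $ k * cnj (z $ k)) * (\<Sum>j\<in>UNIV. wirtinger j (wirtinger_bar j f) z)"
    by (simp add: sum.distrib sum_subtractf sum_distrib_left[symmetric] sum_distrib_right[symmetric])
  then show ?thesis
    unfolding L bihom_euler[OF b] bihom_euler_bar[OF b] bihom_euler2[OF b] bihom_euler2_bar[OF b] casimir_value_def by (simp add: algebra_simps)
qed

text \<open>On the bidegrees \<open>(m + t, n + t)\<close> the Casimir value is strictly monotone in \<open>t\<close>.\<close>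

lemma casimir_value_shift:
  assumes "casimir_value d m n = casimir_value d m' n'" "int m - int n = int m' - int n'" "d \<ge> 2"
  shows "m = m' \<and> n = n'"
proof -
  have *: "complex_of_int (int m * (int m - 1 + int d) + int n * (int n - 1 + int d)) =
     complex_of_int (int m' * (int m' - 1 + int d) + int n' * (int n' - 1 + int d))"
    using assms(1) by (simp add: casimir_value_def)
  define t where "t = int m' - int m"
  have t: "int m' = int m + t" "int n' = int n + t" using assms(2) by (auto simp: t_def)
  have "t * (2 * (int m + int d - 1) + 2 * int n + 2 * t) = 0"
    using * unfolding of_int_eq_iff t by (simp add: algebra_simps)
  moreover have "2 * (int m + int d - 1) + 2 * int n + 2 * t = int m + int n + int m' + int n' + 2 * (int d - 1)"
    using t by simp
  ultimately have "t = 0" using assms(3) by auto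
  with t show ?thesis by simp
qed

section \<open>Unitary invariance of the surface measure\<close>

lemma nn_integral_lborel_shift:
  fixes f :: "'a::euclidean_space \<Rightarrow> ennreal"
  assumes "f \<in> borel_measurable borel"
  shows "(\<integral>\<^sup>+x. f (c + x) \<partial>lborel) = (\<integral>\<^sup>+x. f x \<partial>lborel)"
  using nn_integral_distr[of "(+) c" lborel borel f] assms by (simp add: lborel_distr_plus)

text \<open>The image measure \<open>\<nu>\<close> of Lebesgue measure under \<open>T\<close> is invariant under translations. Let \<open>B\<close> be the unit
ball. Integrating the product of the indicators of \<open>T x + y \<in> A\<close> and \<open>y \<in> B\<close> in the two possible orders
gives \<open>\<nu>(A) \<bar>B\<bar> = \<bar>A\<bar> \<bar>B\<bar>\<close>: in the second order the translation \<open>y \<mapsto> y - T x\<close> turns the inner integral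
into the volume of the preimage of a unit ball, and isometries map unit balls to unit balls.\<close>

lemma lborel_orthogonal:
  fixes T :: "'a::euclidean_space \<Rightarrow> 'a"
  assumes T: "orthogonal_transformation T"
  shows "distr lborel borel T = lborel"
proof (rule measure_eqI)
  have lin: "linear T" by (rule orthogonal_transformation_linear[OF T])
  have mT [measurable]: "T \<in> borel_measurable borel"
    using linear_continuous_on[OF linear_conv_bounded_linear[THEN iffD1, OF lin]]
    by (simp add: borel_measurable_continuous_onI)
  fix A assume "A \<in> sets (distr lborel borel T)"
  then have A [measurable]: "A \<in> sets borel" by simp
  define B where "B = ball (0::'a) 1"
  have B [measurable]: "B \<in> sets borel" by (simp add: B_def)
  have shift: "(\<integral>\<^sup>+x. indicator A (T x) \<partial>lborel) = (\<integral>\<^sup>+x. indicator A (T x + y) \<partial>lborel)" for y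
  proof -
    obtain x0 where "y = T x0" using orthogonal_transformation_surj[OF T] by (metis surjD)
    then show ?thesis
      using nn_integral_lborel_shift[of "\<lambda>x. indicator A (T x)" x0]
      by (simp add: linear_add[OF lin] add.commute)
  qed
  have inner: "(\<integral>\<^sup>+x. indicator B (y - T x) \<partial>lborel) = emeasure lborel B" for y
  proof -
    obtain x0 where y: "y = T x0" using orthogonal_transformation_surj[OF T] by (metis surjD)
    have "indicator B (y - T x) = (indicator (ball x0 1) x :: ennreal)" for x
      using orthogonal_transformation_norm[OF T, of "x0 - x"] norm_minus_commute[of "T x0" "T x"]
      by (simp add: y B_def indicator_def dist_norm linear_diff[OF lin])
    then have "(\<integral>\<^sup>+x. indicator B (y - T x) \<partial>lborel) = emeasure lborel (ball x0 1)" by simp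
    also have "\<dots> = emeasure lborel B"
    proof -
      have "emeasure lborel (ball x0 1) = (\<integral>\<^sup>+x. indicator (ball x0 1) (x0 + x) \<partial>lborel)"
        using nn_integral_lborel_shift[of "indicator (ball x0 1)" x0] by (simp add: borel_measurable_indicator)
      also have "(\<lambda>x. indicator (ball x0 1) (x0 + x)) = (indicator B :: _ \<Rightarrow> ennreal)"
        by (auto simp: indicator_def B_def dist_norm fun_eq_iff)
      finally show ?thesis by simp
    qed
    finally show ?thesis .
  qed
  have "emeasure (distr lborel borel T) A = (\<integral>\<^sup>+x. indicator A (T x) \<partial>lborel)"
    using A by (subst nn_integral_distr[of T lborel borel "indicator A", symmetric]) simp_all
  then have "emeasure (distr lborel borel T) A * emeasure lborel B
      = (\<integral>\<^sup>+x. indicator A (T x) \<partial>lborel) * (\<integral>\<^sup>+y. indicator B y \<partial>lborel)"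
    by simp
  also have "\<dots> = (\<integral>\<^sup>+y. (\<integral>\<^sup>+x. indicator A (T x) \<partial>lborel) * indicator B y \<partial>lborel)"
    by (subst nn_integral_cmult) simp_all
  also have "\<dots> = (\<integral>\<^sup>+y. (\<integral>\<^sup>+x. indicator A (T x + y) * indicator B y \<partial>lborel) \<partial>lborel)"
    by (subst nn_integral_multc) (simp_all add: shift[symmetric])
  also have "\<dots> = (\<integral>\<^sup>+x. (\<integral>\<^sup>+y. indicator A (T x + y) * indicator B y \<partial>lborel) \<partial>lborel)"
    by (rule lborel_pair.Fubini') simp
  also have "\<dots> = (\<integral>\<^sup>+x. (\<integral>\<^sup>+y. indicator A y * indicator B (y - T x) \<partial>lborel) \<partial>lborel)"
  proof (rule nn_integral_cong)
    fix x
    show "(\<integral>\<^sup>+y. indicator A (T x + y) * indicator B y \<partial>lborel)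
       = (\<integral>\<^sup>+y. indicator A y * indicator B (y - T x) \<partial>lborel)"
      using nn_integral_lborel_shift[of "\<lambda>y. indicator A y * indicator B (y - T x)" "T x"] by simp
  qed
  also have "\<dots> = (\<integral>\<^sup>+y. (\<integral>\<^sup>+x. indicator A y * indicator B (y - T x) \<partial>lborel) \<partial>lborel)"
    by (rule lborel_pair.Fubini'[symmetric]) simp
  also have "\<dots> = (\<integral>\<^sup>+y. indicator A y * emeasure lborel B \<partial>lborel)"
    by (subst nn_integral_cmult) (simp_all add: inner)
  also have "\<dots> = emeasure lborel A * emeasure lborel B"
    by (subst nn_integral_multc) simp_all
  finally have eq: "emeasure (distr lborel borel T) A * emeasure lborel B = emeasure lborel A * emeasure lborel B" .
  have "emeasure lborel B \<noteq> \<infinity>" using emeasure_lborel_ball_finite[of "0::'a" 1] by (simp add: B_def)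
  moreover have "emeasure lborel B \<noteq> 0"
  proof
    assume "emeasure lborel B = 0"
    then have "B \<in> null_sets lborel" by (simp add: null_sets_def)
    then have "negligible B" by (simp add: negligible_iff_null_sets null_sets_completionI)
    then show False using open_not_negligible[of B] by (simp add: B_def)
  qed
  ultimately show "emeasure (distr lborel borel T) A = emeasure lborel A"
    using eq by (metis mult_divide_eq_ennreal infinity_ennreal_def)
qed simp

lemma surface_measurable_continuous:
  fixes f :: "complex ^ 'd \<Rightarrow> 'b::topological_space"
  assumes "continuous_on (sphere 0 1) f"
  shows "f \<in> borel_measurable surface_measure"
  using borel_measurable_continuous_on_restrict[OF assms]
  by (simp add: measurable_cong_sets[OF sets_surface_measure refl])

lemma sets_surface_measureD:
  assumes "A \<in> sets (surface_measure :: (complex ^ 'd) measure)"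
  shows "A \<in> sets borel" "A \<subseteq> sphere 0 1"
  using assms unfolding sets_surface_measure by (auto simp: sets_restrict_space_iff)

lemma cone_borel:
  fixes A :: "(complex ^ 'd) set"
  assumes "A \<in> sets borel"
  shows "{x \<in> cball 0 1 - {0}. x /\<^sub>R norm x \<in> A} \<in> sets borel"
proof -
  have "{x \<in> cball 0 1 - {0}. x /\<^sub>R norm x \<in> A}
     = (cball 0 1 - {0}) \<inter> ((\<lambda>x. x /\<^sub>R norm x) -` A \<inter> space borel)" by auto
  also have "\<dots> \<in> sets borel"
    using assms by (intro sets.Int measurable_sets[where A=borel and M=borel]) auto
  finally show ?thesis .
qed

text \<open>An orthogonal map commutes with \<open>x \<mapsto> x / \<bar>x\<bar>\<close> and hence maps the truncated cone over a preimage onto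
the truncated cone over the set.\<close>

lemma surface_measure_orthogonal:
  fixes T :: "complex ^ 'd \<Rightarrow> complex ^ 'd"
  assumes T: "orthogonal_transformation T"
  shows "T \<in> surface_measure \<rightarrow>\<^sub>M surface_measure"
    and "distr surface_measure surface_measure T = surface_measure"
proof -
  have lin: "linear T" by (rule orthogonal_transformation_linear[OF T])
  have nT: "norm (T x) = norm x" for x by (rule orthogonal_transformation_norm[OF T])
  have mT: "T \<in> borel_measurable borel"
    using linear_continuous_on[OF linear_conv_bounded_linear[THEN iffD1, OF lin]]
    by (simp add: borel_measurable_continuous_onI)
  show m: "T \<in> surface_measure \<rightarrow>\<^sub>M surface_measure"
    unfolding measurable_cong_sets[OF sets_surface_measure sets_surface_measure]
    by (rule measurable_restrict_space2)
       (auto simp: space_restrict_space nT mT intro!: measurable_restrict_space1)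
  show "distr surface_measure surface_measure T = surface_measure"
  proof (rule measure_eqI)
    fix A assume "A \<in> sets (distr surface_measure surface_measure T)"
    then have A': "A \<in> sets surface_measure" by simp
    note A = sets_surface_measureD[OF A']
    let ?B = "T -` A \<inter> space surface_measure"
    have "?B \<in> sets surface_measure" using m A' by (rule measurable_sets)
    note B = sets_surface_measureD[OF this]
    let ?C = "{x \<in> cball 0 1 - {0}. x /\<^sub>R norm x \<in> A}"
    have T0: "T x = 0 \<longleftrightarrow> x = 0" for x by (metis nT norm_eq_zero)
    have "{x \<in> cball 0 1 - {0}. x /\<^sub>R norm x \<in> ?B} = T -` ?C"
      using A(2) by (auto simp: nT T0 linear_cmul[OF lin])
    then have "emeasure (distr surface_measure surface_measure T) A
       = ennreal (2 * real CARD('d)) * emeasure lborel (T -` ?C)"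
      using emeasure_surface_measure[OF B] by (simp add: emeasure_distr[OF m A'])
    also have "emeasure lborel (T -` ?C) = emeasure (distr lborel borel T) ?C"
      using mT cone_borel[OF A(1)] by (subst emeasure_distr) simp_all
    also have "\<dots> = emeasure lborel ?C" by (simp add: lborel_orthogonal[OF T])
    finally show "emeasure (distr surface_measure surface_measure T) A = emeasure surface_measure A"
      using emeasure_surface_measure[OF A] by simp
  qed simp
qed

lemma integral_surface_orthogonal:
  fixes f :: "complex ^ 'd \<Rightarrow> complex" and T :: "complex ^ 'd \<Rightarrow> complex ^ 'd"
  assumes T: "orthogonal_transformation T" and f: "f \<in> borel_measurable surface_measure"
  shows "(\<integral>z. f (T z) \<partial>surface_measure) = (\<integral>z. f z \<partial>surface_measure)"
  using integral_distr[OF surface_measure_orthogonal(1)[OF T] f]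
  by (simp add: surface_measure_orthogonal(2)[OF T])

lemma finite_surface_measure: "finite_measure (surface_measure :: (complex ^ 'd) measure)"
proof
  have "{x \<in> cball 0 1 - {0}. x /\<^sub>R norm x \<in> sphere 0 1} \<subseteq> (cball 0 1 :: (complex ^ 'd) set)"
    by auto
  from emeasure_mono[OF this, of lborel]
  have "emeasure lborel {x \<in> cball 0 1 - {0 :: complex ^ 'd}. x /\<^sub>R norm x \<in> sphere 0 1}
      \<le> emeasure lborel (cball 0 1 :: (complex ^ 'd) set)" by simp
  also have "\<dots> < \<infinity>" by (rule emeasure_lborel_cball_finite)
  finally show "emeasure surface_measure (space surface_measure :: (complex ^ 'd) set) \<noteq> \<infinity>"
    using emeasure_surface_measure[of "sphere 0 1 :: (complex ^ 'd) set"]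
    by (simp add: ennreal_mult_eq_top_iff less_top)
qed

interpretation surface: finite_measure "surface_measure :: (complex ^ 'd) measure"
  by (rule finite_surface_measure)

definition area :: "'d::finite itself \<Rightarrow> real" where
  "area _ = measure (surface_measure :: (complex ^ 'd) measure) (sphere 0 1)"

lemma surface_integral_const: "(\<integral>z. (c :: complex) \<partial>(surface_measure :: (complex ^ 'd) measure)) = c * of_real (area TYPE('d))"
  "(\<integral>z. (r :: real) \<partial>(surface_measure :: (complex ^ 'd) measure)) = r * area TYPE('d)"
  by (simp_all add: area_def scaleR_conv_of_real)

lemma surface_integrable_continuous:
  fixes f :: "complex ^ 'd \<Rightarrow> 'b::{banach,second_countable_topology}"
  assumes "continuous_on (sphere 0 1) f"
  shows "integrable surface_measure f"
proof -
  have "compact (f ` sphere 0 1)" using assms by (intro compact_continuous_image) auto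
  then obtain B where B: "\<And>z. z \<in> sphere 0 1 \<Longrightarrow> norm (f z) \<le> B"
    by (metis (no_types, lifting) bounded_iff compact_imp_bounded imageI)
  show ?thesis
    by (rule surface.integrable_const_bound[where B = B])
       (auto intro!: surface_measurable_continuous assms AE_I2 simp: B)
qed

text \<open>The points where \<open>f\<close> does not vanish form a null set, but the cone over a neighbourhood of one such
point contains a nonempty open set.\<close>

lemma surface_integral_zero_imp_zero:
  fixes f :: "complex ^ 'd \<Rightarrow> real"
  assumes c: "continuous_on (sphere 0 1) f" and nn: "\<And>z. z \<in> sphere 0 1 \<Longrightarrow> 0 \<le> f z"
    and 0: "(\<integral>z. f z \<partial>surface_measure) = 0" and w: "w \<in> sphere 0 1"
  shows "f w = 0"
proof (rule ccontr)
  assume fw: "f w \<noteq> 0"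
  let ?A = "{z \<in> sphere 0 1. f z \<noteq> 0}"
  have meas: "f \<in> borel_measurable surface_measure" by (rule surface_measurable_continuous[OF c])
  have A: "?A \<in> sets surface_measure"
    using borel_measurable_neq[OF meas borel_measurable_const[of 0]] by simp
  have "AE z in surface_measure. f z = 0"
    using 0 nn by (subst (asm) integral_nonneg_eq_0_iff_AE)
      (auto intro!: surface_integrable_continuous c AE_I2)
  then have "emeasure surface_measure ?A = 0"
    using AE_iff_measurable[OF A, of "\<lambda>z. f z = 0"] by simp
  then have e0: "emeasure lborel {x \<in> cball 0 1 - {0}. x /\<^sub>R norm x \<in> ?A} = 0"
    using emeasure_surface_measure[OF sets_surface_measureD[OF A]] by simp
  let ?g = "\<lambda>x :: complex ^ 'd. f (x /\<^sub>R norm x)"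
  let ?U = "ball 0 1 - {0 :: complex ^ 'd}"
  have nrm: "norm (x /\<^sub>R norm x) = 1" if "x \<noteq> 0" for x :: "complex ^ 'd"
    using that by simp
  have im: "(\<lambda>x. x /\<^sub>R norm x) ` ?U \<subseteq> sphere 0 1"
  proof (rule image_subsetI)
    fix x :: "complex ^ 'd" assume "x \<in> ?U"
    then have "norm (x /\<^sub>R norm x) = 1" using nrm by blast
    then show "x /\<^sub>R norm x \<in> sphere 0 1" by (simp only: mem_sphere dist_0_norm)
  qed
  have cg: "continuous_on ?U ?g"
    by (rule continuous_on_compose2[OF c _ im]) (auto intro!: continuous_intros)
  have "openin (top_of_set ?U) (?U \<inter> ?g -` (- {0}))"
    by (rule continuous_openin_preimage_gen[OF cg]) auto
  then have op: "open (?U \<inter> ?g -` (- {0}))"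
    by (rule openin_open_trans) (auto intro: open_delete)
  have "(1/2) *\<^sub>R w \<in> ?U \<inter> ?g -` (- {0})"
    using w fw by auto
  then have "\<not> negligible (?U \<inter> ?g -` (- {0}))"
    using open_not_negligible[OF op] by blast
  moreover have "negligible (?U \<inter> ?g -` (- {0}))"
  proof -
    have "emeasure lborel (?U \<inter> ?g -` (- {0})) \<le> emeasure lborel {x \<in> cball 0 1 - {0}. x /\<^sub>R norm x \<in> ?A}"
    proof (rule emeasure_mono)
      show "?U \<inter> ?g -` (- {0}) \<subseteq> {x \<in> cball 0 1 - {0}. x /\<^sub>R norm x \<in> ?A}"
        using im ball_subset_cball[of "0 :: complex ^ 'd" 1] by blast
      show "{x \<in> cball 0 1 - {0}. x /\<^sub>R norm x \<in> ?A} \<in> sets lborel"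
        using cone_borel[OF sets_surface_measureD(1)[OF A]] by (simp only: sets_lborel)
    qed
    then have "emeasure lborel (?U \<inter> ?g -` (- {0})) = 0" by (simp only: e0 le_zero_eq)
    then have "?U \<inter> ?g -` (- {0}) \<in> null_sets lborel"
      using borel_open[OF op] by (simp only: null_sets_def mem_Collect_eq sets_lborel simp_thms)
    then show ?thesis
      by (simp add: negligible_iff_null_sets null_sets_completionI)
  qed
  ultimately show False by simp
qed

lemma area_pos: "area TYPE('d::finite) > 0"
proof (rule ccontr)
  assume "\<not> ?thesis"
  then have "area TYPE('d) = 0" by (metis area_def measure_nonneg order_le_less not_less)
  then have "(\<integral>z. (1::real) \<partial>(surface_measure :: (complex ^ 'd) measure)) = 0"
    by (subst surface_integral_const) simp
  from surface_integral_zero_imp_zero[OF continuous_on_const _ this, of "axis undefined 1"]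
  show False by (simp add: norm_eq_sqrt_inner inner_axis_axis)
qed

section \<open>Integrals of infinitesimal rotations vanish\<close>

text \<open>The constant dominates the difference quotients along a one-parameter group of unitary maps.\<close>

lemma polyfun_bounded_Lipschitz:
  fixes f :: "complex ^ 'd \<Rightarrow> complex"
  assumes "polyfun f"
  shows "\<exists>B\<ge>0. (\<forall>z\<in>sphere 0 1. norm (f z) \<le> B) \<and>
    (\<forall>z\<in>sphere 0 1. \<forall>w\<in>sphere 0 1. norm (f z - f w) \<le> B * norm (z - w))"
  using assms
proof (induction rule: polyfun.induct)
  case (const c)
  then show ?case by (intro exI[of _ "norm c"]) simp
next
  case (coord j)
  have 1: "norm (z $ j - w $ j) \<le> norm (z - w)" for z w :: "complex ^ 'd"
    using Finite_Cartesian_Product.norm_nth_le[of "z - w" j] by simp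
  have 2: "norm (z $ j) \<le> norm z" for z :: "complex ^ 'd"
    by (rule Finite_Cartesian_Product.norm_nth_le)
  show ?case
  proof (intro exI[of _ 1] conjI ballI)
    show "norm (z $ j) \<le> 1" if "z \<in> sphere 0 1" for z :: "complex ^ 'd" using that 2[of z] by simp
  qed (use 1 in simp_all)
next
  case (cnj_coord j)
  have 1: "norm (cnj (z $ j) - cnj (w $ j)) \<le> norm (z - w)" for z w :: "complex ^ 'd"
    using Finite_Cartesian_Product.norm_nth_le[of "z - w" j]
    by (metis complex_cnj_diff complex_mod_cnj vector_minus_component)
  have 2: "norm (cnj (z $ j)) \<le> norm z" for z :: "complex ^ 'd"
    using Finite_Cartesian_Product.norm_nth_le[of z j] by simp
  show ?case
  proof (intro exI[of _ 1] conjI ballI)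
    show "norm (cnj (z $ j)) \<le> 1" if "z \<in> sphere 0 1" for z :: "complex ^ 'd" using that 2[of z] by simp
  qed (use 1 in simp_all)
next
  case (add f g)
  then obtain B C where B: "B \<ge> 0" "\<And>z. z \<in> sphere 0 1 \<Longrightarrow> norm (f z) \<le> B"
      "\<And>z w. z \<in> sphere 0 1 \<Longrightarrow> w \<in> sphere 0 1 \<Longrightarrow> norm (f z - f w) \<le> B * norm (z - w)"
    and C: "C \<ge> 0" "\<And>z. z \<in> sphere 0 1 \<Longrightarrow> norm (g z) \<le> C"
      "\<And>z w. z \<in> sphere 0 1 \<Longrightarrow> w \<in> sphere 0 1 \<Longrightarrow> norm (g z - g w) \<le> C * norm (z - w)"
    by metis
  show ?case
  proof (intro exI[of _ "B + C"] conjI ballI)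
    fix z w :: "complex ^ 'd" assume z: "z \<in> sphere 0 1" and w: "w \<in> sphere 0 1"
    have "norm (f z + g z - (f w + g w)) \<le> norm (f z - f w) + norm (g z - g w)"
      by (metis add_diff_add norm_triangle_ineq)
    with B(3)[OF z w] C(3)[OF z w]
    show "norm (f z + g z - (f w + g w)) \<le> (B + C) * norm (z - w)"
      by (simp add: algebra_simps)
  qed (use B C in \<open>auto intro!: norm_triangle_mono simp del: mem_sphere\<close>)
next
  case (mult f g)
  then obtain B C where B: "B \<ge> 0" "\<And>z. z \<in> sphere 0 1 \<Longrightarrow> norm (f z) \<le> B"
      "\<And>z w. z \<in> sphere 0 1 \<Longrightarrow> w \<in> sphere 0 1 \<Longrightarrow> norm (f z - f w) \<le> B * norm (z - w)"
    and C: "C \<ge> 0" "\<And>z. z \<in> sphere 0 1 \<Longrightarrow> norm (g z) \<le> C"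
      "\<And>z w. z \<in> sphere 0 1 \<Longrightarrow> w \<in> sphere 0 1 \<Longrightarrow> norm (g z - g w) \<le> C * norm (z - w)"
    by metis
  show ?case
  proof (intro exI[of _ "2 * (B * C)"] conjI ballI)
    fix z :: "complex ^ 'd" assume z: "z \<in> sphere 0 1"
    have "norm (f z) * norm (g z) \<le> B * C" using B(2)[OF z] C(2)[OF z] B(1) by (intro mult_mono) auto
    moreover have "0 \<le> B * C" using B(1) C(1) by simp
    ultimately show "norm (f z * g z) \<le> 2 * (B * C)" unfolding norm_mult by linarith
  next
    fix z w :: "complex ^ 'd" assume z: "z \<in> sphere 0 1" and w: "w \<in> sphere 0 1"
    have "f z * g z - f w * g w = (f z - f w) * g z + f w * (g z - g w)"
      by (simp add: algebra_simps)
    then have "norm (f z * g z - f w * g w) \<le> norm (f z - f w) * norm (g z) + norm (f w) * norm (g z - g w)"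
      by (metis norm_mult norm_triangle_ineq)
    also have "\<dots> \<le> (B * norm (z - w)) * C + B * (C * norm (z - w))"
      using B C z w by (intro add_mono mult_mono) auto
    finally show "norm (f z * g z - f w * g w) \<le> 2 * (B * C) * norm (z - w)"
      by (simp add: algebra_simps)
  qed (use B C in simp)
qed

definition cip :: "complex ^ 'd \<Rightarrow> complex ^ 'd \<Rightarrow> complex" where
  "cip z u = (\<Sum>j\<in>UNIV. z $ j * cnj (u $ j))"

text \<open>The complex reflection that multiplies the direction of a unit vector \<open>u\<close> by \<open>\<omega>\<close> and fixes its orthogonal
complement. For \<open>\<omega> = cis t\<close> these maps form a one-parameter group with generator \<open>z \<mapsto> \<i> (cip z u) u\<close>;
by polarisation, these generators suffice to reach every \<open>rot j k\<close>.\<close>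

definition reflection :: "complex ^ 'd \<Rightarrow> complex \<Rightarrow> complex ^ 'd \<Rightarrow> complex ^ 'd" where
  "reflection u \<omega> z = (\<chi> j. z $ j + (\<omega> - 1) * cip z u * u $ j)"

lemma norm_eq_cip: "complex_of_real ((norm z)\<^sup>2) = cip z z"
proof -
  have "(norm z)\<^sup>2 = (\<Sum>j\<in>UNIV. Re (z $ j) * Re (z $ j) + Im (z $ j) * Im (z $ j))"
    by (simp only: power2_norm_eq_inner inner_vec_def inner_complex_def)
  then show ?thesis by (simp only:) (simp add: cip_def complex_eq_iff)
qed

lemma cip_add: "cip (z + w) u = cip z u + cip w u"
  by (simp add: cip_def sum.distrib algebra_simps)

lemma cip_scaleR: "cip (r *\<^sub>R z) u = r *\<^sub>R cip z u"
  by (simp add: cip_def scaleR_sum_right)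

lemma reflection_orthogonal:
  fixes u :: "complex ^ 'd"
  assumes u: "norm u = 1" and w: "norm \<omega> = 1"
  shows "orthogonal_transformation (reflection u \<omega>)"
  unfolding orthogonal_transformation
proof (intro conjI allI)
  show "linear (reflection u \<omega>)"
    by (rule linearI) (simp_all add: reflection_def cip_add cip_scaleR vec_eq_iff algebra_simps)
  fix z :: "complex ^ 'd"
  define s where "s = cip z u"
  define c where "c = \<omega> - 1"
  have uu: "(\<Sum>j\<in>UNIV. u $ j * cnj (u $ j)) = 1"
    using norm_eq_cip[of u] u by (simp add: cip_def)
  have ss: "(\<Sum>j\<in>UNIV. u $ j * cnj (z $ j)) = cnj s"
    by (simp add: s_def cip_def mult.commute)
  have "\<omega> * cnj \<omega> = 1" using w by (simp add: complex_norm_square[symmetric])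
  then have c: "c + cnj c + c * cnj c = 0" by (simp add: c_def algebra_simps)
  have "cip (reflection u \<omega> z) (reflection u \<omega> z) =
     (\<Sum>j\<in>UNIV. z $ j * cnj (z $ j) + (cnj c * cnj s) * (z $ j * cnj (u $ j))
        + (c * s) * (u $ j * cnj (z $ j)) + (c * s * cnj c * cnj s) * (u $ j * cnj (u $ j)))"
    unfolding reflection_def s_def[symmetric] c_def[symmetric] unfolding cip_def
    by (rule sum.cong) (simp_all add: algebra_simps)
  also have "\<dots> = cip z z + (cnj c * cnj s) * s + (c * s) * cnj s + c * s * cnj c * cnj s"
    by (simp add: sum.distrib sum_distrib_left[symmetric] uu ss) (simp add: cip_def s_def)
  also have "\<dots> = cip z z + (c + cnj c + c * cnj c) * (s * cnj s)" by (simp add: algebra_simps)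
  finally have "cip (reflection u \<omega> z) (reflection u \<omega> z) = cip z z" by (simp add: c)
  then have "(norm (reflection u \<omega> z))\<^sup>2 = (norm z)\<^sup>2"
    unfolding norm_eq_cip[symmetric] of_real_eq_iff .
  then show "norm (reflection u \<omega> z) = norm z" by simp
qed

lemma tendsto_difference_quotient:
  fixes g :: "real \<Rightarrow> 'a::real_normed_vector"
  assumes "(g has_derivative (\<lambda>h. h *\<^sub>R G)) (at 0)"
  shows "(\<lambda>n. real (Suc n) *\<^sub>R (g (1 / real (Suc n)) - g 0)) \<longlonglongrightarrow> G"
proof -
  have "((\<lambda>h. norm (g (0 + h) - g 0 - h *\<^sub>R G) / norm h) \<longlongrightarrow> 0) (at 0)"
    using assms by (simp add: has_derivative_at)
  moreover have "filterlim (\<lambda>n. 1 / real (Suc n)) (at 0) sequentially"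
    using LIMSEQ_inverse_real_of_nat by (auto simp: filterlim_at inverse_eq_divide)
  ultimately have "(\<lambda>n. norm (g (0 + 1 / real (Suc n)) - g 0 - (1 / real (Suc n)) *\<^sub>R G) / norm (1 / real (Suc n))) \<longlonglongrightarrow> 0"
    by (rule filterlim_compose)
  moreover have "norm (g (0 + 1 / real (Suc n)) - g 0 - (1 / real (Suc n)) *\<^sub>R G) / norm (1 / real (Suc n))
      = norm (real (Suc n) *\<^sub>R (g (1 / real (Suc n)) - g 0) - G)" for n
  proof -
    have *: "norm (a - (1 / k) *\<^sub>R G) / norm (1 / k) = norm (k *\<^sub>R a - G)" if "k > 0" for k :: real and a :: 'a
    proof -
      have "k *\<^sub>R a - G = k *\<^sub>R (a - (1 / k) *\<^sub>R G)" using that by (simp add: scaleR_diff_right)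
      then show ?thesis using that by simp
    qed
    show ?thesis by (simp only: add_0 *[of "real (Suc n)"] of_nat_0_less_iff zero_less_Suc)
  qed
  ultimately have "(\<lambda>n. norm (real (Suc n) *\<^sub>R (g (1 / real (Suc n)) - g 0) - G)) \<longlonglongrightarrow> 0"
    by (simp only:)
  then show ?thesis by (rule LIM_zero_cancel[OF tendsto_norm_zero_cancel])
qed

lemma norm_cis_minus_one: "norm (cis t - 1) \<le> \<bar>t\<bar>"
  using dist_exp_i_1[of t] abs_sin_x_le_abs_x[of "t / 2"] by (simp add: cis_conv_exp)

text \<open>The integral of \<open>f\<close> composed with the reflection of angle \<open>t\<close> does not depend on \<open>t\<close>. Its difference
quotients at \<open>0\<close> converge, by dominated convergence, to the integral of the derivative of \<open>f\<close> along the
generator.\<close>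

lemma surface_integral_rot_unit:
  fixes f :: "complex ^ 'd \<Rightarrow> complex"
  assumes f: "polyfun f" and u: "norm u = 1"
  shows "(\<integral>z. (\<Sum>j\<in>UNIV. \<Sum>k\<in>UNIV. cnj (u $ j) * u $ k * rot j k f z) \<partial>surface_measure) = 0"
proof -
  define T where "T t = reflection u (cis t)" for t
  define G where "G z = \<i> * (\<Sum>j\<in>UNIV. \<Sum>k\<in>UNIV. cnj (u $ j) * u $ k * rot j k f z)" for z
  have T: "orthogonal_transformation (T t)" for t
    unfolding T_def using u by (intro reflection_orthogonal) auto
  have T0: "T 0 z = z" for z by (simp add: T_def reflection_def)
  have dT: "((\<lambda>t. T t z) has_derivative (\<lambda>h. h *\<^sub>R (\<chi> j. \<i> * cip z u * u $ j))) (at 0)" for z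
  proof -
    define L where "L c = (\<chi> j. c * cip z u * u $ j)" for c
    have "linear L"
      by (rule linearI) (simp_all add: L_def vec_eq_iff algebra_simps)
    then have L: "bounded_linear L" by (simp add: linear_conv_bounded_linear)
    have cis: "((\<lambda>t. cis t - 1) has_derivative (\<lambda>h. h *\<^sub>R \<i>)) (at 0)"
    proof -
      have 1: "((\<lambda>t. \<i> * complex_of_real t) has_derivative (\<lambda>h. \<i> * of_real h)) (at 0)"
        by (intro has_derivative_mult_right has_derivative_of_real has_derivative_ident)
      have 2: "(exp has_derivative (*) (exp (\<i> * complex_of_real 0))) (at (\<i> * complex_of_real 0))"
        using DERIV_exp[unfolded has_field_derivative_def] .
      have 3: "((\<lambda>t. exp (\<i> * complex_of_real t)) has_derivative
          (\<lambda>h. exp (\<i> * complex_of_real 0) * (\<i> * of_real h))) (at 0)"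
        by (rule has_derivative_compose[OF 1 2])
      show ?thesis
        using has_derivative_diff[OF 3 has_derivative_const[of 1]]
        by (simp add: cis_conv_exp scaleR_conv_of_real mult.commute)
    qed
    have "((\<lambda>t. z + L (cis t - 1)) has_derivative (\<lambda>h. 0 + L (h *\<^sub>R \<i>))) (at 0)"
      by (intro has_derivative_add has_derivative_const bounded_linear.has_derivative[OF L cis])
    moreover have "T t z = z + L (cis t - 1)" for t
      by (simp add: T_def reflection_def L_def vec_eq_iff)
    ultimately show ?thesis by (simp add: linear_cmul[OF \<open>linear L\<close>]) (simp add: L_def)
  qed
  have dG: "((\<lambda>t. f (T t z)) has_derivative (\<lambda>h. h *\<^sub>R G z)) (at 0)" for z
  proof -
    let ?F = "\<lambda>v. \<Sum>k\<in>UNIV. v $ k * wirtinger k f z + cnj (v $ k) * wirtinger_bar k f z"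
    let ?v = "(\<chi> j. \<i> * cip z u * u $ j) :: complex ^ 'd"
    have F: "(f has_derivative ?F) (at (T 0 z))" unfolding T0 by (rule polyfun_has_derivative[OF f])
    have "((\<lambda>t. f (T t z)) has_derivative (\<lambda>h. ?F (h *\<^sub>R ?v))) (at 0)"
      by (rule has_derivative_compose[OF dT F])
    moreover have "?F (h *\<^sub>R ?v) = h *\<^sub>R ?F ?v" for h
      unfolding vector_scaleR_component by (simp add: scaleR_sum_right algebra_simps)
    moreover have "?F ?v = G z"
    proof -
      have "?F ?v = \<i> * ((\<Sum>k\<in>UNIV. cip z u * u $ k * wirtinger k f z)
          - (\<Sum>j\<in>UNIV. cnj (cip z u) * cnj (u $ j) * wirtinger_bar j f z))"
        by (simp add: sum_distrib_left sum_subtractf algebra_simps sum.distrib sum_negf)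
      also have "(\<Sum>k\<in>UNIV. cip z u * u $ k * wirtinger k f z)
         = (\<Sum>j\<in>UNIV. \<Sum>k\<in>UNIV. cnj (u $ j) * u $ k * (z $ j * wirtinger k f z))"
        unfolding cip_def sum_distrib_right by (subst sum.swap) (simp add: algebra_simps)
      also have "(\<Sum>j\<in>UNIV. cnj (cip z u) * cnj (u $ j) * wirtinger_bar j f z)
         = (\<Sum>j\<in>UNIV. \<Sum>k\<in>UNIV. cnj (u $ j) * u $ k * (cnj (z $ k) * wirtinger_bar j f z))"
        by (simp add: cip_def sum_distrib_right sum_distrib_left algebra_simps)
      finally show ?thesis
        by (simp add: G_def rot_def sum_subtractf right_diff_distrib)
    qed
    ultimately show ?thesis by simp
  qed
  obtain B where B: "B \<ge> 0"
    "\<And>z w. z \<in> sphere 0 1 \<Longrightarrow> w \<in> sphere 0 1 \<Longrightarrow> norm (f z - f w) \<le> B * norm (z - w)"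
    using polyfun_bounded_Lipschitz[OF f] by metis
  obtain K where K: "K \<ge> 0" "\<And>z. z \<in> sphere 0 1 \<Longrightarrow> norm (cip z u) \<le> K"
  proof -
    have "polyfun (\<lambda>z. cip z u)" unfolding cip_def by (intro polyfun_intros)
    then show ?thesis using polyfun_bounded_Lipschitz that by metis
  qed
  have dist: "norm (T t z - z) \<le> \<bar>t\<bar> * K" if "z \<in> sphere 0 1" for t z
  proof -
    have "T t z - z = (\<chi> j. (cis t - 1) * cip z u * u $ j)"
      by (simp add: T_def reflection_def vec_eq_iff)
    moreover have "norm (\<chi> j. c * u $ j) = norm c" for c
    proof -
      have "cip (\<chi> j. c * u $ j) (\<chi> j. c * u $ j) = (c * cnj c) * cip u u"
        by (simp add: cip_def sum_distrib_left algebra_simps)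
      also have "\<dots> = complex_of_real ((norm c)\<^sup>2)"
        by (simp only: norm_eq_cip[of u, symmetric] u complex_norm_square[symmetric]) simp
      finally have "(norm (\<chi> j. c * u $ j))\<^sup>2 = (norm c)\<^sup>2"
        unfolding norm_eq_cip[symmetric] of_real_eq_iff .
      then show ?thesis by simp
    qed
    ultimately have "norm (T t z - z) = norm (cis t - 1) * norm (cip z u)" by (simp add: norm_mult)
    also have "\<dots> \<le> \<bar>t\<bar> * K" using norm_cis_minus_one K(2)[OF that] by (intro mult_mono) auto
    finally show ?thesis .
  qed
  define q where "q n z = real (Suc n) *\<^sub>R (f (T (1 / real (Suc n)) z) - f z)" for n z
  have mf: "f \<in> borel_measurable surface_measure"
    by (intro surface_measurable_continuous polyfun_continuous f)
  have mfT: "(\<lambda>z. f (T t z)) \<in> borel_measurable surface_measure" for t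
    using measurable_compose[OF surface_measure_orthogonal(1)[OF T] mf] .
  have intf: "integrable surface_measure f"
    by (intro surface_integrable_continuous polyfun_continuous f)
  have intfT: "integrable surface_measure (\<lambda>z. f (T t z))" for t
  proof -
    have "integrable (distr surface_measure surface_measure (T t)) f"
      using intf by (simp add: surface_measure_orthogonal(2)[OF T])
    then show ?thesis using integrable_distr[OF surface_measure_orthogonal(1)[OF T]] by blast
  qed
  have "(\<lambda>n. \<integral>z. q n z \<partial>surface_measure) \<longlonglongrightarrow> (\<integral>z. G z \<partial>surface_measure)"
  proof (rule integral_dominated_convergence)
    show "G \<in> borel_measurable surface_measure"
      unfolding G_def by (intro surface_measurable_continuous polyfun_continuous polyfun_intros polyfun_rot f)
    show "q n \<in> borel_measurable surface_measure" for n
      unfolding q_def by (intro borel_measurable_scaleR borel_measurable_diff mf mfT borel_measurable_const)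
    show "integrable surface_measure (\<lambda>z :: complex ^ 'd. B * K)" by simp
    show "AE z in surface_measure. (\<lambda>n. q n z) \<longlonglongrightarrow> G z"
      unfolding q_def using tendsto_difference_quotient[OF dG] by (simp add: T0)
    show "AE z in surface_measure. norm (q n z) \<le> B * K" for n
    proof (rule AE_I2)
      fix z :: "complex ^ 'd" assume "z \<in> space surface_measure"
      then have z: "z \<in> sphere 0 1" by simp
      then have Tz: "T t z \<in> sphere 0 1" for t
        using orthogonal_transformation_norm[OF T, of t z] by simp
      have "norm (f (T (1 / real (Suc n)) z) - f z) \<le> B * norm (T (1 / real (Suc n)) z - z)"
        by (rule B(2)[OF Tz z])
      also have "\<dots> \<le> B * (\<bar>1 / real (Suc n)\<bar> * K)" by (intro mult_left_mono dist z B(1))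
      finally show "norm (q n z) \<le> B * K" 
        unfolding q_def norm_scaleR by (simp add: field_simps del: of_nat_Suc)
    qed
  qed
  moreover have "(\<integral>z. q n z \<partial>surface_measure) = 0" for n
    unfolding q_def using intf intfT integral_surface_orthogonal[OF T mf] by simp
  ultimately have "(\<integral>z. G z \<partial>surface_measure) = 0" by (simp add: LIMSEQ_const_iff)
  then show ?thesis unfolding G_def by simp
qed

text \<open>A sesquilinear form that vanishes on the diagonal is zero: evaluate at \<open>e\<^sub>j\<close>, \<open>e\<^sub>j + e\<^sub>k\<close> and \<open>e\<^sub>j + \<i> e\<^sub>k\<close>.\<close>

lemma surface_integral_rot:
  fixes f :: "complex ^ 'd \<Rightarrow> complex"
  assumes f: "polyfun f"
  shows "(\<integral>z. rot j k f z \<partial>surface_measure) = 0"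
proof -
  define M where "M j k = (\<integral>z. rot j k f z \<partial>surface_measure)" for j k
  have int: "integrable surface_measure (\<lambda>z. c * rot j k f z)" for c j k
    by (intro surface_integrable_continuous polyfun_continuous polyfun_intros polyfun_rot f)
  have Q: "(\<Sum>j\<in>UNIV. \<Sum>k\<in>UNIV. cnj (u $ j) * u $ k * M j k) = 0" for u :: "complex ^ 'd"
  proof (cases "u = 0")
    case False
    define v where "v = u /\<^sub>R norm u"
    have u: "u $ j = of_real (norm u) * v $ j" for j
      unfolding v_def vector_scaleR_component using False by (simp add: scaleR_conv_of_real)
    have "norm v = 1" using False by (simp add: v_def)
    from surface_integral_rot_unit[OF f this]
    have "(\<Sum>j\<in>UNIV. \<Sum>k\<in>UNIV. cnj (v $ j) * v $ k * M j k) = 0"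
      unfolding M_def by (simp add: Bochner_Integration.integral_sum int Bochner_Integration.integrable_sum)
    moreover have "(\<Sum>j\<in>UNIV. \<Sum>k\<in>UNIV. cnj (u $ j) * u $ k * M j k)
       = of_real (norm u) * of_real (norm u) * (\<Sum>j\<in>UNIV. \<Sum>k\<in>UNIV. cnj (v $ j) * v $ k * M j k)"
      unfolding u by (simp add: sum_distrib_left mult_ac)
    ultimately show ?thesis by simp
  qed simp
  have diag: "M j j = 0" for j
  proof -
    have 1: "(\<Sum>i\<in>UNIV. g i) = g j" if "\<And>i. i \<noteq> j \<Longrightarrow> g i = 0" for g :: "'d \<Rightarrow> complex"
      using that sum.mono_neutral_right[of UNIV "{j}" g] by simp
    show ?thesis
      using Q[of "axis j 1"] by (subst (asm) 1, simp add: axis_def, subst (asm) 1) (simp_all add: axis_def)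
  qed
  have off: "M j k = 0" if "j \<noteq> k"
  proof -
    have *: "(\<Sum>i\<in>UNIV. \<Sum>l\<in>UNIV. cnj (u $ i) * u $ l * M i l) =
        cnj (u $ j) * u $ k * M j k + cnj (u $ k) * u $ j * M k j"
      if "\<And>i. i \<noteq> j \<Longrightarrow> i \<noteq> k \<Longrightarrow> u $ i = 0" for u :: "complex ^ 'd"
    proof -
      have 1: "(\<Sum>i\<in>UNIV. g i) = g j + g k" if "\<And>i. i \<noteq> j \<Longrightarrow> i \<noteq> k \<Longrightarrow> g i = 0" for g :: "'d \<Rightarrow> complex"
      proof -
        have "(\<Sum>i\<in>UNIV. g i) = (\<Sum>i\<in>{j, k}. g i)"
          using that by (intro sum.mono_neutral_right) auto
        then show ?thesis using \<open>j \<noteq> k\<close> by simp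
      qed
      show ?thesis using that
        by (subst 1, simp, subst 1, simp, subst 1, simp) (simp add: diag)
    qed
    have "M j k + M k j = 0"
      using Q[of "axis j 1 + axis k 1"] *[of "axis j 1 + axis k 1"] that by (simp add: axis_def)
    moreover have "\<i> * M j k - \<i> * M k j = 0"
      using Q[of "axis j 1 + axis k \<i>"] *[of "axis j 1 + axis k \<i>"] that by (simp add: axis_def)
    ultimately show ?thesis by (simp add: algebra_simps add_eq_0_iff)
  qed
  show ?thesis using diag off unfolding M_def by (cases "j = k") auto
qed

lemma surface_integral_rot_by_parts:
  assumes "polyfun f" "polyfun g"
  shows "(\<integral>z. rot j k f z * g z \<partial>surface_measure) = - (\<integral>z. f z * rot j k g z \<partial>surface_measure)"
proof -
  have "(\<integral>z. rot j k f z * g z + f z * rot j k g z \<partial>surface_measure) = 0"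
    using surface_integral_rot[OF polyfun.mult[OF assms], of j k] by (simp add: rot_mult assms)
  moreover have "integrable surface_measure (\<lambda>z. rot j k f z * g z)" "integrable surface_measure (\<lambda>z. f z * rot j k g z)"
    by (intro surface_integrable_continuous polyfun_continuous polyfun_intros polyfun_rot assms)+
  ultimately show ?thesis by (simp add: eq_neg_iff_add_eq_0)
qed

text \<open>The conjugate \<open>h\<close> of \<open>g\<close> is harmonic of bidegree \<open>(n', m')\<close>. Moving \<open>\<Sum> rot j j\<close>, which multiplies \<open>f\<close> by
\<open>m - n\<close> and \<open>h\<close> by \<open>n' - m'\<close>, from \<open>f\<close> to \<open>h\<close> shows that the integral vanishes unless
\<open>m - n = m' - n'\<close>. Moving the Casimir operator, the product of two operators \<open>rot\<close>, shows that it
vanishes unless the Casimir values agree.\<close>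

lemma harm_orthogonal:
  fixes f g :: "complex ^ 'd \<Rightarrow> complex"
  assumes f: "harm m n f" and g: "harm m' n' g" and ne: "(m, n) \<noteq> (m', n')" and d: "CARD('d) \<ge> 2"
  shows "(\<integral>z. f z * cnj (g z) \<partial>surface_measure) = 0"
proof -
  define h where "h = (\<lambda>z. cnj (g z))"
  have h: "harm n' m' h" unfolding h_def by (rule harm_cnj[OF g])
  have pf: "polyfun f" and ph: "polyfun h" using f h by (auto dest: harm_polyfun)
  define I where "I = (\<integral>z. f z * h z \<partial>surface_measure)"
  note int = surface_integrable_continuous[OF polyfun_continuous]
  have "(\<integral>z. (\<Sum>j\<in>UNIV. rot j j f z) * h z \<partial>surface_measure) = - (\<integral>z. f z * (\<Sum>j\<in>UNIV. rot j j h z) \<partial>surface_measure)"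
    by (simp add: sum_distrib_left sum_distrib_right Bochner_Integration.integral_sum int polyfun_intros polyfun_rot
        pf ph surface_integral_rot_by_parts sum_negf)
  moreover have "(\<integral>z. (\<Sum>j\<in>UNIV. rot j j f z) * h z \<partial>surface_measure) = (of_nat m - of_nat n) * I"
    using f by (simp add: harm_def rot_trace[of m n f] I_def mult.assoc)
  moreover have "(\<integral>z. f z * (\<Sum>j\<in>UNIV. rot j j h z) \<partial>surface_measure) = (of_nat n' - of_nat m') * I"
  proof -
    have "(\<integral>z. f z * (\<Sum>j\<in>UNIV. rot j j h z) \<partial>surface_measure)
       = (\<integral>z. (of_nat n' - of_nat m') * (f z * h z) \<partial>surface_measure)"
      using h by (intro Bochner_Integration.integral_cong) (simp_all add: harm_def rot_trace[of n' m' h])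
    then show ?thesis by (simp add: I_def)
  qed
  ultimately have "(of_nat m - of_nat n) * I = - ((of_nat n' - of_nat m') * I)" by metis
  then have 1: "(of_nat m - of_nat n + of_nat n' - of_nat m') * I = 0" by (simp add: algebra_simps)
  have "(\<integral>z. (\<Sum>j\<in>UNIV. \<Sum>k\<in>UNIV. rot j k (rot k j f) z) * h z \<partial>surface_measure)
     = (\<Sum>j\<in>UNIV. \<Sum>k\<in>UNIV. (\<integral>z. rot j k (rot k j f) z * h z \<partial>surface_measure))"
    by (simp add: sum_distrib_right Bochner_Integration.integral_sum int polyfun_intros polyfun_rot pf ph)
  also have "\<dots> = (\<Sum>j\<in>UNIV. \<Sum>k\<in>UNIV. (\<integral>z. f z * rot k j (rot j k h) z \<partial>surface_measure))"
    by (simp add: surface_integral_rot_by_parts polyfun_rot pf ph)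
  also have "\<dots> = (\<integral>z. f z * (\<Sum>k\<in>UNIV. \<Sum>j\<in>UNIV. rot k j (rot j k h) z) \<partial>surface_measure)"
    by (subst sum.swap)
      (simp add: sum_distrib_left Bochner_Integration.integral_sum int polyfun_intros polyfun_rot pf ph)
  also have "\<dots> = (\<integral>z. casimir_value CARD('d) n' m' * (f z * h z) \<partial>surface_measure)"
    by (intro Bochner_Integration.integral_cong) (simp_all add: casimir[OF h])
  also have "\<dots> = casimir_value CARD('d) n' m' * I" by (simp add: I_def)
  also have "(\<integral>z. (\<Sum>j\<in>UNIV. \<Sum>k\<in>UNIV. rot j k (rot k j f) z) * h z \<partial>surface_measure)
      = casimir_value CARD('d) m n * I"
    by (simp add: casimir[OF f] I_def mult.assoc)
  finally have "casimir_value CARD('d) m n * I = casimir_value CARD('d) n' m' * I" .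
  moreover have "casimir_value CARD('d) n' m' = casimir_value CARD('d) m' n'"
    by (simp add: casimir_value_def)
  ultimately have 2: "casimir_value CARD('d) m n = casimir_value CARD('d) m' n' \<or> I = 0" by auto
  have "I = 0"
  proof (rule ccontr)
    assume "I \<noteq> 0"
    with 1 have "of_nat m - of_nat n + of_nat n' - of_nat m' = (0 :: complex)" by simp
    then have "complex_of_int (int m - int n) = complex_of_int (int m' - int n')"
      by (simp add: algebra_simps)
    then have "int m - int n = int m' - int n'" by (simp only: of_int_eq_iff)
    with 2 \<open>I \<noteq> 0\<close> ne d casimir_value_shift show False by blast
  qed
  then show ?thesis by (simp add: I_def h_def)
qed

section \<open>Orthonormal sets of polynomials on the sphere\<close>

definition sphere_polys :: "(complex ^ 'd \<Rightarrow> complex) set" where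
  "sphere_polys = sphere_restrict ` {f. polyfun f}"

lemma sphere_restrict_apply [simp]: "norm z = 1 \<Longrightarrow> sphere_restrict f z = f z"
  by (simp add: sphere_restrict_def)

lemma sphere_restrict_lin:
  "sphere_restrict (\<lambda>z. f z + g z) = (\<lambda>z. sphere_restrict f z + sphere_restrict g z)"
  "sphere_restrict (\<lambda>z. c * f z) = (\<lambda>z. c * sphere_restrict f z)"
  "sphere_restrict (\<lambda>z. 0) = (\<lambda>z. 0)"
  by (auto simp: sphere_restrict_def)

lemma sphere_restrict_span:
  assumes "f \<in> cfun.span S" shows "sphere_restrict f \<in> cfun.span (sphere_restrict ` S)"
  using assms
proof (induction rule: span_cfun_induct)
  case zero
  show ?case using subspace_zero_fun[OF cfun.subspace_span] by (simp add: sphere_restrict_lin)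
next
  case (step c g h)
  then show ?case
    unfolding sphere_restrict_lin
    by (intro subspace_add_fun[OF cfun.subspace_span] subspace_cmult_fun[OF cfun.subspace_span])
       (auto intro: cfun.span_base)
qed

lemma subspace_sphere_restrict:
  assumes "cfun.subspace W" shows "cfun.subspace (sphere_restrict ` W)"
proof (rule cfun.subspaceI)
  show "0 \<in> sphere_restrict ` W"
    using imageI[OF subspace_zero_fun[OF assms], of sphere_restrict]
    by (simp only: sphere_restrict_lin(3) zero_fun_def)
  show "x + y \<in> sphere_restrict ` W" if "x \<in> sphere_restrict ` W" "y \<in> sphere_restrict ` W" for x y
    using that subspace_add_fun[OF assms] by (auto simp: plus_fun_def sphere_restrict_lin(1)[symmetric])
  show "cscale c x \<in> sphere_restrict ` W" if "x \<in> sphere_restrict ` W" for c x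
    using that subspace_cmult_fun[OF assms] by (auto simp: cscale_def sphere_restrict_lin(2)[symmetric])
qed

lemma subspace_sphere_polys: "cfun.subspace sphere_polys"
  unfolding sphere_polys_def
proof (rule subspace_sphere_restrict, rule cfun.subspaceI)
  show "0 \<in> {f. polyfun f}" by (simp add: zero_fun_def polyfun.const)
qed (auto simp: plus_fun_def cscale_def intro: polyfun.intros)

lemma sphere_polys_continuous: "f \<in> sphere_polys \<Longrightarrow> continuous_on (sphere 0 1) f"
proof -
  assume "f \<in> sphere_polys"
  then obtain p where p: "f = sphere_restrict p" "polyfun p" by (auto simp: sphere_polys_def)
  then show ?thesis
    using polyfun_continuous[OF p(2), of "sphere 0 1"]
    by (subst continuous_on_cong[OF refl, of "sphere 0 1" f p]) simp_all
qed

lemma sphere_polys_outside: "f \<in> sphere_polys \<Longrightarrow> z \<notin> sphere 0 1 \<Longrightarrow> f z = 0"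
  by (auto simp: sphere_polys_def sphere_restrict_def)

definition sip :: "(complex ^ 'd \<Rightarrow> complex) \<Rightarrow> (complex ^ 'd \<Rightarrow> complex) \<Rightarrow> complex" where
  "sip f g = (\<integral>z. f z * cnj (g z) \<partial>surface_measure)"

lemma sip_integrable:
  "f \<in> sphere_polys \<Longrightarrow> g \<in> sphere_polys \<Longrightarrow> integrable surface_measure (\<lambda>z. f z * cnj (g z))"
  by (intro surface_integrable_continuous continuous_intros sphere_polys_continuous)

lemma sip_cnj: "cnj (sip f g) = sip g f"
  unfolding sip_def by (subst Bochner_Integration.integral_cnj[symmetric]) (simp add: mult.commute)

lemma sip_add: "f \<in> sphere_polys \<Longrightarrow> g \<in> sphere_polys \<Longrightarrow> h \<in> sphere_polys \<Longrightarrow>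
    sip (\<lambda>z. f z + g z) h = sip f h + sip g h"
  by (simp add: sip_def distrib_right sip_integrable)

lemma sip_cmult: "sip (\<lambda>z. c * f z) h = c * sip f h"
  by (simp add: sip_def mult.assoc)

lemma sip_cmult_right: "sip f (\<lambda>z. c * g z) = cnj c * sip f g"
  using arg_cong[OF sip_cmult[of c g f], of cnj] by (simp add: sip_cnj)

lemma sip_sum: "(\<And>i. i \<in> I \<Longrightarrow> f i \<in> sphere_polys) \<Longrightarrow> h \<in> sphere_polys \<Longrightarrow>
    sip (\<lambda>z. \<Sum>i\<in>I. c i * f i z) h = (\<Sum>i\<in>I. c i * sip (f i) h)"
  by (simp add: sip_def sum_distrib_right Bochner_Integration.integral_sum mult.assoc
        integrable_mult_right sip_integrable)

lemma sip_sum_right: "(\<And>i. i \<in> I \<Longrightarrow> f i \<in> sphere_polys) \<Longrightarrow> h \<in> sphere_polys \<Longrightarrow>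
    sip h (\<lambda>z. \<Sum>i\<in>I. c i * f i z) = (\<Sum>i\<in>I. cnj (c i) * sip h (f i))"
  using arg_cong[OF sip_sum[of I f h c], of cnj] by (simp add: sip_cnj)

lemma sip_self: "sip f f = of_real (\<integral>z. (norm (f z))\<^sup>2 \<partial>surface_measure)"
proof -
  have "f z * cnj (f z) = complex_of_real ((norm (f z))\<^sup>2)" for z
    by (simp only: complex_norm_square)
  then show ?thesis by (simp only: sip_def integral_complex_of_real)
qed

lemma sip_self_eq_0:
  assumes f: "f \<in> sphere_polys" and 0: "sip f f = 0"
  shows "f = (\<lambda>z. 0)"
proof
  fix z
  have "(\<integral>z. (norm (f z))\<^sup>2 \<partial>surface_measure) = 0" using 0 by (simp only: sip_self of_real_eq_0_iff)
  moreover have "continuous_on (sphere 0 1) (\<lambda>z. (norm (f z))\<^sup>2)"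
    by (intro continuous_intros sphere_polys_continuous f)
  ultimately have "(norm (f z))\<^sup>2 = 0" if "z \<in> sphere 0 1"
    using that surface_integral_zero_imp_zero[of "\<lambda>z. (norm (f z))\<^sup>2" z] by simp
  then show "f z = 0" using sphere_polys_outside[OF f] by (cases "z \<in> sphere 0 1") auto
qed

definition orthonormal :: "(complex ^ 'd \<Rightarrow> complex) set \<Rightarrow> bool" where
  "orthonormal B \<longleftrightarrow> B \<subseteq> sphere_polys \<and> (\<forall>b\<in>B. \<forall>c\<in>B. sip b c = (if b = c then 1 else 0))"

lemma orthonormal_expand:
  assumes B: "orthonormal B" "finite B" and f: "f \<in> cfun.span B"
  shows "f \<in> sphere_polys" and "f = (\<lambda>z. \<Sum>b\<in>B. sip f b * b z)"
proof -
  have "f \<in> sphere_polys \<and> f = (\<lambda>z. \<Sum>b\<in>B. sip f b * b z)"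
    using f
  proof (induction rule: span_cfun_induct)
    case zero
    show ?case using subspace_zero_fun[OF subspace_sphere_polys] by (simp add: sip_def)
  next
    case (step c g h)
    have Bs: "b \<in> B \<Longrightarrow> b \<in> sphere_polys" for b using B by (auto simp: orthonormal_def)
    have gs: "(\<lambda>z. c * g z) \<in> sphere_polys"
      by (intro subspace_cmult_fun subspace_sphere_polys Bs step)
    have "sip (\<lambda>z. c * g z + h z) b = (if g = b then c else 0) + sip h b" if "b \<in> B" for b
      using that step B by (simp add: sip_add gs Bs sip_cmult orthonormal_def)
    then have "(\<Sum>b\<in>B. sip (\<lambda>z. c * g z + h z) b * b z) = c * g z + (\<Sum>b\<in>B. sip h b * b z)" for z
      using B(2) step.hyps by (simp add: distrib_right sum.distrib if_distrib[of "\<lambda>x. x * _"] cong: if_cong)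
    moreover have "(\<Sum>b\<in>B. sip h b * b z) = h z" for z
      using step.IH by (metis (no_types))
    ultimately show ?case
      using subspace_add_fun[OF subspace_sphere_polys gs, of h] step.IH by (simp add: fun_eq_iff)
  qed
  then show "f \<in> sphere_polys" and "f = (\<lambda>z. \<Sum>b\<in>B. sip f b * b z)" by blast+
qed

lemma orthonormal_independent:
  assumes B: "orthonormal B"
  shows "cfun.independent B"
proof
  assume "cfun.dependent B"
  then obtain a where a: "a \<in> B" "a \<in> cfun.span (B - {a})"
    by (auto simp: cfun.dependent_def)
  have Bs: "b \<in> B \<Longrightarrow> b \<in> sphere_polys" for b using B by (auto simp: orthonormal_def)
  have "f \<in> sphere_polys \<and> sip f a = 0" if "f \<in> cfun.span (B - {a})" for f
    using that
  proof (induction rule: span_cfun_induct)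
    case zero
    show ?case using subspace_zero_fun[OF subspace_sphere_polys] by (simp add: sip_def)
  next
    case (step c g h)
    have gs: "(\<lambda>z. c * g z) \<in> sphere_polys"
      using step by (intro subspace_cmult_fun subspace_sphere_polys Bs) simp
    then show ?case
      using step a B subspace_add_fun[OF subspace_sphere_polys gs, of h]
      by (simp add: sip_add Bs sip_cmult orthonormal_def)
  qed
  from this[OF a(2)] a(1) B show False by (simp add: orthonormal_def)
qed

lemma orthonormal_dim:
  assumes "orthonormal B" "cfun.span B = V"
  shows "cfun.dim V = card B"
  using orthonormal_independent[OF assms(1)] assms(2)
  by (metis cfun.dim_span cfun.dim_eq_card)

text \<open>An orthonormal subset of \<open>V\<close> of maximal cardinality spans: otherwise an element of \<open>V\<close> outside the span,
minus its projection and normalised, could be added. The finite spanning set bounds the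
cardinalities.\<close>

lemma orthonormal_basis_exists:
  assumes V: "cfun.subspace V" "V \<subseteq> sphere_polys" and F: "finite F" "V \<subseteq> cfun.span F"
  obtains B where "finite B" "orthonormal B" "cfun.span B = V"
proof -
  let ?P = "\<lambda>B. B \<subseteq> V \<and> finite B \<and> orthonormal B"
  have bound: "card B < Suc (card F)" if "?P B" for B
  proof -
    have "finite B \<and> card B \<le> card F"
      using that F orthonormal_independent by (intro cfun.independent_span_bound) auto
    then show ?thesis by simp
  qed
  have "?P {}" by (simp add: orthonormal_def)
  from ex_has_greatest_nat[where P = ?P and f = card, OF this] bound
  obtain B where B: "?P B" and mx: "\<And>C. ?P C \<Longrightarrow> card C \<le> card B" by meson
  have Bs: "b \<in> B \<Longrightarrow> b \<in> sphere_polys" for b using B V by auto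
  have "V \<subseteq> cfun.span B"
  proof (rule ccontr)
    assume "\<not> ?thesis"
    then obtain v where v: "v \<in> V" "v \<notin> cfun.span B" by blast
    define p where "p = (\<lambda>z. \<Sum>b\<in>B. sip v b * b z)"
    have pB: "p \<in> cfun.span B"
      unfolding p_def by (intro subspace_sum_fun cfun.subspace_span cfun.span_base)
    have pV: "p \<in> V" unfolding p_def using B by (intro subspace_sum_fun V) auto
    define r where "r = (\<lambda>z. v z - p z)"
    have rV: "r \<in> V" unfolding r_def by (intro subspace_diff_fun V v pV)
    then have rs: "r \<in> sphere_polys" using V by auto
    have "r \<noteq> (\<lambda>z. 0)"
    proof
      assume "r = (\<lambda>z. 0)"
      then have "v = p" by (auto simp: r_def fun_eq_iff)
      with v pB show False by simp
    qed
    then have "sip r r \<noteq> 0" using sip_self_eq_0[OF rs] by blast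
    define t where "t = (\<integral>z. (norm (r z))\<^sup>2 \<partial>surface_measure)"
    have t: "sip r r = of_real t" by (simp add: sip_self t_def)
    have "t \<ge> 0" unfolding t_def by simp
    with t \<open>sip r r \<noteq> 0\<close> have t0: "t > 0" by (cases "t = 0") auto
    have rb: "sip r b = 0" if "b \<in> B" for b
    proof -
      have "sip v b = sip (\<lambda>z. p z + r z) b" by (simp add: r_def)
      also have "\<dots> = sip p b + sip r b" using pV V rs Bs[OF that] by (intro sip_add) auto
      also have "sip p b = sip v b"
        unfolding p_def using that B Bs by (simp add: sip_sum orthonormal_def if_distrib[of "\<lambda>x. _ * x"] cong: if_cong)
      finally show ?thesis by simp
    qed
    define e where "e = (\<lambda>z. of_real (1 / sqrt t) * r z)"
    have eV: "e \<in> V" unfolding e_def by (intro subspace_cmult_fun V rV)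
    have eb: "sip e b = 0" if "b \<in> B" for b using rb[OF that] unfolding e_def sip_cmult by simp
    then have be: "sip b e = 0" if "b \<in> B" for b using that sip_cnj[of e b] by simp
    have "sip e e = complex_of_real (1 / sqrt t) * (cnj (complex_of_real (1 / sqrt t)) * sip r r)"
      unfolding e_def sip_cmult sip_cmult_right by (rule refl)
    also have "\<dots> = of_real ((1 / sqrt t) * (1 / sqrt t) * t)"
      by (simp only: t complex_cnj_complex_of_real of_real_mult mult.assoc)
    also have "(1 / sqrt t) * (1 / sqrt t) * t = 1" using t0 by (simp add: field_simps)
    finally have ee: "sip e e = 1" by simp
    then have "e \<notin> B" using eb by auto
    moreover have "?P (insert e B)"
      using B V eV eb be ee by (auto simp: orthonormal_def)
    ultimately show False using mx[of "insert e B"] B by simp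
  qed
  moreover have "cfun.span B \<subseteq> V" using B V by (intro cfun.span_minimal) auto
  ultimately show ?thesis using that B by auto
qed

section \<open>Reproducing kernels on the diagonal\<close>

text \<open>Contract \<open>rot j k f z = 0\<close> with \<open>cnj z\<^sub>j v\<^sub>k\<close> and with \<open>z\<^sub>k cnj v\<^sub>j\<close>: on the sphere the derivative of \<open>f\<close> in a
direction \<open>v\<close> becomes a multiple of the real inner product of \<open>v\<close> and \<open>z\<close>, and vanishes for tangential \<open>v\<close>.
So \<open>x \<mapsto> f (x / \<bar>x\<bar>)\<close> has derivative zero on the punctured space, which is connected.\<close>

lemma rot_zero_imp_constant:
  fixes f :: "complex ^ 'd \<Rightarrow> complex"
  assumes f: "polyfun f" and rot: "\<And>j k z. z \<in> sphere 0 1 \<Longrightarrow> rot j k f z = 0"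
    and z: "z \<in> sphere 0 1" and w: "w \<in> sphere 0 1"
  shows "f z = f w"
proof -
  \<comment> \<open>Here \<open>a\<close> and \<open>b\<close> are the holomorphic and antiholomorphic parts of the derivative along \<open>v\<close>.\<close>
  have tangent: "(\<Sum>k\<in>UNIV. v $ k * wirtinger k f z + cnj (v $ k) * wirtinger_bar k f z) = 0"
    if z: "z \<in> sphere 0 1" and v: "z \<bullet> v = 0" for z v :: "complex ^ 'd"
  proof -
    define E where "E = (\<Sum>k\<in>UNIV. z $ k * wirtinger k f z)"
    define E' where "E' = (\<Sum>k\<in>UNIV. cnj (z $ k) * wirtinger_bar k f z)"
    define a where "a = (\<Sum>k\<in>UNIV. v $ k * wirtinger k f z)"
    define b where "b = (\<Sum>k\<in>UNIV. cnj (v $ k) * wirtinger_bar k f z)"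
    have r: "z $ j * wirtinger k f z - cnj (z $ k) * wirtinger_bar j f z = 0" for j k
      using rot[OF z, of j k] by (simp add: rot_def)
    have zz: "(\<Sum>j\<in>UNIV. z $ j * cnj (z $ j)) = 1"
      using norm_eq_cip[of z] z by (simp add: cip_def)
    have "E - E' = (\<Sum>j\<in>UNIV. z $ j * wirtinger j f z - cnj (z $ j) * wirtinger_bar j f z)"
      by (simp add: E_def E'_def sum_subtractf)
    then have EE: "E = E'" by (simp add: r)
    have "(\<Sum>j\<in>UNIV. z $ j * cnj (z $ j)) * a - cip v z * E' =
        (\<Sum>j\<in>UNIV. \<Sum>k\<in>UNIV. cnj (z $ j) * v $ k * (z $ j * wirtinger k f z - cnj (z $ k) * wirtinger_bar j f z))"
    proof -
      have "cip v z * E' = (\<Sum>j\<in>UNIV. \<Sum>k\<in>UNIV. (cnj (z $ j) * wirtinger_bar j f z) * (v $ k * cnj (z $ k)))"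
        unfolding cip_def E'_def by (subst mult.commute) (rule sum_product)
      then show ?thesis
        unfolding a_def sum_product by (simp add: sum_subtractf algebra_simps)
    qed
    also have "\<dots> = 0" by (simp only: r mult_zero_right sum.neutral_const)
    finally have a: "a = cip v z * E'" by (simp add: zz)
    have "cip z v * E - (\<Sum>k\<in>UNIV. z $ k * cnj (z $ k)) * b =
        (\<Sum>j\<in>UNIV. \<Sum>k\<in>UNIV. z $ k * cnj (v $ j) * (z $ j * wirtinger k f z - cnj (z $ k) * wirtinger_bar j f z))"
    proof -
      have "(\<Sum>k\<in>UNIV. z $ k * cnj (z $ k)) * b
          = (\<Sum>j\<in>UNIV. \<Sum>k\<in>UNIV. (cnj (v $ j) * wirtinger_bar j f z) * (z $ k * cnj (z $ k)))"
        unfolding b_def by (subst mult.commute) (rule sum_product)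
      then show ?thesis
        unfolding cip_def E_def sum_product by (simp add: sum_subtractf algebra_simps)
    qed
    also have "\<dots> = 0" by (simp only: r mult_zero_right sum.neutral_const)
    finally have b: "b = cip z v * E" by (simp add: zz)
    have "cip z v + cip v z = of_real (2 * (z \<bullet> v))"
      by (simp add: cip_def inner_vec_def inner_complex_def complex_eq_iff sum.distrib[symmetric] sum_distrib_left
          algebra_simps)
    then have "a + b = 0" using v unfolding a b EE by (simp add: distrib_right[symmetric] add.commute)
    then show ?thesis by (simp add: a_def b_def sum.distrib)
  qed
  define N where "N x = x /\<^sub>R norm x" for x :: "complex ^ 'd"
  have nN: "norm (N x) = 1" if "x \<noteq> 0" for x using that by (simp add: N_def)
  have deriv: "((\<lambda>x. f (N x)) has_derivative (\<lambda>h. 0)) (at x)" if x: "x \<noteq> 0" for x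
  proof -
    have "N differentiable (at x)"
      unfolding N_def using x
      by (intro differentiable_scaleR differentiable_ident differentiable_inverse differentiable_norm_at) auto
    then obtain D where D: "(N has_derivative D) (at x)" by (auto simp: differentiable_def)
    have "((\<lambda>x. N x \<bullet> N x) has_derivative (\<lambda>h. N x \<bullet> D h + D h \<bullet> N x)) (at x)"
      by (rule has_derivative_inner[OF D D])
    moreover have "((\<lambda>x. N x \<bullet> N x) has_derivative (\<lambda>h. 0)) (at x)"
    proof (rule has_derivative_transform_within_open[of "\<lambda>x. 1" _ _ _ "- {0}"])
      show "1 = N y \<bullet> N y" if "y \<in> - {0}" for y
        using nN[of y] that by (simp add: norm_eq_1)
    qed (use x in auto)
    ultimately have "(\<lambda>h. N x \<bullet> D h + D h \<bullet> N x) = (\<lambda>h. 0)"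
      by (rule has_derivative_unique)
    then have "N x \<bullet> D h + D h \<bullet> N x = 0" for h by meson
    then have orth: "N x \<bullet> D h = 0" for h by (simp add: inner_commute)
    have "((\<lambda>x. f (N x)) has_derivative
        (\<lambda>h. \<Sum>k\<in>UNIV. D h $ k * wirtinger k f (N x) + cnj (D h $ k) * wirtinger_bar k f (N x))) (at x)"
      by (rule has_derivative_compose[OF D polyfun_has_derivative[OF f]])
    moreover have "(\<Sum>k\<in>UNIV. D h $ k * wirtinger k f (N x) + cnj (D h $ k) * wirtinger_bar k f (N x)) = 0" for h
      using nN[OF x] by (intro tangent orth) simp
    ultimately show ?thesis by simp
  qed
  \<comment> \<open>Real dimension at least two is what makes the punctured space connected.\<close>
  have "2 \<le> DIM(complex ^ 'd)" by simp
  then have "connected (- {0 :: complex ^ 'd})" by (rule connected_punctured_universe)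
  moreover have "z \<noteq> 0" "w \<noteq> 0" using z w by auto
  ultimately have "f (N z) = f (N w)"
    using has_derivative_zero_unique_connected[of "- {0 :: complex ^ 'd}" "\<lambda>x. f (N x)" z w] deriv
    by (auto simp: open_Compl)
  then show ?thesis using z w by (simp add: N_def)
qed

text \<open>Integration by parts shows that the matrices of \<open>rot j k\<close> and \<open>rot k j\<close> in an orthonormal basis are
adjoint to each other. Hence \<open>rot j k\<close> annihilates \<open>K = \<Sum> \<bar>b\<bar>\<^sup>2\<close> on the sphere, so \<open>K\<close> is constant there, and
its integral is the number of basis elements. In terms of the group: a unitary change of variables
maps one orthonormal basis to another, and the group is transitive on the sphere.\<close>

lemma kernel_diagonal:
  fixes W :: "(complex ^ 'd \<Rightarrow> complex) set"
  assumes W: "\<And>f. f \<in> W \<Longrightarrow> polyfun f" "\<And>f j k. f \<in> W \<Longrightarrow> rot j k f \<in> W"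
    and B: "finite B" "orthonormal B" "cfun.span B = sphere_restrict ` W"
    and z: "z \<in> sphere 0 1"
  shows "(\<Sum>b\<in>B. (norm (b z))\<^sup>2) = real (card B) / area TYPE('d)"
proof -
  have "\<forall>b\<in>B. \<exists>p. p \<in> W \<and> b = sphere_restrict p"
    using B(3) cfun.span_superset[of B] by blast
  then obtain p where p: "\<And>b. b \<in> B \<Longrightarrow> p b \<in> W" "\<And>b. b \<in> B \<Longrightarrow> b = sphere_restrict (p b)" by metis
  have pp: "b \<in> B \<Longrightarrow> polyfun (p b)" for b using p W by auto
  have Bs: "b \<in> B \<Longrightarrow> b \<in> sphere_polys" for b using B by (auto simp: orthonormal_def)
  have bz: "b z = p b z" if "b \<in> B" "z \<in> sphere 0 1" for b z
    using p(2)[OF that(1)] that(2) by (metis dist_0_norm mem_sphere sphere_restrict_apply)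
  define K where "K = (\<lambda>z. \<Sum>b\<in>B. p b z * cnj (p b z))"
  have pK: "polyfun K" unfolding K_def by (intro polyfun_intros pp)
  define m where "m j k b c = sip (sphere_restrict (rot j k (p b))) c" for j k b c
  have rotb: "rot j k (p b) z = (\<Sum>c\<in>B. m j k b c * p c z)" if "b \<in> B" "z \<in> sphere 0 1" for j k b z
  proof -
    have "sphere_restrict (rot j k (p b)) \<in> cfun.span B" using B(3) W p that by auto
    from fun_cong[OF orthonormal_expand(2)[OF B(2,1) this], of z] that(2)
    show ?thesis by (simp add: m_def bz)
  qed
  have madj: "m j k b c = cnj (m k j c b)" if bc: "b \<in> B" "c \<in> B" for j k b c
  proof -
    have "m j k b c = (\<integral>z. rot j k (p b) z * cnj (p c z) \<partial>surface_measure)"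
      unfolding m_def sip_def by (rule Bochner_Integration.integral_cong) (simp_all add: bz bc)
    also have "\<dots> = (\<integral>z. p b z * cnj (rot k j (p c) z) \<partial>surface_measure)"
      by (simp add: surface_integral_rot_by_parts polyfun_cnj pp bc rot_cnj)
    also have "\<dots> = (\<integral>z. b z * cnj (sphere_restrict (rot k j (p c)) z) \<partial>surface_measure)"
      by (rule Bochner_Integration.integral_cong) (simp_all add: bz bc)
    also have "\<dots> = cnj (m k j c b)" by (simp add: m_def sip_cnj) (simp add: sip_def)
    finally show ?thesis .
  qed
  have Kb: "K w = (\<Sum>b\<in>B. b w * cnj (b w))" if "w \<in> sphere 0 1" for w
    unfolding K_def by (intro sum.cong refl) (simp only: bz[OF _ that])
  have rotK: "rot j k K z = 0" if z: "z \<in> sphere 0 1" for j k z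
  proof -
    have "rot j k K z = (\<Sum>b\<in>B. rot j k (p b) z * cnj (p b z) - p b z * cnj (rot k j (p b) z))"
      unfolding K_def by (simp add: rot_sum rot_mult rot_cnj polyfun_intros pp)
    also have "\<dots> = (\<Sum>b\<in>B. (\<Sum>c\<in>B. m j k b c * p c z) * cnj (p b z) - p b z * cnj (\<Sum>c\<in>B. m k j b c * p c z))"
      using z by (intro sum.cong) (simp_all add: rotb)
    also have "\<dots> = (\<Sum>b\<in>B. \<Sum>c\<in>B. m j k b c * p c z * cnj (p b z))
        - (\<Sum>b\<in>B. \<Sum>c\<in>B. p b z * (cnj (m k j b c) * cnj (p c z)))"
      by (simp add: sum_subtractf sum_distrib_left sum_distrib_right)
    also have "(\<Sum>b\<in>B. \<Sum>c\<in>B. p b z * (cnj (m k j b c) * cnj (p c z)))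
        = (\<Sum>c\<in>B. \<Sum>b\<in>B. p b z * (cnj (m k j b c) * cnj (p c z)))"
      by (rule sum.swap)
    also have "\<dots> = (\<Sum>b\<in>B. \<Sum>c\<in>B. m j k b c * p c z * cnj (p b z))"
    proof (intro sum.cong refl)
      fix x y assume "x \<in> B" "y \<in> B"
      then have "cnj (m k j y x) = m j k x y" using madj[of x y j k] by simp
      then show "p y z * (cnj (m k j y x) * cnj (p x z)) = m j k x y * p y z * cnj (p x z)" by simp
    qed
    finally show ?thesis by simp
  qed
  have Kz: "K w = K z" if "w \<in> space surface_measure" for w
    using rot_zero_imp_constant[OF pK rotK _ z] that by (simp only: space_surface_measure)
  have "(\<integral>w. K w \<partial>surface_measure) = (\<integral>w. K z \<partial>(surface_measure :: (complex ^ 'd) measure))"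
    by (rule Bochner_Integration.integral_cong[OF refl Kz])
  also have "\<dots> = K z * of_real (area TYPE('d))" by (rule surface_integral_const(1))
  also have "(\<integral>w. K w \<partial>surface_measure) = (\<integral>w. (\<Sum>b\<in>B. b w * cnj (b w)) \<partial>surface_measure)"
    by (rule Bochner_Integration.integral_cong[OF refl]) (simp only: Kb space_surface_measure)
  also have "\<dots> = (\<Sum>b\<in>B. sip b b)"
    unfolding sip_def by (rule Bochner_Integration.integral_sum) (simp add: sip_integrable Bs)
  also have "\<dots> = of_nat (card B)" using B by (simp add: orthonormal_def)
  finally have "of_nat (card B) = K z * of_real (area TYPE('d))" .
  moreover have "K z = of_real (\<Sum>b\<in>B. (norm (b z))\<^sup>2)"
    unfolding Kb[OF z] of_real_sum complex_norm_square ..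
  ultimately have "complex_of_real (real (card B)) = of_real ((\<Sum>b\<in>B. (norm (b z))\<^sup>2) * area TYPE('d))"
    by simp
  then have "real (card B) = (\<Sum>b\<in>B. (norm (b z))\<^sup>2) * area TYPE('d)" unfolding of_real_eq_iff .
  then show ?thesis using area_pos[where 'd = 'd] by (simp add: field_simps)
qed

section \<open>Moments of random sign sums\<close>

lemma fact_double_ge: "2 ^ n * fact n \<le> (fact (2 * n) :: real)"
proof (induction n)
  case (Suc n)
  have "(2::real) ^ Suc n * fact (Suc n) = (2 * real (Suc n)) * (2 ^ n * fact n)" by simp
  also have "\<dots> \<le> (2 * real (Suc n)) * fact (2 * n)" using Suc by (intro mult_left_mono) auto
  also have "\<dots> \<le> (2 * real (Suc n)) * (real (2 * n + 1) * fact (2 * n))"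
    by (intro mult_left_mono) (auto simp: mult_ge1_I fact_ge_zero intro: mult_right_mono[of 1, simplified])
  also have "\<dots> = fact (2 * Suc n)" by (simp add: algebra_simps)
  finally show ?case .
qed simp

lemma exp_plus_exp_minus_le: "exp y + exp (- y) \<le> 2 * exp (y\<^sup>2 / 2)" for y :: real
proof -
  have "strict_mono (\<lambda>n::nat. 2 * n)" by (simp add: strict_mono_def)
  then have "(\<lambda>n. if even (2 * n) then y ^ (2 * n) /\<^sub>R fact (2 * n) else 0) sums cosh y"
    by (subst sums_mono_reindex[where f = "\<lambda>n. if even n then y ^ n /\<^sub>R fact n else 0"])
       (auto elim!: evenE intro: cosh_converges)
  then have c: "(\<lambda>n. y ^ (2 * n) / fact (2 * n)) sums cosh y" by (simp add: field_simps)
  have e: "(\<lambda>n. (y\<^sup>2 / 2) ^ n / fact n) sums exp (y\<^sup>2 / 2)"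
    using exp_converges[of "y\<^sup>2 / 2"] by (simp add: field_simps)
  have "cosh y \<le> exp (y\<^sup>2 / 2)"
  proof (rule sums_le[OF _ c e])
    fix n
    have "y ^ (2 * n) / fact (2 * n) \<le> y ^ (2 * n) / (2 ^ n * fact n)"
      by (intro divide_left_mono fact_double_ge) auto
    also have "\<dots> = (y\<^sup>2 / 2) ^ n / fact n" by (simp add: power_mult power_divide)
    finally show "y ^ (2 * n) / fact (2 * n) \<le> (y\<^sup>2 / 2) ^ n / fact n" .
  qed
  then show ?thesis by (simp add: cosh_def)
qed

lemma power_le_fact_exp:
  fixes x :: real
  assumes "x \<ge> 0"
  shows "x ^ n \<le> fact n * exp x"
proof -
  have "(\<lambda>n. x ^ n / fact n) sums exp x" using exp_converges[of x] by (simp add: field_simps)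
  then have "(\<Sum>k\<in>{n}. x ^ k / fact k) \<le> exp x"
    using assms by (intro sum_le_suminf[THEN order_trans]) (auto simp: sums_iff)
  then show ?thesis by (simp add: field_simps)
qed

definition sgn_of :: "'i set \<Rightarrow> 'i \<Rightarrow> real" where
  "sgn_of A i = (if i \<in> A then 1 else - 1)"

text \<open>Over all signs the exponential moment factors into hyperbolic cosines.\<close>

lemma sum_exp_signs_le:
  fixes a :: "'i \<Rightarrow> real"
  assumes I: "finite I"
  shows "(\<Sum>A\<in>Pow I. exp (\<Sum>i\<in>I. sgn_of A i * a i)) \<le> 2 ^ card I * exp ((\<Sum>i\<in>I. (a i)\<^sup>2) / 2)"
proof -
  have "exp (\<Sum>i\<in>I. sgn_of A i * a i) = (\<Prod>i\<in>A. exp (a i)) * (\<Prod>i\<in>I - A. exp (- a i))" if "A \<in> Pow I" for A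
  proof -
    have "(\<Prod>i\<in>I. exp (sgn_of A i * a i)) = (\<Prod>i\<in>A. exp (sgn_of A i * a i)) * (\<Prod>i\<in>I - A. exp (sgn_of A i * a i))"
      using that I by (metis PowD prod.subset_diff mult.commute)
    then show ?thesis by (simp add: exp_sum I sgn_of_def)
  qed
  then have "(\<Sum>A\<in>Pow I. exp (\<Sum>i\<in>I. sgn_of A i * a i)) = (\<Prod>i\<in>I. exp (a i) + exp (- a i))"
    using prod_add[OF I, of "\<lambda>i. exp (a i)" "\<lambda>i. exp (- a i)"] by simp
  also have "\<dots> \<le> (\<Prod>i\<in>I. 2 * exp ((a i)\<^sup>2 / 2))"
    by (intro prod_mono conjI exp_plus_exp_minus_le) (simp add: add_nonneg_nonneg)
  also have "\<dots> = 2 ^ card I * exp ((\<Sum>i\<in>I. (a i)\<^sup>2) / 2)"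
    by (simp add: prod.distrib exp_sum[symmetric] I sum_divide_distrib)
  finally show ?thesis .
qed

text \<open>The power of order \<open>2 j\<close> of a sign sum \<open>X\<close> is bounded by \<open>(2 j)! / t ^ (2 j)\<close> times \<open>exp (t X) + exp (- t X)\<close>, and the
exponential moments are Gaussian. The value \<open>t = \<surd>(2 j) / \<tau>\<close> balances the two factors.\<close>

lemma even_moment_real_signs:
  fixes a :: "'i \<Rightarrow> real"
  assumes I: "finite I" and s: "(\<Sum>i\<in>I. (a i)\<^sup>2) \<le> \<tau>\<^sup>2" "\<tau> > 0" and j: "j \<ge> 1"
  shows "(\<Sum>A\<in>Pow I. (\<Sum>i\<in>I. sgn_of A i * a i) ^ (2 * j))
    \<le> 2 ^ card I * (2 * (2 * exp 1 * real j) ^ j * \<tau> ^ (2 * j))"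
proof -
  define t where "t = sqrt (2 * real j) / \<tau>"
  have t: "t > 0" using s j by (simp add: t_def)
  have t2: "t\<^sup>2 = 2 * real j / \<tau>\<^sup>2" by (simp add: t_def power_divide)
  define X where "X A = (\<Sum>i\<in>I. sgn_of A i * a i)" for A
  have E: "(\<Sum>A\<in>Pow I. exp (c * X A)) \<le> 2 ^ card I * exp (real j)" if c: "c\<^sup>2 = t\<^sup>2" for c
  proof -
    have "(\<Sum>A\<in>Pow I. exp (c * X A)) = (\<Sum>A\<in>Pow I. exp (\<Sum>i\<in>I. sgn_of A i * (c * a i)))"
      by (simp add: X_def sum_distrib_left mult_ac)
    also have "\<dots> \<le> 2 ^ card I * exp ((\<Sum>i\<in>I. (c * a i)\<^sup>2) / 2)" by (rule sum_exp_signs_le[OF I])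
    also have "\<dots> \<le> 2 ^ card I * exp (real j)"
    proof -
      have "(\<Sum>i\<in>I. (c * a i)\<^sup>2) = t\<^sup>2 * (\<Sum>i\<in>I. (a i)\<^sup>2)"
        by (simp add: power_mult_distrib sum_distrib_left c)
      also have "\<dots> \<le> t\<^sup>2 * \<tau>\<^sup>2" using s by (intro mult_left_mono) auto
      also have "\<dots> = 2 * real j" using s by (simp add: t2)
      finally show ?thesis by simp
    qed
    finally show ?thesis .
  qed
  have "(X A) ^ (2 * j) \<le> fact (2 * j) / t ^ (2 * j) * (exp (t * X A) + exp (- t * X A))" for A
  proof -
    have "(t * X A) ^ (2 * j) = \<bar>t * X A\<bar> ^ (2 * j)" by (simp add: power_mult)
    also have "\<dots> \<le> fact (2 * j) * exp \<bar>t * X A\<bar>" by (rule power_le_fact_exp) simp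
    also have "exp \<bar>t * X A\<bar> \<le> exp (t * X A) + exp (- t * X A)" by (simp add: abs_if)
    finally show ?thesis using t by (simp add: power_mult_distrib field_simps)
  qed
  then have "(\<Sum>A\<in>Pow I. (X A) ^ (2 * j))
      \<le> (\<Sum>A\<in>Pow I. fact (2 * j) / t ^ (2 * j) * (exp (t * X A) + exp (- t * X A)))"
    by (intro sum_mono)
  also have "\<dots> = fact (2 * j) / t ^ (2 * j) * ((\<Sum>A\<in>Pow I. exp (t * X A)) + (\<Sum>A\<in>Pow I. exp (- t * X A)))"
    by (simp only: sum.distrib sum_distrib_left[symmetric])
  also have "\<dots> \<le> fact (2 * j) / t ^ (2 * j) * (2 ^ card I * exp (real j) + 2 ^ card I * exp (real j))"
    using t by (intro mult_left_mono add_mono E) auto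
  also have "\<dots> \<le> (2 * real j) ^ (2 * j) / t ^ (2 * j) * (2 ^ card I * exp (real j) + 2 ^ card I * exp (real j))"
  proof -
    have "(fact (2 * j) :: real) \<le> (2 * real j) ^ (2 * j)"
      using fact_le_power[of "2 * j", where 'a = real] by simp
    then show ?thesis using t by (intro mult_right_mono divide_right_mono) auto
  qed
  also have "\<dots> = 2 ^ card I * (2 * (2 * exp 1 * real j) ^ j * \<tau> ^ (2 * j))"
  proof -
    have "t ^ (2 * j) = (2 * real j) ^ j / \<tau> ^ (2 * j)" by (simp only: power_mult t2 power_divide)
    moreover have "(2 * real j) ^ (2 * j) = (2 * real j) ^ j * (2 * real j) ^ j"
      by (simp only: mult_2 power_add)
    moreover have "a * a / (a / b) = a * b" if "a \<noteq> 0" for a b :: real using that by simp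
    ultimately have "(2 * real j) ^ (2 * j) / t ^ (2 * j) = (2 * real j) ^ j * \<tau> ^ (2 * j)"
      using j by (simp only: power_not_zero) simp
    moreover have "exp (real j) = exp 1 ^ j" using exp_of_nat_mult[of j "1::real"] by simp
    moreover have "(2 * exp 1 * real j) ^ j = (2 * real j) ^ j * exp 1 ^ j"
      by (simp only: power_mult_distrib[symmetric] mult_ac)
    ultimately show ?thesis by (simp only:) (simp add: algebra_simps)
  qed
  finally show ?thesis by (simp add: X_def)
qed

lemma even_moment_signs:
  fixes a :: "'i \<Rightarrow> complex"
  assumes I: "finite I" and s: "(\<Sum>i\<in>I. (norm (a i))\<^sup>2) \<le> \<tau>\<^sup>2" "\<tau> > 0" and j: "j \<ge> 1"
  shows "(\<Sum>A\<in>Pow I. norm (\<Sum>i\<in>I. of_real (sgn_of A i) * a i) ^ (2 * j))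
    \<le> 2 ^ card I * ((16 * exp 1 * real j) ^ j * \<tau> ^ (2 * j))"
proof -
  define X where "X A = (\<Sum>i\<in>I. of_real (sgn_of A i) * a i)" for A
  define C where "C = 2 * (2 * exp 1 * real j) ^ j * \<tau> ^ (2 * j)"
  have re: "(\<Sum>i\<in>I. (Re (a i))\<^sup>2) \<le> \<tau>\<^sup>2" "(\<Sum>i\<in>I. (Im (a i))\<^sup>2) \<le> \<tau>\<^sup>2"
    using s(1) by (auto intro!: order_trans[OF sum_mono s(1)] simp: cmod_power2)
  have "norm (X A) ^ (2 * j) \<le> 2 ^ j * (Re (X A) ^ (2 * j) + Im (X A) ^ (2 * j))" for A
  proof -
    have "norm (X A) ^ (2 * j) = ((Re (X A))\<^sup>2 + (Im (X A))\<^sup>2) ^ j"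
      by (simp add: power_mult cmod_power2)
    also have "\<dots> \<le> (2 * max ((Re (X A))\<^sup>2) ((Im (X A))\<^sup>2)) ^ j"
      by (intro power_mono) (auto simp: max_def)
    also have "\<dots> = 2 ^ j * max ((Re (X A))\<^sup>2) ((Im (X A))\<^sup>2) ^ j" by (simp add: power_mult_distrib)
    also have "\<dots> \<le> 2 ^ j * (((Re (X A))\<^sup>2) ^ j + ((Im (X A))\<^sup>2) ^ j)"
      by (intro mult_left_mono) (auto simp: max_def)
    finally show ?thesis by (simp add: power_mult)
  qed
  then have "(\<Sum>A\<in>Pow I. norm (X A) ^ (2 * j))
      \<le> (\<Sum>A\<in>Pow I. 2 ^ j * (Re (X A) ^ (2 * j) + Im (X A) ^ (2 * j)))" by (intro sum_mono)
  also have "\<dots> = 2 ^ j * ((\<Sum>A\<in>Pow I. (\<Sum>i\<in>I. sgn_of A i * Re (a i)) ^ (2 * j))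
      + (\<Sum>A\<in>Pow I. (\<Sum>i\<in>I. sgn_of A i * Im (a i)) ^ (2 * j)))"
    by (simp add: sum.distrib sum_distrib_left[symmetric] X_def)
  also have "\<dots> \<le> 2 ^ j * (2 ^ card I * C + 2 ^ card I * C)"
    unfolding C_def by (intro mult_left_mono add_mono even_moment_real_signs I s re j) auto
  also have "\<dots> = 2 ^ card I * (4 * (4 * exp 1 * real j) ^ j * \<tau> ^ (2 * j))"
    by (simp add: C_def power_mult_distrib[symmetric] mult_ac)
  also have "\<dots> \<le> 2 ^ card I * ((16 * exp 1 * real j) ^ j * \<tau> ^ (2 * j))"
  proof -
    have "(4::real) \<le> 4 ^ j" using j self_le_power[of "4::real" j] by simp
    then have "4 * (4 * exp 1 * real j) ^ j \<le> 4 ^ j * (4 * exp 1 * real j) ^ j"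
      by (intro mult_right_mono) auto
    also have "\<dots> = (4 * (4 * exp 1 * real j)) ^ j" by (rule power_mult_distrib[symmetric])
    also have "4 * (4 * exp 1 * real j) = 16 * exp 1 * real j" by simp
    finally have "4 * (4 * exp 1 * real j) ^ j \<le> (16 * exp 1 * real j) ^ j" .
    from mult_right_mono[OF this, of "\<tau> ^ (2 * j)"] s(2)
    show ?thesis by (intro mult_left_mono) simp_all
  qed
  finally show ?thesis by (simp add: X_def)
qed

text \<open>Some choice of signs does at least as well as the average over all choices, and the average can be
taken under the integral.\<close>

lemma good_signs_exist:
  fixes h :: "'i \<Rightarrow> complex ^ 'd \<Rightarrow> complex"
  assumes I: "finite I" and h: "\<And>i. i \<in> I \<Longrightarrow> h i \<in> sphere_polys"
    and s: "\<And>z. z \<in> sphere 0 1 \<Longrightarrow> (\<Sum>i\<in>I. (norm (h i z))\<^sup>2) \<le> \<tau>\<^sup>2" "\<tau> > 0" and j: "j \<ge> 1"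
  obtains A where "A \<subseteq> I"
    "(\<integral>z. norm (\<Sum>i\<in>I. of_real (sgn_of A i) * h i z) ^ (2 * j) \<partial>surface_measure)
       \<le> (sqrt (16 * exp 1 * real j) * \<tau>) ^ (2 * j) * area TYPE('d)"
proof -
  define f where "f A z = norm (\<Sum>i\<in>I. of_real (sgn_of A i) * h i z) ^ (2 * j)" for A z
  define C where "C = (16 * exp 1 * real j) ^ j * \<tau> ^ (2 * j)"
  have Ceq: "C = (sqrt (16 * exp 1 * real j) * \<tau>) ^ (2 * j)"
    by (simp add: C_def power_mult power_mult_distrib)
  have int: "integrable surface_measure (f A)" for A
    unfolding f_def by (intro surface_integrable_continuous continuous_intros sphere_polys_continuous h)
  have "(\<Sum>A\<in>Pow I. \<integral>z. f A z \<partial>surface_measure) = (\<integral>z. (\<Sum>A\<in>Pow I. f A z) \<partial>surface_measure)"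
    by (rule Bochner_Integration.integral_sum[symmetric]) (rule int)
  also have "\<dots> \<le> (\<integral>z. 2 ^ card I * C \<partial>(surface_measure :: (complex ^ 'd) measure))"
  proof (rule integral_mono)
    show "integrable surface_measure (\<lambda>z. \<Sum>A\<in>Pow I. f A z)" by (intro Bochner_Integration.integrable_sum int)
    show "(\<Sum>A\<in>Pow I. f A z) \<le> 2 ^ card I * C" if "z \<in> space surface_measure" for z
      using that unfolding f_def C_def by (intro even_moment_signs I s j) auto
  qed simp
  also have "\<dots> = (\<Sum>A\<in>Pow I. C * area TYPE('d))"
    using I by (simp add: area_def card_Pow)
  finally have "(\<Sum>A\<in>Pow I. \<integral>z. f A z \<partial>surface_measure) \<le> (\<Sum>A\<in>Pow I. C * area TYPE('d))" .
  then obtain A where "A \<in> Pow I" "(\<integral>z. f A z \<partial>surface_measure) \<le> C * area TYPE('d)"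
    using sum_strict_mono[of "Pow I" "\<lambda>_. C * area TYPE('d)" "\<lambda>A. \<integral>z. f A z \<partial>surface_measure"] I
    by (metis (no_types, lifting) Pow_not_empty finite_Pow_iff not_le)
  then show ?thesis using that[of A] unfolding f_def Ceq by auto
qed

section \<open>Orthonormal solutions of homogeneous linear systems\<close>

text \<open>Gaussian elimination: an equation with a nonzero coefficient at \<open>k\<close> eliminates the unknown \<open>k\<close>.\<close>

lemma homogeneous_system_solution:
  fixes C :: "('i \<Rightarrow> complex) set"
  assumes "finite C" "card C \<le> n" "finite S" "n < card S"
  shows "\<exists>c. (\<exists>i\<in>S. c i \<noteq> 0) \<and> (\<forall>a\<in>C. (\<Sum>i\<in>S. a i * c i) = 0)"
  using assms
proof (induction n arbitrary: C S)
  case 0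
  then have "C = {}" by simp
  moreover obtain i where "i \<in> S" using 0 by fastforce
  ultimately show ?case by (intro exI[of _ "\<lambda>_. 1"]) auto
next
  case (Suc n)
  show ?case
  proof (cases "\<exists>a\<in>C. \<exists>i\<in>S. a i \<noteq> 0")
    case False
    obtain i where "i \<in> S" using Suc.prems by fastforce
    with False show ?thesis by (intro exI[of _ "\<lambda>_. 1"]) auto
  next
    case True
    then obtain a k where a: "a \<in> C" "k \<in> S" "a k \<noteq> 0" by blast
    define red where "red b i = b i - b k / a k * a i" for b i
    let ?C = "red ` (C - {a})"
    have "card ?C \<le> n"
      using card_image_le[of "C - {a}" red] Suc.prems a by (simp add: card_Diff_singleton)
    moreover have "finite ?C" "finite (S - {k})" using Suc.prems by simp_all
    moreover have "n < card (S - {k})" using Suc.prems a by (simp add: card_Diff_singleton)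
    ultimately have "\<exists>c. (\<exists>i\<in>S - {k}. c i \<noteq> 0) \<and> (\<forall>b\<in>?C. (\<Sum>i\<in>S - {k}. b i * c i) = 0)"
      using Suc.IH by (simp only:)
    then obtain c where c: "\<exists>i\<in>S - {k}. c i \<noteq> 0" "\<forall>b\<in>?C. (\<Sum>i\<in>S - {k}. b i * c i) = 0"
      by (elim exE conjE)
    define x where "x = - (\<Sum>i\<in>S - {k}. a i * c i) / a k"
    define d where "d = c(k := x)"
    have sum_d: "(\<Sum>i\<in>S. b i * d i) = b k * x + (\<Sum>i\<in>S - {k}. b i * c i)" for b
    proof -
      have "(\<Sum>i\<in>S. b i * d i) = b k * d k + (\<Sum>i\<in>S - {k}. b i * d i)"
        using Suc.prems a by (simp add: sum.remove)
      then show ?thesis by (simp add: d_def)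
    qed
    have ad: "(\<Sum>i\<in>S. a i * d i) = 0"
      unfolding sum_d using a by (simp add: x_def)
    have "(\<Sum>i\<in>S. b i * d i) = 0" if "b \<in> C" for b
    proof (cases "b = a")
      case False
      have "(\<Sum>i\<in>S. b i * d i) = (\<Sum>i\<in>S. red b i * d i) + b k / a k * (\<Sum>i\<in>S. a i * d i)"
        by (simp add: red_def sum_distrib_left sum.distrib[symmetric] algebra_simps)
      also have "(\<Sum>i\<in>S. red b i * d i) = 0"
        unfolding sum_d using c(2) that False a by (simp add: red_def)
      finally show ?thesis by (simp add: ad)
    qed (simp add: ad)
    moreover have "\<exists>i\<in>S. d i \<noteq> 0" using c(1) by (auto simp: d_def)
    ultimately show ?thesis by blast
  qed
qed

text \<open>Orthogonality to the solutions found so far adds one homogeneous equation for each of them, so a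
further solution exists as long as equations and solutions together are fewer than the unknowns.\<close>

lemma orthonormal_solutions:
  fixes C :: "('i \<Rightarrow> complex) set"
  assumes C: "finite C" and S: "finite S" and m: "m + card C \<le> card S"
  shows "\<exists>v :: nat \<Rightarrow> 'i \<Rightarrow> complex. (\<forall>r<m. \<forall>a\<in>C. (\<Sum>i\<in>S. a i * v r i) = 0) \<and>
    (\<forall>r<m. \<forall>r'<m. (\<Sum>i\<in>S. v r i * cnj (v r' i)) = (if r = r' then 1 else 0))"
  using m
proof (induction m)
  case (Suc m)
  then have "m + card C \<le> card S" by simp
  from Suc.IH[OF this] obtain v where v: "\<And>r a. r < m \<Longrightarrow> a \<in> C \<Longrightarrow> (\<Sum>i\<in>S. a i * v r i) = 0"
    "\<And>r r'. r < m \<Longrightarrow> r' < m \<Longrightarrow> (\<Sum>i\<in>S. v r i * cnj (v r' i)) = (if r = r' then 1 else 0)"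
    by blast
  let ?C = "C \<union> (\<lambda>r i. cnj (v r i)) ` {..<m}"
  have "card ?C \<le> card C + m"
    using card_Un_le[of C "(\<lambda>r i. cnj (v r i)) ` {..<m}"] card_image_le[of "{..<m}" "\<lambda>r i. cnj (v r i)"] by simp
  moreover have "finite ?C" "card C + m < card S" using C Suc.prems by simp_all
  ultimately have "\<exists>c. (\<exists>i\<in>S. c i \<noteq> 0) \<and> (\<forall>a\<in>?C. (\<Sum>i\<in>S. a i * c i) = 0)"
    using homogeneous_system_solution[of ?C "card C + m" S] S by (simp only:)
  then obtain c where c: "\<exists>i\<in>S. c i \<noteq> 0" "\<And>a. a \<in> ?C \<Longrightarrow> (\<Sum>i\<in>S. a i * c i) = 0"
    by (elim exE conjE) (simp only:)
  define t where "t = (\<Sum>i\<in>S. (norm (c i))\<^sup>2)"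
  have t: "t > 0"
  proof -
    obtain i where "i \<in> S" "c i \<noteq> 0" using c(1) by blast
    then show ?thesis unfolding t_def by (intro sum_pos2[OF S]) simp_all
  qed
  define e where "e = (\<lambda>i. complex_of_real (1 / sqrt t) * c i)"
  have lin: "(\<Sum>i\<in>S. a i * e i) = complex_of_real (1 / sqrt t) * (\<Sum>i\<in>S. a i * c i)" for a
    by (simp add: e_def sum_distrib_left mult_ac)
  have ve: "(\<Sum>i\<in>S. cnj (v r i) * e i) = 0" if "r < m" for r
    using lin[of "\<lambda>i. cnj (v r i)"] c(2)[of "\<lambda>i. cnj (v r i)"] that by auto
  have ve': "(\<Sum>i\<in>S. v r i * cnj (e i)) = 0" if "r < m" for r
    using arg_cong[OF ve[OF that], of cnj] by simp
  have ee: "(\<Sum>i\<in>S. e i * cnj (e i)) = 1"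
  proof -
    have "(\<Sum>i\<in>S. e i * cnj (e i)) = of_real (\<Sum>i\<in>S. (norm (e i))\<^sup>2)"
      unfolding of_real_sum complex_norm_square ..
    also have "(\<Sum>i\<in>S. (norm (e i))\<^sup>2) = (1 / t) * t"
      unfolding t_def sum_distrib_left
      using t by (intro sum.cong refl) (simp add: e_def norm_mult norm_divide power_divide t_def[symmetric])
    finally show ?thesis using t by simp
  qed
  show ?case
  proof (intro exI[of _ "v(m := e)"] conjI allI impI ballI)
    fix r a assume "r < Suc m" "a \<in> C"
    then show "(\<Sum>i\<in>S. a i * (v(m := e)) r i) = 0"
      using v(1)[of r a] lin[of a] c(2)[of a] by (cases "r = m") auto
  next
    fix r r' assume "r < Suc m" "r' < Suc m"
    then show "(\<Sum>i\<in>S. (v(m := e)) r i * cnj ((v(m := e)) r' i)) = (if r = r' then 1 else 0)"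
      using v(2)[of r r'] ve[of r'] ve'[of r] ee by (cases "r = m"; cases "r' = m") (auto simp: mult.commute)
  qed
qed simp

section \<open>Elementary estimates in the spaces of integrable powers\<close>

lemma sphere_polys_Lp:
  assumes "f \<in> sphere_polys" "p > 0"
  shows "f \<in> Lp_space p"
proof -
  have "continuous_on (sphere 0 1) f" by (rule sphere_polys_continuous[OF assms(1)])
  then have "continuous_on (sphere 0 1) (\<lambda>z. norm (f z) powr p)"
    using assms(2) by (intro continuous_on_powr' continuous_intros) auto
  then show ?thesis
    using surface_measurable_continuous[OF sphere_polys_continuous[OF assms(1)]]
    by (auto simp: Lp_space_def intro: surface_integrable_continuous)
qed

lemma Lp_norm_nonneg: "Lp_norm p f \<ge> 0"
  by (simp add: Lp_norm_def)

lemma powr_add_le: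
  fixes a b q :: real
  assumes "a \<ge> 0" "b \<ge> 0" "q \<ge> 0"
  shows "(a + b) powr q \<le> 2 powr q * (a powr q + b powr q)"
proof -
  have "(a + b) powr q \<le> (2 * max a b) powr q" using assms by (intro powr_mono2) auto
  also have "\<dots> = 2 powr q * max a b powr q" using assms by (simp add: powr_mult)
  also have "\<dots> \<le> 2 powr q * (a powr q + b powr q)" by (intro mult_left_mono) (auto simp: max_def)
  finally show ?thesis .
qed

lemma Lp_space_diff:
  assumes f: "f \<in> Lp_space q" and g: "g \<in> Lp_space q" and q: "q \<ge> 0"
  shows "(\<lambda>z. f z - g z) \<in> Lp_space q"
proof -
  have m: "f \<in> borel_measurable surface_measure" "g \<in> borel_measurable surface_measure"
    using f g by (auto simp: Lp_space_def)
  have "integrable surface_measure (\<lambda>z. norm (f z - g z) powr q)"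
  proof (rule Bochner_Integration.integrable_bound)
    show "integrable surface_measure (\<lambda>z. 2 powr q * (norm (f z) powr q + norm (g z) powr q))"
      using f g by (auto simp: Lp_space_def)
    show "(\<lambda>z. norm (f z - g z) powr q) \<in> borel_measurable surface_measure"
      using m by measurable
    show "AE z in surface_measure. norm (norm (f z - g z) powr q)
        \<le> norm (2 powr q * (norm (f z) powr q + norm (g z) powr q))"
    proof (rule AE_I2)
      fix z
      have "norm (f z - g z) powr q \<le> (norm (f z) + norm (g z)) powr q"
        using q by (intro powr_mono2 norm_triangle_ineq4) auto
      also have "\<dots> \<le> 2 powr q * (norm (f z) powr q + norm (g z) powr q)"
        using q by (intro powr_add_le) auto
      finally show "norm (norm (f z - g z) powr q) \<le> norm (2 powr q * (norm (f z) powr q + norm (g z) powr q))"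
        by simp
    qed
  qed
  with m show ?thesis by (auto simp: Lp_space_def)
qed

lemma Lp_norm_le_of_L2:
  fixes f :: "complex ^ 'd \<Rightarrow> complex"
  assumes f: "f \<in> sphere_polys" and p: "1 \<le> p" "p \<le> 2" and 1: "(\<integral>z. (norm (f z))\<^sup>2 \<partial>surface_measure) \<le> 1"
  shows "Lp_norm p f \<le> 1 + area TYPE('d)"
proof -
  have c: "continuous_on (sphere 0 1) f" by (rule sphere_polys_continuous[OF f])
  have "(\<integral>z. norm (f z) powr p \<partial>surface_measure) \<le> (\<integral>z. 1 + (norm (f z))\<^sup>2 \<partial>surface_measure)"
  proof (rule integral_mono)
    show "integrable surface_measure (\<lambda>z. norm (f z) powr p)"
      using sphere_polys_Lp[OF f, of p] p by (simp add: Lp_space_def)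
    show "integrable surface_measure (\<lambda>z. 1 + (norm (f z))\<^sup>2)"
      by (intro surface_integrable_continuous continuous_intros c)
    fix z
    show "norm (f z) powr p \<le> 1 + (norm (f z))\<^sup>2"
    proof (cases "norm (f z) \<le> 1")
      case True
      then have "norm (f z) powr p \<le> 1" using p by (intro powr_le1) auto
      then show ?thesis by (simp add: add_increasing2)
    next
      case False
      then have "norm (f z) powr p \<le> norm (f z) powr 2" using p by (intro powr_mono) auto
      then show ?thesis using False by (simp add: powr_numeral)
    qed
  qed
  also have "\<dots> = area TYPE('d) + (\<integral>z. (norm (f z))\<^sup>2 \<partial>surface_measure)"
    by (subst Bochner_Integration.integral_add)
       (auto intro!: surface_integrable_continuous continuous_intros c simp: surface_integral_const(2)[of 1, simplified])
  also have "\<dots> \<le> 1 + area TYPE('d)" using 1 by simp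
  finally have *: "(\<integral>z. norm (f z) powr p \<partial>surface_measure) \<le> 1 + area TYPE('d)" .
  have "Lp_norm p f \<le> (1 + area TYPE('d)) powr (1 / p)"
    unfolding Lp_norm_def using * p by (intro powr_mono2) auto
  also have "\<dots> \<le> (1 + area TYPE('d)) powr 1"
    using p area_pos[where 'd='d] by (intro powr_mono) auto
  finally show ?thesis using area_pos[where 'd='d] by simp
qed

lemma Lp_norm_cmult:
  assumes "c \<ge> 0" "p > 0"
  shows "Lp_norm p (\<lambda>z. of_real c * f z) = c * Lp_norm p f"
proof -
  have "(\<integral>z. norm (of_real c * f z) powr p \<partial>surface_measure) = c powr p * (\<integral>z. norm (f z) powr p \<partial>surface_measure)"
    using assms by (simp add: norm_mult powr_mult)
  then show ?thesis using assms by (simp add: Lp_norm_def powr_mult powr_powr)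
qed

lemma norm_integral_le:
  fixes f :: "'a \<Rightarrow> complex" and g :: "'a \<Rightarrow> real"
  assumes f: "f \<in> borel_measurable M" and g: "integrable M g" and le: "\<And>z. z \<in> space M \<Longrightarrow> norm (f z) \<le> g z"
  shows "norm (\<integral>z. f z \<partial>M) \<le> (\<integral>z. g z \<partial>M)"
proof -
  have "integrable M f"
    by (rule Bochner_Integration.integrable_bound[OF g f]) (auto intro!: AE_I2 order_trans[OF le])
  then have "(\<integral>z. norm (f z) \<partial>M) \<le> (\<integral>z. g z \<partial>M)"
    by (intro integral_mono integrable_norm g le)
  then show ?thesis using integral_norm_bound[of M f] by linarith
qed

text \<open>Young's inequality with \<open>b powr q' \<le> 1 + b ^ (2 * j)\<close> lets an even moment of order at least \<open>q'\<close> play the role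
of the norm in the dual exponent \<open>q'\<close>. Scaling \<open>f\<close> by a number \<open>\<epsilon>\<close> above its norm covers the functions
of norm zero.\<close>

lemma pairing_le_Lp:
  fixes f y :: "complex ^ 'd \<Rightarrow> complex"
  assumes q: "q > 1" and f: "f \<in> Lp_space q" and y: "y \<in> sphere_polys" and T: "T > 0"
    and yT: "(\<integral>z. norm (y z) ^ (2 * j) \<partial>surface_measure) \<le> T ^ (2 * j) * area TYPE('d)"
    and j: "real (2 * j) \<ge> q / (q - 1)"
  shows "norm (\<integral>z. f z * cnj (y z) \<partial>surface_measure) \<le> (1 + 2 * area TYPE('d)) * T * Lp_norm q f"
proof -
  define q' where "q' = q / (q - 1)"
  have q': "q' > 1" "1 / q + 1 / q' = 1" using q by (auto simp: q'_def field_simps)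
  have c: "continuous_on (sphere 0 1) y" by (rule sphere_polys_continuous[OF y])
  have If: "integrable surface_measure (\<lambda>z. norm (f z) powr q)" using f by (simp add: Lp_space_def)
  have mfy: "(\<lambda>z. f z * cnj (y z)) \<in> borel_measurable surface_measure"
    using f surface_measurable_continuous[OF continuous_on_cnj[OF c]]
    by (auto simp: Lp_space_def intro!: borel_measurable_times)
  have ineq: "norm (\<integral>z. f z * cnj (y z) \<partial>surface_measure) \<le> \<epsilon> * T * (1 + 2 * area TYPE('d))"
    if e: "\<epsilon> > Lp_norm q f" for \<epsilon>
  proof -
    have e0: "\<epsilon> > 0" using e Lp_norm_nonneg[of q f] by linarith
    have pt: "norm (f z * cnj (y z)) \<le> \<epsilon> * T * (norm (f z) powr q / \<epsilon> powr q + 1 + norm (y z) ^ (2 * j) / T ^ (2 * j))" for z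
    proof -
      let ?a = "norm (f z) / \<epsilon>" and ?b = "norm (y z) / T"
      have "?a * ?b \<le> ?a powr q / q + ?b powr q' / q'"
        using e0 T q q' by (intro Youngs_inequality) auto
      also have "\<dots> \<le> ?a powr q + ?b powr q'"
      proof -
        have "u / r \<le> u" if "u \<ge> 0" "r > 1" for u r :: real
          using that mult_left_mono[of 1 r u] by (simp add: field_simps)
        then show ?thesis using q q' by (intro add_mono) simp_all
      qed
      also have "?b powr q' \<le> 1 + ?b ^ (2 * j)"
      proof (cases "?b \<le> 1")
        case True
        then have "?b powr q' \<le> 1" using q' T by (intro powr_le1) auto
        moreover have "?b ^ (2 * j) \<ge> 0" using T by simp
        ultimately show ?thesis by linarith
      next
        case False
        then have "?b powr q' \<le> ?b powr real (2 * j)" using j by (intro powr_mono) (auto simp: q'_def)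
        also have "\<dots> = ?b ^ (2 * j)" using False T by (intro powr_realpow) (auto intro: less_trans[of 0 1])
        finally show ?thesis by simp
      qed
      finally have "?a * ?b \<le> ?a powr q + (1 + ?b ^ (2 * j))" by simp
      then have "\<epsilon> * T * (?a * ?b) \<le> \<epsilon> * T * (?a powr q + (1 + ?b ^ (2 * j)))"
        using e0 T by (intro mult_left_mono) auto
      moreover have "\<epsilon> * T * (?a * ?b) = norm (f z * cnj (y z))" using e0 T by (simp add: norm_mult)
      moreover have "?a powr q = norm (f z) powr q / \<epsilon> powr q" using e0 by (simp add: powr_divide)
      ultimately show ?thesis by (simp add: power_divide add.assoc)
    qed
    have int: "integrable surface_measure
        (\<lambda>z. \<epsilon> * T * (norm (f z) powr q / \<epsilon> powr q + 1 + norm (y z) ^ (2 * j) / T ^ (2 * j)))"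
      using T by (intro integrable_mult_right Bochner_Integration.integrable_add integrable_divide If
          surface_integrable_continuous continuous_intros c) auto
    have "norm (\<integral>z. f z * cnj (y z) \<partial>surface_measure)
      \<le> (\<integral>z. \<epsilon> * T * (norm (f z) powr q / \<epsilon> powr q + 1 + norm (y z) ^ (2 * j) / T ^ (2 * j)) \<partial>surface_measure)"
      by (rule norm_integral_le[OF mfy int pt])
    also have "\<dots> = \<epsilon> * T * ((\<integral>z. norm (f z) powr q \<partial>surface_measure) / \<epsilon> powr q + area TYPE('d)
        + (\<integral>z. norm (y z) ^ (2 * j) \<partial>surface_measure) / T ^ (2 * j))"
    proof -
      have "(\<integral>z. norm (f z) powr q / \<epsilon> powr q + 1 + norm (y z) ^ (2 * j) / T ^ (2 * j) \<partial>surface_measure)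
        = (\<integral>z. norm (f z) powr q / \<epsilon> powr q \<partial>surface_measure) + (\<integral>z. 1 \<partial>(surface_measure :: (complex ^ 'd) measure))
          + (\<integral>z. norm (y z) ^ (2 * j) / T ^ (2 * j) \<partial>surface_measure)"
        using T by (subst Bochner_Integration.integral_add, simp_all add: If)
          (auto intro!: surface_integrable_continuous continuous_intros c)
      then show ?thesis by (simp add: surface_integral_const(2)[of 1, simplified])
    qed
    also have "\<dots> \<le> \<epsilon> * T * (1 + area TYPE('d) + area TYPE('d))"
    proof -
      have "(\<integral>z. norm (f z) powr q \<partial>surface_measure) = Lp_norm q f powr q"
        using q by (simp add: Lp_norm_def powr_powr)
      also have "\<dots> \<le> \<epsilon> powr q" using e q Lp_norm_nonneg by (intro powr_mono2) auto
      finally have "(\<integral>z. norm (f z) powr q \<partial>surface_measure) / \<epsilon> powr q \<le> 1" using e0 by simp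
      moreover have "(\<integral>z. norm (y z) ^ (2 * j) \<partial>surface_measure) / T ^ (2 * j) \<le> area TYPE('d)"
        using yT T by (simp add: field_simps)
      ultimately show ?thesis using e0 T by (intro mult_left_mono add_mono) auto
    qed
    finally show ?thesis by (simp add: algebra_simps)
  qed
  define c where "c = T * (1 + 2 * area TYPE('d))"
  have c: "c > 0" unfolding c_def using T area_pos[where 'd='d] by simp
  have "norm (\<integral>z. f z * cnj (y z) \<partial>surface_measure) / c \<le> \<epsilon>" if "\<epsilon> > Lp_norm q f" for \<epsilon>
  proof -
    have "norm (\<integral>z. f z * cnj (y z) \<partial>surface_measure) \<le> \<epsilon> * c"
      using ineq[OF that] by (simp only: c_def mult.assoc)
    then show ?thesis using c by (simp add: pos_divide_le_eq)
  qed
  then have "norm (\<integral>z. f z * cnj (y z) \<partial>surface_measure) / c \<le> Lp_norm q f"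
    by (rule dense_ge)
  then have "norm (\<integral>z. f z * cnj (y z) \<partial>surface_measure) \<le> Lp_norm q f * c"
    using c by (simp add: pos_divide_le_eq)
  then show ?thesis by (simp add: c_def mult_ac)
qed

lemma pairing_le_L1:
  fixes f y :: "complex ^ 'd \<Rightarrow> complex"
  assumes f: "f \<in> Lp_space 1" and y: "y \<in> sphere_polys" and yT: "\<And>z. z \<in> sphere 0 1 \<Longrightarrow> norm (y z) \<le> T"
  shows "norm (\<integral>z. f z * cnj (y z) \<partial>surface_measure) \<le> T * Lp_norm 1 f"
proof -
  have If: "integrable surface_measure (\<lambda>z. norm (f z))" using f by (simp add: Lp_space_def)
  have "norm (\<integral>z. f z * cnj (y z) \<partial>surface_measure) \<le> (\<integral>z. T * norm (f z) \<partial>surface_measure)"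
  proof (rule norm_integral_le)
    show "(\<lambda>z. f z * cnj (y z)) \<in> borel_measurable surface_measure"
      using f surface_measurable_continuous[OF continuous_on_cnj[OF sphere_polys_continuous[OF y]]]
      by (auto simp: Lp_space_def intro!: borel_measurable_times)
    show "norm (f z * cnj (y z)) \<le> T * norm (f z)" if "z \<in> space surface_measure" for z
      using that mult_right_mono[OF yT[of z], of "norm (f z)"] by (simp add: norm_mult mult.commute)
  qed (intro integrable_mult_right If)
  also have "\<dots> = T * Lp_norm 1 f" by (simp add: Lp_norm_def)
  finally show ?thesis .
qed

section \<open>Spaces of polynomials of bounded bidegree\<close>

definition bimonomials_upto :: "nat \<Rightarrow> (complex ^ 'd \<Rightarrow> complex) set" where
  "bimonomials_upto M = (\<lambda>(\<alpha>, \<beta>). bimonomial \<alpha> \<beta>) ` ({\<alpha>. sum \<alpha> UNIV \<le> M} \<times> {\<beta>. sum \<beta> UNIV \<le> M})"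

definition polys_upto :: "nat \<Rightarrow> (complex ^ 'd \<Rightarrow> complex) set" where
  "polys_upto M = cfun.span (bimonomials_upto M)"

lemma multiindices_bound:
  "finite {\<alpha> :: 'd::finite \<Rightarrow> nat. sum \<alpha> UNIV \<le> M}"
  "card {\<alpha> :: 'd::finite \<Rightarrow> nat. sum \<alpha> UNIV \<le> M} \<le> (M + 1) ^ CARD('d)"
proof -
  have sub: "{\<alpha> :: 'd \<Rightarrow> nat. sum \<alpha> UNIV \<le> M} \<subseteq> (\<Pi>\<^sub>E i\<in>UNIV. {..M})"
  proof (rule subsetI)
    fix \<alpha> :: "'d \<Rightarrow> nat" assume "\<alpha> \<in> {\<alpha>. sum \<alpha> UNIV \<le> M}"
    then have "\<alpha> i \<le> M" for i using member_le_sum[of i UNIV \<alpha>] by simp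
    then show "\<alpha> \<in> (\<Pi>\<^sub>E i\<in>UNIV. {..M})" by (simp add: PiE_iff)
  qed
  have fin: "finite (\<Pi>\<^sub>E i\<in>(UNIV :: 'd set). {..M})" by (intro finite_PiE) auto
  show "finite {\<alpha> :: 'd \<Rightarrow> nat. sum \<alpha> UNIV \<le> M}" by (rule finite_subset[OF sub fin])
  show "card {\<alpha> :: 'd \<Rightarrow> nat. sum \<alpha> UNIV \<le> M} \<le> (M + 1) ^ CARD('d)"
    using card_mono[OF fin sub] by (simp add: card_PiE)
qed

lemma finite_bimonomials_upto: "finite (bimonomials_upto M)"
  unfolding bimonomials_upto_def by (intro finite_imageI finite_cartesian_product multiindices_bound)

lemma card_bimonomials_upto: "card (bimonomials_upto M :: (complex ^ 'd \<Rightarrow> complex) set) \<le> (M + 1) ^ (2 * CARD('d))"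
proof -
  have "card (bimonomials_upto M :: (complex ^ 'd \<Rightarrow> complex) set)
      \<le> card ({\<alpha> :: 'd \<Rightarrow> nat. sum \<alpha> UNIV \<le> M} \<times> {\<beta> :: 'd \<Rightarrow> nat. sum \<beta> UNIV \<le> M})"
    unfolding bimonomials_upto_def by (intro card_image_le finite_cartesian_product multiindices_bound)
  also have "\<dots> \<le> (M + 1) ^ CARD('d) * (M + 1) ^ CARD('d)"
    unfolding card_cartesian_product by (intro mult_mono multiindices_bound) auto
  finally show ?thesis by (simp add: mult_2 power_add)
qed

lemma subspace_polys_upto: "cfun.subspace (polys_upto M)"
  unfolding polys_upto_def by (rule cfun.subspace_span)

lemma bihom_polys_upto:
  assumes "bihom m n f" "m \<le> M" "n \<le> M"
  shows "f \<in> polys_upto M"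
proof -
  have "f \<in> bihomogeneous m n" using assms(1) by (simp add: bihomogeneous_iff)
  moreover have "{bimonomial \<alpha> \<beta> | \<alpha> \<beta>. sum \<alpha> UNIV = m \<and> sum \<beta> UNIV = n} \<subseteq> (bimonomials_upto M :: (complex ^ 'a \<Rightarrow> complex) set)"
    using assms by (force simp: bimonomials_upto_def)
  ultimately show ?thesis unfolding bihomogeneous_def polys_upto_def using cfun.span_mono by blast
qed

lemma bimonomials_upto_mult:
  assumes "f \<in> bimonomials_upto M" "g \<in> bimonomials_upto M'"
  shows "(\<lambda>z. f z * g z) \<in> bimonomials_upto (M + M')"
proof -
  obtain \<alpha> \<beta> \<gamma> \<delta> where f: "f = bimonomial \<alpha> \<beta>" "sum \<alpha> UNIV \<le> M" "sum \<beta> UNIV \<le> M"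
    and g: "g = bimonomial \<gamma> \<delta>" "sum \<gamma> UNIV \<le> M'" "sum \<delta> UNIV \<le> M'"
    using assms by (auto simp: bimonomials_upto_def)
  have "(\<lambda>z. f z * g z) = bimonomial (\<lambda>j. \<alpha> j + \<gamma> j) (\<lambda>j. \<beta> j + \<delta> j)"
    by (simp add: f g bimonomial_mult fun_eq_iff)
  moreover have "sum (\<lambda>j. \<alpha> j + \<gamma> j) UNIV \<le> M + M'" "sum (\<lambda>j. \<beta> j + \<delta> j) UNIV \<le> M + M'"
    using f g by (simp_all add: sum.distrib add_mono)
  ultimately show ?thesis unfolding bimonomials_upto_def by (auto intro!: image_eqI[of _ _ "(\<lambda>j. \<alpha> j + \<gamma> j, \<lambda>j. \<beta> j + \<delta> j)"])
qed

lemma polys_upto_mult: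
  assumes f: "f \<in> polys_upto M" and g: "g \<in> polys_upto M'"
  shows "(\<lambda>z. f z * g z) \<in> polys_upto (M + M')"
  using f[unfolded polys_upto_def]
proof (induction rule: span_cfun_induct)
  case zero
  show ?case using subspace_zero_fun[OF subspace_polys_upto] by simp
next
  case (step c x h)
  have "(\<lambda>z. x z * g z) \<in> polys_upto (M + M')"
    using g[unfolded polys_upto_def]
  proof (induction rule: span_cfun_induct)
    case zero
    show ?case using subspace_zero_fun[OF subspace_polys_upto] by simp
  next
    case (step c y h)
    have "(\<lambda>z. x z * y z) \<in> polys_upto (M + M')"
      unfolding polys_upto_def
      by (intro cfun.span_base bimonomials_upto_mult step \<open>x \<in> bimonomials_upto M\<close>)
    from subspace_add_fun[OF subspace_polys_upto subspace_cmult_fun[OF subspace_polys_upto this, of c] step.IH]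
    show ?case by (simp add: algebra_simps)
  qed
  from subspace_add_fun[OF subspace_polys_upto subspace_cmult_fun[OF subspace_polys_upto this, of c] step.IH]
  show ?case by (simp add: algebra_simps)
qed

lemma polys_upto_power:
  assumes "f \<in> polys_upto M"
  shows "(\<lambda>z. f z ^ j) \<in> polys_upto (j * M)"
proof (induction j)
  case 0
  show ?case using bihom_polys_upto[OF bihom.const, of 0 1] by simp
next
  case (Suc j)
  show ?case using polys_upto_mult[OF assms Suc] by simp
qed

lemma bimonomials_upto_bihom:
  assumes "f \<in> bimonomials_upto M"
  shows "\<exists>m n. m \<le> M \<and> n \<le> M \<and> bihom m n f"
  using assms bihom_bimonomial by (fastforce simp: bimonomials_upto_def)

lemma polys_upto_polyfun: "f \<in> polys_upto M \<Longrightarrow> polyfun f"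
  unfolding polys_upto_def
proof (induction rule: span_cfun_induct)
  case (step c g h)
  then show ?case using bimonomials_upto_bihom[of g M] bihom_polyfun by (fastforce intro!: polyfun_intros)
qed (rule polyfun.const)

lemma polys_upto_rot:
  assumes "f \<in> polys_upto M" shows "rot j k f \<in> polys_upto M"
proof -
  have "polyfun f \<and> rot j k f \<in> polys_upto M"
    using assms[unfolded polys_upto_def]
  proof (induction rule: span_cfun_induct)
    case zero
    show ?case using subspace_zero_fun[OF subspace_polys_upto] by (simp add: rot_const polyfun.const)
  next
    case (step c g h)
    obtain m n where b: "m \<le> M" "n \<le> M" "bihom m n g" using bimonomials_upto_bihom[OF step.hyps] by blast
    have g: "polyfun g" using b(3) by (rule bihom_polyfun)
    have "rot j k g \<in> polys_upto M" using bihom_polys_upto[OF bihom_rot[OF b(3)] b(1,2)] .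
    with step.IH g show ?case
      by (auto simp: rot_add rot_cmult polyfun_intros
          intro!: polyfun_intros subspace_add_fun subspace_cmult_fun subspace_polys_upto)
  qed
  then show ?thesis ..
qed

lemma sphere_restrict_polys_upto_span:
  "sphere_restrict ` polys_upto M \<subseteq> cfun.span (sphere_restrict ` bimonomials_upto M)"
  unfolding polys_upto_def by (auto intro: sphere_restrict_span)

lemma norm_sum_mult_sq_le:
  fixes a b :: "'i \<Rightarrow> complex"
  shows "(norm (\<Sum>i\<in>I. a i * b i))\<^sup>2 \<le> (\<Sum>i\<in>I. (norm (a i))\<^sup>2) * (\<Sum>i\<in>I. (norm (b i))\<^sup>2)"
proof -
  have "norm (\<Sum>i\<in>I. a i * b i) \<le> (\<Sum>i\<in>I. norm (a i) * norm (b i))"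
    by (rule order_trans[OF norm_sum]) (simp add: norm_mult)
  then have "(norm (\<Sum>i\<in>I. a i * b i))\<^sup>2 \<le> (\<Sum>i\<in>I. norm (a i) * norm (b i))\<^sup>2"
    by (intro power_mono) auto
  also have "\<dots> \<le> (\<Sum>i\<in>I. (norm (a i))\<^sup>2) * (\<Sum>i\<in>I. (norm (b i))\<^sup>2)" by (rule Cauchy_Schwarz_ineq_sum)
  finally show ?thesis .
qed

lemma parseval:
  assumes B: "orthonormal B" "finite B" and f: "f \<in> cfun.span B"
  shows "(\<Sum>b\<in>B. (norm (sip f b))\<^sup>2) = (\<integral>z. (norm (f z))\<^sup>2 \<partial>surface_measure)"
proof -
  have fs: "f \<in> sphere_polys" by (rule orthonormal_expand(1)[OF B f])
  have Bs: "b \<in> B \<Longrightarrow> b \<in> sphere_polys" for b using B by (auto simp: orthonormal_def)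
  have "sip f f = sip (\<lambda>z. \<Sum>b\<in>B. sip f b * b z) f"
    using arg_cong[OF orthonormal_expand(2)[OF B f], of "\<lambda>g. sip g f"] .
  also have "\<dots> = (\<Sum>b\<in>B. sip f b * cnj (sip f b))"
    by (subst sip_sum) (simp_all add: Bs fs sip_cnj)
  also have "\<dots> = of_real (\<Sum>b\<in>B. (norm (sip f b))\<^sup>2)"
    unfolding of_real_sum complex_norm_square ..
  finally show ?thesis unfolding sip_self of_real_eq_iff by (rule sym)
qed

text \<open>Evaluation at a point, on an invariant space of dimension \<open>n\<close>, has norm \<open>\<surd>(n / area)\<close> in \<open>L\<^sup>2\<close>. Applied to
\<open>f\<close> itself this would cost a factor \<open>\<surd>n\<close> between \<open>f w\<close> and the norm of \<open>f\<close>; applied to the power \<open>f ^ j\<close> the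
dimension, still polynomial in \<open>j M\<close>, enters only through its root of order \<open>2 j\<close>.\<close>

lemma sup_le_moment:
  fixes f :: "complex ^ 'd \<Rightarrow> complex"
  assumes f: "f \<in> polys_upto M" and w: "w \<in> sphere 0 1"
  shows "norm (f w) ^ (2 * j)
    \<le> real (j * M + 1) ^ (2 * CARD('d)) / area TYPE('d) * (\<integral>z. norm (f z) ^ (2 * j) \<partial>surface_measure)"
proof -
  let ?W = "polys_upto (j * M) :: (complex ^ 'd \<Rightarrow> complex) set"
  let ?F = "sphere_restrict ` bimonomials_upto (j * M) :: (complex ^ 'd \<Rightarrow> complex) set"
  have sub: "cfun.subspace (sphere_restrict ` ?W)" by (rule subspace_sphere_restrict[OF subspace_polys_upto])
  have sp: "sphere_restrict ` ?W \<subseteq> sphere_polys"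
    unfolding sphere_polys_def using polys_upto_polyfun by blast
  have fF: "finite ?F" by (intro finite_imageI finite_bimonomials_upto)
  obtain B where B: "finite B" "orthonormal B" "cfun.span B = sphere_restrict ` ?W"
    using orthonormal_basis_exists[OF sub sp fF sphere_restrict_polys_upto_span] .
  have "card B \<le> card ?F"
  proof -
    have "B \<subseteq> cfun.span ?F"
      using cfun.span_superset[of B] B(3) sphere_restrict_polys_upto_span by blast
    then show ?thesis
      using cfun.independent_span_bound[OF fF orthonormal_independent[OF B(2)]] by blast
  qed
  also have "\<dots> \<le> (j * M + 1) ^ (2 * CARD('d))"
    using card_image_le[OF finite_bimonomials_upto, of sphere_restrict "j * M"] card_bimonomials_upto
    by (meson order_trans)
  finally have cB: "real (card B) \<le> real (j * M + 1) ^ (2 * CARD('d))"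
    by (metis of_nat_le_iff of_nat_power)
  define g where "g = sphere_restrict (\<lambda>z. f z ^ j)"
  have gB: "g \<in> cfun.span B" unfolding g_def B(3) by (intro imageI polys_upto_power f)
  have gz: "g z = f z ^ j" if "z \<in> sphere 0 1" for z using that by (simp add: g_def)
  have "norm (f w) ^ (2 * j) = (norm (g w))\<^sup>2"
    by (simp add: gz[OF w] norm_power power_mult[symmetric] mult.commute)
  also have "\<dots> = (norm (\<Sum>b\<in>B. sip g b * b w))\<^sup>2"
    using fun_cong[OF orthonormal_expand(2)[OF B(2,1) gB], of w] by simp
  also have "\<dots> \<le> (\<Sum>b\<in>B. (norm (sip g b))\<^sup>2) * (\<Sum>b\<in>B. (norm (b w))\<^sup>2)"
    by (rule norm_sum_mult_sq_le)
  also have "(\<Sum>b\<in>B. (norm (sip g b))\<^sup>2) = (\<integral>z. (norm (g z))\<^sup>2 \<partial>surface_measure)"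
    by (rule parseval[OF B(2,1) gB])
  also have "\<dots> = (\<integral>z. norm (f z) ^ (2 * j) \<partial>surface_measure)"
    by (rule Bochner_Integration.integral_cong) (simp_all add: gz norm_power power_mult[symmetric] mult.commute)
  also have "(\<Sum>b\<in>B. (norm (b w))\<^sup>2) = real (card B) / area TYPE('d)"
    by (rule kernel_diagonal[OF _ _ B w]) (auto intro: polys_upto_polyfun polys_upto_rot)
  also have "(\<integral>z. norm (f z) ^ (2 * j) \<partial>surface_measure) * (real (card B) / area TYPE('d))
    \<le> (\<integral>z. norm (f z) ^ (2 * j) \<partial>surface_measure) * (real (j * M + 1) ^ (2 * CARD('d)) / area TYPE('d))"
    using cB area_pos[where 'd='d] by (intro mult_left_mono divide_right_mono integral_nonneg) auto
  finally show ?thesis by (simp add: mult.commute)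
qed

section \<open>The levels of spherical harmonics\<close>

lemma subspace_harm: "cfun.subspace {f. harm m n f}"
proof (rule cfun.subspaceI)
  show "0 \<in> {f. harm m n f}" by (simp add: harm_def zero_fun_def bihom.zero)
  show "x + y \<in> {f. harm m n f}" if "x \<in> {f. harm m n f}" "y \<in> {f. harm m n f}" for x y :: "complex ^ 'a \<Rightarrow> complex"
  proof -
    have p: "polyfun x" "polyfun y" using that by (auto dest: harm_polyfun)
    have L: "(\<Sum>j\<in>UNIV. wirtinger j (wirtinger_bar j x) z) = 0" "(\<Sum>j\<in>UNIV. wirtinger j (wirtinger_bar j y) z) = 0" for z
      using that by (simp_all add: harm_def fun_eq_iff)
    have "(\<Sum>j\<in>UNIV. wirtinger j (wirtinger_bar j (\<lambda>z. x z + y z)) z) = 0" for z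
      using L[of z] p by (simp add: wirtinger_rules sum.distrib)
    then show ?thesis using that by (auto simp: harm_def plus_fun_def intro: bihom.add)
  qed
  show "cscale c x \<in> {f. harm m n f}" if "x \<in> {f. harm m n f}" for c and x :: "complex ^ 'a \<Rightarrow> complex"
  proof -
    have p: "polyfun x" using that by (auto dest: harm_polyfun)
    have L: "(\<Sum>j\<in>UNIV. wirtinger j (wirtinger_bar j x) z) = 0" for z
      using that by (simp add: harm_def fun_eq_iff)
    have "(\<Sum>j\<in>UNIV. wirtinger j (wirtinger_bar j (\<lambda>z. c * x z)) z) = 0" for z
      using L[of z] p by (simp add: wirtinger_cmult polyfun_intros sum_distrib_left[symmetric])
    then show ?thesis using that by (auto simp: harm_def cscale_def intro: bihom_cmult)
  qed
qed

definition level_polys :: "nat \<Rightarrow> (complex ^ 'd \<Rightarrow> complex) set" where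
  "level_polys l = cfun.span (\<Union>(m, n) \<in> {(m, n). max m n = l}. {f. harm m n f})"

lemma subspace_level_polys: "cfun.subspace (level_polys l)"
  unfolding level_polys_def by (rule cfun.subspace_span)

lemma harmonics_level_eq: "harmonics_level l = sphere_restrict ` level_polys l"
proof
  have "harmonics m n \<subseteq> sphere_restrict ` level_polys l" if "max m n = l" for m n
    unfolding harmonics_eq level_polys_def using that by (intro image_mono) (auto intro: cfun.span_base)
  then show "harmonics_level l \<subseteq> sphere_restrict ` level_polys l"
    unfolding harmonics_level_def
    by (intro cfun.span_minimal subspace_sphere_restrict subspace_level_polys) auto
  have "sphere_restrict ` (\<Union>(m, n) \<in> {(m, n). max m n = l}. {f. harm m n f}) \<subseteq> (\<Union>(m, n) \<in> {(m, n). max m n = l}. harmonics m n)"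
    by (auto simp: harmonics_eq)
  from cfun.span_mono[OF this]
  show "sphere_restrict ` level_polys l \<subseteq> harmonics_level l"
    unfolding harmonics_level_def level_polys_def using sphere_restrict_span by blast
qed

lemma level_polys_upto: "level_polys l \<subseteq> polys_upto l"
  unfolding level_polys_def
  by (intro cfun.span_minimal subspace_polys_upto) (auto simp: harm_def intro: bihom_polys_upto)

lemma level_polys_rot:
  assumes "f \<in> level_polys l" shows "rot j k f \<in> level_polys l"
proof -
  have "polyfun f \<and> rot j k f \<in> level_polys l"
    using assms[unfolded level_polys_def]
  proof (induction rule: span_cfun_induct)
    case zero
    show ?case using subspace_zero_fun[OF subspace_level_polys] by (simp add: rot_const polyfun.const)
  next
    case (step c g h)
    then obtain m n where mn: "max m n = l" "harm m n g" by auto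
    have g: "polyfun g" using mn(2) by (rule harm_polyfun)
    have "rot j k g \<in> level_polys l"
      unfolding level_polys_def using harm_rot[OF mn(2)] mn(1) by (intro cfun.span_base) auto
    with step.IH g show ?case
      by (auto simp: rot_add rot_cmult polyfun_intros
          intro!: polyfun_intros subspace_add_fun subspace_cmult_fun subspace_level_polys)
  qed
  then show ?thesis ..
qed

lemma subspace_harmonics_level: "cfun.subspace (harmonics_level l)"
  unfolding harmonics_level_def by (rule cfun.subspace_span)

lemma harmonics_level_sphere_polys: "harmonics_level l \<subseteq> sphere_polys"
  unfolding harmonics_level_eq sphere_polys_def using level_polys_upto polys_upto_polyfun by blast

lemma harmonics_subset_level: "harmonics m n \<subseteq> harmonics_level (max m n)"
  unfolding harmonics_level_def by (intro order_trans[OF _ cfun.span_superset]) auto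

lemma harmonics_level_finite_span:
  "harmonics_level l \<subseteq> cfun.span (sphere_restrict ` bimonomials_upto l)"
  unfolding harmonics_level_eq using sphere_restrict_polys_upto_span level_polys_upto by blast

lemma harmonics_orthogonal_level:
  fixes f g :: "complex ^ 'd \<Rightarrow> complex"
  assumes d: "CARD('d) \<ge> 2" and f: "f \<in> harmonics_level l" and g: "g \<in> harmonics_level l'" and ne: "l \<noteq> l'"
  shows "sip f g = 0"
proof -
  have base: "sip x y = 0" if xy: "x \<in> harmonics m n" "y \<in> harmonics m' n'" "max m n = l" "max m' n' = l'"
    for x y :: "complex ^ 'd \<Rightarrow> complex" and m n m' n'
  proof -
    obtain p r where p: "x = sphere_restrict p" "harm m n p" and r: "y = sphere_restrict r" "harm m' n' r"
      using xy by (auto simp: harmonics_eq)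
    have "sip x y = (\<integral>z. p z * cnj (r z) \<partial>surface_measure)"
      unfolding sip_def p r by (rule Bochner_Integration.integral_cong) simp_all
    also have "\<dots> = 0" using xy ne by (intro harm_orthogonal[OF p(2) r(2) _ d]) auto
    finally show ?thesis .
  qed
  have hs: "harmonics m n \<subseteq> (sphere_polys :: (complex ^ 'd \<Rightarrow> complex) set)" for m n
    using harmonics_subset_level harmonics_level_sphere_polys by blast
  have "h \<in> sphere_polys \<and> sip h g = 0" if "h \<in> harmonics_level l" for h
    using that[unfolded harmonics_level_def]
  proof (induction rule: span_cfun_induct)
    case zero
    show ?case using subspace_zero_fun[OF subspace_sphere_polys] by (simp add: sip_def)
  next
    case (step c x h)
    then obtain m n where x: "x \<in> harmonics m n" "max m n = l" by auto
    have "k \<in> sphere_polys \<and> sip k x = 0" if "k \<in> harmonics_level l'" for k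
      using that[unfolded harmonics_level_def]
    proof (induction rule: span_cfun_induct)
      case zero
      show ?case using subspace_zero_fun[OF subspace_sphere_polys] by (simp add: sip_def)
    next
      case (step c y k)
      then obtain m' n' where y: "y \<in> harmonics m' n'" "max m' n' = l'" by auto
      have "sip y x = 0" using arg_cong[OF base[OF x(1) y(1) x(2) y(2)], of cnj] by (simp add: sip_cnj)
      moreover have cy: "(\<lambda>z. c * y z) \<in> sphere_polys"
        using y hs by (intro subspace_cmult_fun subspace_sphere_polys) auto
      moreover have "x \<in> sphere_polys" using x hs by blast
      ultimately show ?case
        using step.IH subspace_add_fun[OF subspace_sphere_polys cy, of k]
        by (simp add: sip_add[OF cy] sip_cmult)
    qed
    from this[OF g] have "sip x g = 0" "g \<in> sphere_polys" using sip_cnj[of g x] by auto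
    moreover have cx: "(\<lambda>z. c * x z) \<in> sphere_polys"
      using x hs by (intro subspace_cmult_fun subspace_sphere_polys) auto
    ultimately show ?case
      using step.IH subspace_add_fun[OF subspace_sphere_polys cx, of h] by (auto simp: sip_add sip_cmult)
  qed
  from this[OF f] show ?thesis ..
qed

text \<open>The definite description in \<open>zonal\<close> denotes: an orthonormal basis gives the reproducing kernel, and two
kernels differ by an element orthogonal to itself.\<close>

lemma zonal_in_harmonics:
  fixes w :: "complex ^ 'd"
  assumes w: "w \<in> sphere 0 1"
  shows "zonal m n w \<in> harmonics m n"
proof -
  let ?V = "harmonics m n :: (complex ^ 'd \<Rightarrow> complex) set"
  have sub: "cfun.subspace ?V" unfolding harmonics_eq by (rule subspace_sphere_restrict[OF subspace_harm])
  have sp: "?V \<subseteq> sphere_polys" using harmonics_subset_level harmonics_level_sphere_polys by blast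
  have fF: "finite (sphere_restrict ` bimonomials_upto (max m n) :: (complex ^ 'd \<Rightarrow> complex) set)"
    by (intro finite_imageI finite_bimonomials_upto)
  have "?V \<subseteq> cfun.span (sphere_restrict ` bimonomials_upto (max m n))"
    using harmonics_subset_level harmonics_level_finite_span by blast
  then obtain B where B: "finite B" "orthonormal B" "cfun.span B = ?V"
    using orthonormal_basis_exists[OF sub sp fF] by blast
  have Bs: "b \<in> B \<Longrightarrow> b \<in> sphere_polys" for b using B by (auto simp: orthonormal_def)
  have "\<exists>!Z. Z \<in> ?V \<and> (\<forall>f\<in>?V. f w = sip f Z)"
  proof (rule ex_ex1I)
    define Z where "Z = (\<lambda>z. \<Sum>b\<in>B. cnj (b w) * b z)"
    have "Z \<in> ?V" unfolding Z_def B(3)[symmetric]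
      by (intro subspace_sum_fun cfun.subspace_span cfun.span_base)
    moreover have "f w = sip f Z" if "f \<in> ?V" for f
    proof -
      have "sip f Z = (\<Sum>b\<in>B. b w * sip f b)"
        unfolding Z_def using that sp by (subst sip_sum_right) (auto simp: Bs)
      also have "\<dots> = f w"
        using fun_cong[OF orthonormal_expand(2)[OF B(2,1), of f], of w] that B(3) by (simp add: mult.commute)
      finally show ?thesis by simp
    qed
    ultimately show "\<exists>Z. Z \<in> ?V \<and> (\<forall>f\<in>?V. f w = sip f Z)" by blast
  next
    fix Z Z' assume Z: "Z \<in> ?V \<and> (\<forall>f\<in>?V. f w = sip f Z)" and Z': "Z' \<in> ?V \<and> (\<forall>f\<in>?V. f w = sip f Z')"
    define D where "D = (\<lambda>z. Z z - Z' z)"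
    have D: "D \<in> ?V" unfolding D_def using Z Z' by (intro subspace_diff_fun sub) auto
    have DD: "D = (\<lambda>z. Z z + (- 1) * Z' z)" by (simp add: D_def)
    have Z's: "(\<lambda>z. (- 1) * Z' z) \<in> sphere_polys"
      using Z' sp by (intro subspace_cmult_fun subspace_sphere_polys) auto
    have "sip D D = sip Z D + (- 1) * sip Z' D"
      unfolding sip_cmult[symmetric] using Z D sp Z's by (subst sip_add[symmetric]) (auto simp: D_def)
    also have "sip Z D = cnj (D w)" using Z D sip_cnj[of D Z] by simp
    also have "sip Z' D = cnj (D w)" using Z' D sip_cnj[of D Z'] by simp
    finally have "D = (\<lambda>z. 0)" using sip_self_eq_0[of D] D sp by auto
    then show "Z = Z'" by (auto simp: D_def fun_eq_iff)
  qed
  from theI'[OF this] show ?thesis unfolding zonal_def sip_def by blast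
qed

lemma conv_zonal_eq_sip: "conv_zonal \<phi> m n w = sip \<phi> (zonal m n w)"
  by (simp add: conv_zonal_def sip_def)

definition level_basis :: "nat \<Rightarrow> (complex ^ 'd \<Rightarrow> complex) set" where
  "level_basis l = (SOME B. finite B \<and> orthonormal B \<and> cfun.span B = harmonics_level l)"

lemma level_basis:
  "finite (level_basis l :: (complex ^ 'a \<Rightarrow> complex) set)"
  "orthonormal (level_basis l :: (complex ^ 'a \<Rightarrow> complex) set)"
  "cfun.span (level_basis l) = (harmonics_level l :: (complex ^ 'a \<Rightarrow> complex) set)"
proof -
  have "\<exists>B. finite B \<and> orthonormal B \<and> cfun.span B = (harmonics_level l :: (complex ^ 'a \<Rightarrow> complex) set)"
    using orthonormal_basis_exists[OF subspace_harmonics_level harmonics_level_sphere_polys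
      finite_imageI[OF finite_bimonomials_upto] harmonics_level_finite_span] by metis
  from someI_ex[OF this]
  show "finite (level_basis l :: (complex ^ 'a \<Rightarrow> complex) set)"
    "orthonormal (level_basis l :: (complex ^ 'a \<Rightarrow> complex) set)"
    "cfun.span (level_basis l) = (harmonics_level l :: (complex ^ 'a \<Rightarrow> complex) set)"
    unfolding level_basis_def by blast+
qed

lemma card_level_basis: "card (level_basis l :: (complex ^ 'd \<Rightarrow> complex) set) = cfun.dim (harmonics_level l :: (complex ^ 'd \<Rightarrow> complex) set)"
  by (rule orthonormal_dim[OF level_basis(2,3), symmetric])

lemma level_kernel:
  fixes z :: "complex ^ 'd"
  assumes "z \<in> sphere 0 1"
  shows "(\<Sum>b\<in>level_basis l. (norm (b z))\<^sup>2)
    = real (cfun.dim (harmonics_level l :: (complex ^ 'd \<Rightarrow> complex) set)) / area TYPE('d)"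
  unfolding card_level_basis[symmetric]
proof (rule kernel_diagonal[OF _ _ level_basis(1,2) _ assms])
  show "cfun.span (level_basis l) = sphere_restrict ` level_polys l"
    by (simp add: level_basis(3) harmonics_level_eq)
qed (use level_polys_upto polys_upto_polyfun level_polys_rot in blast)+

lemma level_basis_level: "b \<in> level_basis l \<Longrightarrow> b \<in> harmonics_level l"
  using cfun.span_base[of b "level_basis l"] by (simp add: level_basis(3))

lemma dim_level_pos: "cfun.dim (harmonics_level l :: (complex ^ 'd \<Rightarrow> complex) set) \<ge> 1"
proof (rule ccontr)
  assume "\<not> ?thesis"
  moreover have "finite (level_basis l :: (complex ^ 'd \<Rightarrow> complex) set)" by (rule level_basis)
  ultimately have "level_basis l = ({} :: (complex ^ 'd \<Rightarrow> complex) set)"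
    by (metis card_level_basis card_0_eq less_one not_le)
  then have triv: "harmonics_level l = {0 :: complex ^ 'd \<Rightarrow> complex}"
    using level_basis(3)[of l, where 'a = 'd] by simp
  define p where "p = (\<lambda>z :: complex ^ 'd. (z $ undefined) ^ l)"
  have "wirtinger_bar j p = (\<lambda>z. 0)" for j
  proof -
    have "wirtinger_bar j (\<lambda>z :: complex ^ 'd. (z $ undefined) ^ k) = (\<lambda>z. 0)" for k
      by (induction k) (auto simp: wirtinger_bar_mult polyfun_intros)
    then show ?thesis by (simp add: p_def)
  qed
  then have "harm l 0 p"
    using bihom_power[OF bihom.coord, of l undefined] by (simp add: harm_def p_def)
  then have "sphere_restrict p \<in> harmonics_level l"
    using harmonics_subset_level[of l 0] by (auto simp: harmonics_eq)
  then have "sphere_restrict p (axis undefined 1) = 0" by (simp add: triv)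
  moreover have "norm (axis undefined 1 :: complex ^ 'd) = 1" by (simp add: norm_eq_sqrt_inner inner_axis_axis)
  ultimately show False by (simp add: p_def)
qed

section \<open>A graded orthonormal basis\<close>

text \<open>Each basis function is paired with its level, on which its eigenvalue depends.\<close>

definition graded_basis :: "nat \<Rightarrow> (nat \<times> (complex ^ 'd \<Rightarrow> complex)) set" where
  "graded_basis N = (SIGMA l:{..N}. level_basis l)"

lemma finite_graded_basis: "finite (graded_basis N)"
  unfolding graded_basis_def by (intro finite_SigmaI level_basis) auto

lemma graded_basis_sphere_polys: "i \<in> graded_basis N \<Longrightarrow> snd i \<in> sphere_polys"
  using level_basis_level harmonics_level_sphere_polys by (fastforce simp: graded_basis_def)

lemma graded_basis_orthonormal:
  fixes i k :: "nat \<times> (complex ^ 'd \<Rightarrow> complex)"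
  assumes d: "CARD('d) \<ge> 2" and "i \<in> graded_basis N" "k \<in> graded_basis N"
  shows "sip (snd i) (snd k) = (if i = k then 1 else 0)"
proof (cases "fst i = fst k")
  case True
  have "snd i \<in> level_basis (fst i)" "snd k \<in> level_basis (fst i)"
    using assms True by (auto simp: graded_basis_def)
  then have "sip (snd i) (snd k) = (if snd i = snd k then 1 else 0)"
    using level_basis(2)[of "fst i"] unfolding orthonormal_def by blast
  then show ?thesis using True by (simp add: prod_eq_iff)
next
  case False
  then show ?thesis
    using assms harmonics_orthogonal_level[OF d level_basis_level level_basis_level False, of "snd i" "snd k"]
    by (auto simp: graded_basis_def)
qed

lemma sum_graded_basis: "(\<Sum>i\<in>graded_basis N. f (fst i) (snd i)) = (\<Sum>l\<le>N. \<Sum>b\<in>level_basis l. f l b)"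
  unfolding graded_basis_def by (subst sum.Sigma) (auto simp: level_basis case_prod_unfold)

lemma card_graded_basis:
  assumes d: "CARD('d) \<ge> 2"
  shows "card (graded_basis N :: (nat \<times> (complex ^ 'd \<Rightarrow> complex)) set) = cfun.dim (harmonics_upto N :: (complex ^ 'd \<Rightarrow> complex) set)"
proof -
  let ?G = "graded_basis N :: (nat \<times> (complex ^ 'd \<Rightarrow> complex)) set"
  have inj: "inj_on snd ?G"
  proof (rule inj_onI)
    fix i k assume ik: "i \<in> ?G" "k \<in> ?G" "snd i = snd k"
    have "sip (snd i) (snd k) = 1" using graded_basis_orthonormal[OF d ik(1) ik(1)] ik(3) by simp
    then show "i = k" using graded_basis_orthonormal[OF d ik(1,2)] by (simp split: if_splits)
  qed
  have on: "orthonormal (snd ` ?G)"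
    unfolding orthonormal_def
    using graded_basis_orthonormal[OF d] graded_basis_sphere_polys inj
    by (auto simp: inj_on_def)
  have "cfun.span (snd ` ?G) = harmonics_upto N"
  proof
    show "cfun.span (snd ` ?G) \<subseteq> harmonics_upto N"
      unfolding harmonics_upto_def using level_basis_level by (intro cfun.span_mono) (fastforce simp: graded_basis_def)
    have "harmonics_level l \<subseteq> cfun.span (snd ` ?G)" if "l \<le> N" for l
    proof -
      have "level_basis l \<subseteq> snd ` ?G" using that by (force simp: graded_basis_def)
      from cfun.span_mono[OF this] show ?thesis by (simp only: level_basis(3))
    qed
    then show "harmonics_upto N \<subseteq> cfun.span (snd ` ?G)"
      unfolding harmonics_upto_def by (intro cfun.span_minimal cfun.subspace_span) auto
  qed
  from orthonormal_dim[OF on this] show ?thesis by (simp add: card_image[OF inj])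
qed

lemma dim_upto_ge:
  assumes d: "CARD('d) \<ge> 2"
  shows "cfun.dim (harmonics_upto N :: (complex ^ 'd \<Rightarrow> complex) set) \<ge> N + 1"
proof -
  have "cfun.dim (harmonics_upto N :: (complex ^ 'd \<Rightarrow> complex) set) = (\<Sum>l\<le>N. card (level_basis l :: (complex ^ 'd \<Rightarrow> complex) set))"
    unfolding card_graded_basis[OF d, symmetric] graded_basis_def
    by (subst card_SigmaI) (auto simp: level_basis)
  also have "\<dots> \<ge> (\<Sum>l\<le>N. 1)"
    unfolding card_level_basis by (intro sum_mono dim_level_pos)
  finally show ?thesis by simp
qed

definition graded_sum :: "nat \<Rightarrow> (nat \<times> (complex ^ 'd \<Rightarrow> complex) \<Rightarrow> complex) \<Rightarrow> complex ^ 'd \<Rightarrow> complex" where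
  "graded_sum N c = (\<lambda>z. \<Sum>i\<in>graded_basis N. c i * snd i z)"

lemma graded_sum_sphere_polys: "graded_sum N c \<in> sphere_polys"
  unfolding graded_sum_def by (intro subspace_sum_fun subspace_sphere_polys graded_basis_sphere_polys)

lemma sip_graded_sum:
  fixes c e :: "nat \<times> (complex ^ 'd \<Rightarrow> complex) \<Rightarrow> complex"
  assumes d: "CARD('d) \<ge> 2"
  shows "sip (graded_sum N c) (graded_sum N e) = (\<Sum>i\<in>graded_basis N. c i * cnj (e i))"
proof -
  have "sip (snd i) (graded_sum N e) = cnj (e i)" if "i \<in> graded_basis N" for i
  proof -
    have "sip (snd i) (graded_sum N e) = (\<Sum>k\<in>graded_basis N. cnj (e k) * sip (snd i) (snd k))"
      unfolding graded_sum_def by (rule sip_sum_right) (auto intro: graded_basis_sphere_polys that)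
    also have "\<dots> = (\<Sum>k\<in>graded_basis N. if i = k then cnj (e k) else 0)"
      by (intro sum.cong refl) (simp add: graded_basis_orthonormal[OF d that])
    also have "\<dots> = cnj (e i)" by (subst sum.delta'[OF finite_graded_basis]) (simp add: that)
    finally show ?thesis .
  qed
  moreover have "sip (graded_sum N c) (graded_sum N e) = (\<Sum>i\<in>graded_basis N. c i * sip (snd i) (graded_sum N e))"
    unfolding graded_sum_def[of N c] by (rule sip_sum) (auto intro: graded_basis_sphere_polys graded_sum_sphere_polys)
  ultimately show ?thesis by simp
qed

lemma graded_sum_polys_upto: 
  obtains p where "p \<in> polys_upto N" "graded_sum N c = sphere_restrict p"
proof -
  have "graded_sum N c \<in> sphere_restrict ` polys_upto N"
    unfolding graded_sum_def
  proof (intro subspace_sum_fun subspace_sphere_restrict subspace_polys_upto)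
    fix i assume "i \<in> graded_basis N"
    then have "snd i \<in> sphere_restrict ` level_polys (fst i)" "fst i \<le> N"
      using level_basis_level by (fastforce simp: graded_basis_def harmonics_level_eq)+
    moreover have "polys_upto (fst i) \<subseteq> polys_upto N" if "fst i \<le> N"
      unfolding polys_upto_def bimonomials_upto_def using that by (intro cfun.span_mono image_mono) auto
    ultimately show "snd i \<in> sphere_restrict ` polys_upto N"
      using level_polys_upto by blast
  qed
  then show ?thesis using that by blast
qed

text \<open>The zonal function of bidegree \<open>(m, n)\<close> lies in the level \<open>max m n\<close>, so a pairing with it sees only the
summands of this level, and these are multiplied by the same number.\<close>

lemma multiplier_image_graded_sum:
  fixes c :: "nat \<times> (complex ^ 'd \<Rightarrow> complex) \<Rightarrow> complex"
  assumes d: "CARD('d) \<ge> 2" and q: "q > 0"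
  shows "multiplier_image (\<lambda>m n. \<mu> (max m n)) q (graded_sum N c) (graded_sum N (\<lambda>i. \<mu> (fst i) * c i))"
  unfolding multiplier_image_def
proof (intro conjI allI ballI)
  show "graded_sum N (\<lambda>i. \<mu> (fst i) * c i) \<in> Lp_space q"
    by (rule sphere_polys_Lp[OF graded_sum_sphere_polys q])
  fix m n and w :: "complex ^ 'd" assume w: "w \<in> sphere 0 1"
  define Z where "Z = zonal m n w"
  have Z: "Z \<in> harmonics_level (max m n)"
    unfolding Z_def using zonal_in_harmonics[OF w] harmonics_subset_level by blast
  then have Zs: "Z \<in> sphere_polys" using harmonics_level_sphere_polys by blast
  have *: "\<mu> (fst i) * sip (snd i) Z = \<mu> (max m n) * sip (snd i) Z" if "i \<in> graded_basis N" for i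
  proof (cases "fst i = max m n")
    case False
    have "snd i \<in> harmonics_level (fst i)" using that level_basis_level by (auto simp: graded_basis_def)
    then have "sip (snd i) Z = 0" using harmonics_orthogonal_level[OF d _ Z False] by blast
    then show ?thesis by simp
  qed simp
  have "sip (graded_sum N (\<lambda>i. \<mu> (fst i) * c i)) Z = (\<Sum>i\<in>graded_basis N. \<mu> (fst i) * c i * sip (snd i) Z)"
    unfolding graded_sum_def by (rule sip_sum) (auto intro: graded_basis_sphere_polys Zs)
  also have "\<dots> = (\<Sum>i\<in>graded_basis N. \<mu> (max m n) * (c i * sip (snd i) Z))"
  proof (intro sum.cong refl)
    fix i assume "i \<in> (graded_basis N :: (nat \<times> (complex ^ 'd \<Rightarrow> complex)) set)"
    from *[OF this] show "\<mu> (fst i) * c i * sip (snd i) Z = \<mu> (max m n) * (c i * sip (snd i) Z)"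
      by (simp add: mult.assoc mult.left_commute[of _ "c i"])
  qed
  also have "\<dots> = \<mu> (max m n) * sip (graded_sum N c) Z"
    unfolding graded_sum_def sum_distrib_left[symmetric]
    by (subst sip_sum) (auto intro: graded_basis_sphere_polys Zs)
  finally show "conv_zonal (graded_sum N (\<lambda>i. \<mu> (fst i) * c i)) m n w
      = \<mu> (max m n) * conv_zonal (graded_sum N c) m n w"
    by (simp only: conv_zonal_eq_sip Z_def)
qed

section \<open>Coefficients with small dual norm under linear constraints\<close>

text \<open>The right-hand side exceeds the left-hand side by the square of the distance from \<open>x\<close> to its projection
\<open>u\<close> to the span of the conjugated vectors.\<close>

lemma bessel_coordinates:
  fixes v :: "nat \<Rightarrow> 'i \<Rightarrow> complex"
  assumes v: "\<And>r r'. r < m \<Longrightarrow> r' < m \<Longrightarrow> (\<Sum>i\<in>I. v r i * cnj (v r' i)) = (if r = r' then 1 else 0)"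
  shows "(\<Sum>r<m. (norm (\<Sum>i\<in>I. v r i * x i))\<^sup>2) \<le> (\<Sum>i\<in>I. (norm (x i))\<^sup>2)"
proof -
  define t where "t r = (\<Sum>i\<in>I. v r i * x i)" for r
  define u where "u i = (\<Sum>r<m. t r * cnj (v r i))" for i
  have xu: "(\<Sum>i\<in>I. x i * cnj (u i)) = (\<Sum>r<m. t r * cnj (t r))"
  proof -
    have "(\<Sum>i\<in>I. x i * cnj (u i)) = (\<Sum>i\<in>I. \<Sum>r<m. cnj (t r) * (v r i * x i))"
      by (simp add: u_def sum_distrib_left mult_ac)
    also have "\<dots> = (\<Sum>r<m. cnj (t r) * (\<Sum>i\<in>I. v r i * x i))"
      by (subst sum.swap) (simp add: sum_distrib_left)
    finally show ?thesis by (simp add: t_def mult.commute)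
  qed
  have ux: "(\<Sum>i\<in>I. u i * cnj (x i)) = (\<Sum>r<m. t r * cnj (t r))"
  proof -
    have "(\<Sum>i\<in>I. u i * cnj (x i)) = cnj (\<Sum>i\<in>I. x i * cnj (u i))" by (simp add: mult.commute)
    also have "\<dots> = (\<Sum>r<m. t r * cnj (t r))" unfolding xu by (simp add: mult.commute)
    finally show ?thesis .
  qed
  have uu: "(\<Sum>i\<in>I. u i * cnj (u i)) = (\<Sum>r<m. t r * cnj (t r))"
  proof -
    have "(\<Sum>i\<in>I. u i * cnj (u i)) = (\<Sum>i\<in>I. \<Sum>r'<m. cnj (t r') * (v r' i * u i))"
      by (simp add: u_def[of _, THEN arg_cong[where f = cnj]] sum_distrib_left mult_ac)
    also have "\<dots> = (\<Sum>r'<m. cnj (t r') * (\<Sum>i\<in>I. v r' i * u i))"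
      by (subst sum.swap) (simp add: sum_distrib_left)
    also have "\<dots> = (\<Sum>r'<m. cnj (t r') * t r')"
    proof (intro sum.cong refl)
      fix r' assume r': "r' \<in> {..<m}"
      have "(\<Sum>i\<in>I. v r' i * u i) = (\<Sum>i\<in>I. \<Sum>r<m. t r * (v r' i * cnj (v r i)))"
        by (simp add: u_def sum_distrib_left mult_ac)
      also have "\<dots> = (\<Sum>r<m. t r * (\<Sum>i\<in>I. v r' i * cnj (v r i)))"
        by (subst sum.swap) (simp add: sum_distrib_left)
      also have "\<dots> = (\<Sum>r<m. if r' = r then t r else 0)"
        using r' by (intro sum.cong refl) (simp add: v)
      also have "\<dots> = t r'" by (subst sum.delta') (use r' in simp_all)
      finally show "cnj (t r') * (\<Sum>i\<in>I. v r' i * u i) = cnj (t r') * t r'" by simp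
    qed
    finally show ?thesis by (simp add: mult.commute)
  qed
  have "complex_of_real (\<Sum>i\<in>I. (norm (x i - u i))\<^sup>2) = (\<Sum>i\<in>I. (x i - u i) * cnj (x i - u i))"
    unfolding of_real_sum complex_norm_square ..
  also have "\<dots> = (\<Sum>i\<in>I. x i * cnj (x i)) - (\<Sum>i\<in>I. x i * cnj (u i)) - (\<Sum>i\<in>I. u i * cnj (x i)) + (\<Sum>i\<in>I. u i * cnj (u i))"
    by (simp add: sum_subtractf sum.distrib algebra_simps)
  also have "\<dots> = (\<Sum>i\<in>I. x i * cnj (x i)) - (\<Sum>r<m. t r * cnj (t r))"
    unfolding xu ux uu by simp
  also have "\<dots> = complex_of_real ((\<Sum>i\<in>I. (norm (x i))\<^sup>2) - (\<Sum>r<m. (norm (t r))\<^sup>2))"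
    unfolding of_real_diff of_real_sum complex_norm_square ..
  finally have "(\<Sum>i\<in>I. (norm (x i - u i))\<^sup>2) = (\<Sum>i\<in>I. (norm (x i))\<^sup>2) - (\<Sum>r<m. (norm (t r))\<^sup>2)"
    unfolding of_real_eq_iff .
  moreover have "(\<Sum>i\<in>I. (norm (x i - u i))\<^sup>2) \<ge> 0" by (intro sum_nonneg) auto
  ultimately show ?thesis unfolding t_def by simp
qed

lemma sgn_of_square [simp]: "sgn_of A r * sgn_of A r = 1"
  by (simp add: sgn_of_def)

text \<open>With \<open>j \<ge> ln s\<close> the root of order \<open>2 j\<close> of a fixed power of \<open>j N + 1\<close> stays bounded.\<close>

lemma bidegree_count_le_exp:
  assumes j: "ln (real s) \<le> real j" and s: "N + 1 \<le> s"
  shows "real (j * N + 1) \<le> exp (2 * real j)"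
proof -
  have "real (j * N + 1) \<le> (real j + 1) * (real N + 1)" by (simp add: algebra_simps)
  also have "\<dots> \<le> exp (real j) * exp (real j)"
  proof (intro mult_mono)
    show "real j + 1 \<le> exp (real j)" using exp_ge_add_one_self[of "real j"] by linarith
    have "real N + 1 \<le> real s" using s by linarith
    also have "\<dots> = exp (ln (real s))" using s by simp
    also have "\<dots> \<le> exp (real j)" using j by simp
    finally show "real N + 1 \<le> exp (real j)" .
  qed auto
  finally show ?thesis by (simp add: exp_add[symmetric])
qed

lemma sup_le_of_moment:
  fixes y :: "complex ^ 'd \<Rightarrow> complex"
  assumes p: "p \<in> polys_upto N" "y = sphere_restrict p"
    and j: "j \<ge> 1" "ln (real s) \<le> real j" and s: "N + 1 \<le> s" and T: "T > 0"
    and yT: "(\<integral>z. norm (y z) ^ (2 * j) \<partial>surface_measure) \<le> T ^ (2 * j) * area TYPE('d)"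
    and w: "w \<in> sphere 0 1"
  shows "norm (y w) \<le> exp (2 * real CARD('d)) * T"
proof -
  let ?A = "area TYPE('d)" and ?d = "CARD('d)"
  have A: "?A > 0" by (rule area_pos)
  have yp: "y z = p z" if "z \<in> sphere 0 1" for z using that p(2) by simp
  have "norm (y w) ^ (2 * j) = norm (p w) ^ (2 * j)" by (simp only: yp[OF w])
  also have "\<dots> \<le> real (j * N + 1) ^ (2 * ?d) / ?A * (\<integral>z. norm (p z) ^ (2 * j) \<partial>surface_measure)"
    by (rule sup_le_moment[OF p(1) w])
  also have "(\<integral>z. norm (p z) ^ (2 * j) \<partial>surface_measure) = (\<integral>z. norm (y z) ^ (2 * j) \<partial>surface_measure)"
    by (rule Bochner_Integration.integral_cong) (simp_all add: yp)
  also have "real (j * N + 1) ^ (2 * ?d) / ?A * (\<integral>z. norm (y z) ^ (2 * j) \<partial>surface_measure)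
      \<le> real (j * N + 1) ^ (2 * ?d) / ?A * (T ^ (2 * j) * ?A)"
    using A by (intro mult_left_mono yT) auto
  also have "\<dots> = real (j * N + 1) ^ (2 * ?d) * T ^ (2 * j)" using A by simp
  also have "\<dots> \<le> exp (2 * real j) ^ (2 * ?d) * T ^ (2 * j)"
    using T by (intro mult_right_mono power_mono bidegree_count_le_exp[OF j(2) s]) auto
  also have "exp (2 * real j) ^ (2 * ?d) = exp (2 * real ?d) ^ (2 * j)"
    by (simp add: exp_of_nat_mult[symmetric] mult_ac)
  also have "\<dots> * T ^ (2 * j) = (exp (2 * real ?d) * T) ^ (2 * j)" by (simp add: power_mult_distrib)
  finally have "norm (y w) ^ (2 * j) \<le> (exp (2 * real ?d) * T) ^ (2 * j)" .
  moreover have "0 \<le> exp (2 * real ?d) * T" "0 < 2 * j" using T j(1) by simp_all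
  ultimately show ?thesis by (simp only: power_mono_iff norm_ge_zero)
qed

lemma vartheta_nonneg: "vartheta q s \<ge> 0"
  by (simp add: vartheta_def)

text \<open>The coefficients are \<open>c = \<Sum> \<plusminus>v\<^sub>r\<close> with an orthonormal family \<open>v\<^sub>r\<close> of solutions of the constraints. Signs do not
change the norm of \<open>c\<close>, and they are chosen such that the moment of the dual polynomial is small;
Bessel's inequality and the constant kernel diagonals of the levels bound the sum of squares that
governs this moment.\<close>

lemma good_coefficients:
  fixes C :: "(nat \<times> (complex ^ 'd \<Rightarrow> complex) \<Rightarrow> complex) set" and \<mu> :: "nat \<Rightarrow> real"
  assumes d: "CARD('d) \<ge> 2" and j: "j \<ge> 1" and \<mu>: "\<And>l. \<mu> l > 0" and C: "finite C"
    and m: "m + card C \<le> cfun.dim (harmonics_upto N :: (complex ^ 'd \<Rightarrow> complex) set)"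
  defines "\<tau> \<equiv> sqrt ((\<Sum>l\<le>N. real (cfun.dim (harmonics_level l :: (complex ^ 'd \<Rightarrow> complex) set)) / (\<mu> l)\<^sup>2) / area TYPE('d))"
  obtains c where "\<And>a. a \<in> C \<Longrightarrow> (\<Sum>i\<in>graded_basis N. a i * c i) = 0"
    "(\<Sum>i\<in>graded_basis N. c i * cnj (c i)) = of_nat m"
    "(\<integral>z. norm (graded_sum N (\<lambda>i. c i / of_real (\<mu> (fst i))) z) ^ (2 * j) \<partial>surface_measure)
       \<le> (sqrt (16 * exp 1 * real j) * \<tau>) ^ (2 * j) * area TYPE('d)" "\<tau> > 0"
proof -
  let ?I = "graded_basis N :: (nat \<times> (complex ^ 'd \<Rightarrow> complex)) set"
  let ?dl = "\<lambda>l. real (cfun.dim (harmonics_level l :: (complex ^ 'd \<Rightarrow> complex) set))"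
  have A: "area TYPE('d) > 0" by (rule area_pos)
  have "m + card C \<le> card ?I" using m by (simp add: card_graded_basis[OF d])
  from orthonormal_solutions[OF C finite_graded_basis this]
  obtain v where v0: "\<forall>r<m. \<forall>a\<in>C. (\<Sum>i\<in>?I. a i * v r i) = 0"
    "\<forall>r<m. \<forall>r'<m. (\<Sum>i\<in>?I. v r i * cnj (v r' i)) = (if r = r' then 1 else 0)"
    by (elim exE conjE)
  have v: "\<And>r a. r < m \<Longrightarrow> a \<in> C \<Longrightarrow> (\<Sum>i\<in>?I. a i * v r i) = 0"
    "\<And>r r'. r < m \<Longrightarrow> r' < m \<Longrightarrow> (\<Sum>i\<in>?I. v r i * cnj (v r' i)) = (if r = r' then 1 else 0)"
    by (simp only: v0(1)) (simp only: v0(2))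
  have S: "(\<Sum>l\<le>N. ?dl l / (\<mu> l)\<^sup>2) > 0"
  proof (rule sum_pos)
    fix l
    have "?dl l > 0" using dim_level_pos[of l, where 'd='d] by simp
    then show "?dl l / (\<mu> l)\<^sup>2 > 0" using \<mu>[of l] by simp
  qed auto
  have \<tau>: "\<tau> > 0" unfolding \<tau>_def using S A by simp
  have \<tau>2: "\<tau>\<^sup>2 = (\<Sum>l\<le>N. ?dl l / (\<mu> l)\<^sup>2) / area TYPE('d)" unfolding \<tau>_def using S A by simp
  define h where "h r = graded_sum N (\<lambda>i. v r i / of_real (\<mu> (fst i)))" for r
  have hs: "h r \<in> sphere_polys" for r unfolding h_def by (rule graded_sum_sphere_polys)
  have hb: "(\<Sum>r<m. (norm (h r z))\<^sup>2) \<le> \<tau>\<^sup>2" if z: "z \<in> sphere 0 1" for z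
  proof -
    have "h r z = (\<Sum>i\<in>?I. v r i * (snd i z / of_real (\<mu> (fst i))))" for r
      by (simp add: h_def graded_sum_def)
    then have "(\<Sum>r<m. (norm (h r z))\<^sup>2) \<le> (\<Sum>i\<in>?I. (norm (snd i z / of_real (\<mu> (fst i))))\<^sup>2)"
      using bessel_coordinates[of m v ?I "\<lambda>i. snd i z / of_real (\<mu> (fst i))", OF v(2)] by simp
    also have "\<dots> = (\<Sum>l\<le>N. \<Sum>b\<in>level_basis l. (norm (b z))\<^sup>2 / (\<mu> l)\<^sup>2)"
      using sum_graded_basis[of "\<lambda>l b. (norm (b z))\<^sup>2 / (\<mu> l)\<^sup>2" N]
      by (simp add: norm_divide power_divide)
    also have "\<dots> = (\<Sum>l\<le>N. (?dl l / area TYPE('d)) / (\<mu> l)\<^sup>2)"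
      by (simp add: sum_divide_distrib[symmetric] level_kernel[OF z])
    also have "\<dots> = \<tau>\<^sup>2" by (simp add: \<tau>2 sum_divide_distrib mult.commute)
    finally show ?thesis .
  qed
  obtain A where A: "A \<subseteq> {..<m}"
    "(\<integral>z. norm (\<Sum>r<m. of_real (sgn_of A r) * h r z) ^ (2 * j) \<partial>surface_measure)
       \<le> (sqrt (16 * exp 1 * real j) * \<tau>) ^ (2 * j) * area TYPE('d)"
    using good_signs_exist[of "{..<m}" h \<tau> j, OF _ hs hb \<tau> j] by auto
  define \<epsilon> where "\<epsilon> r = complex_of_real (sgn_of A r)" for r
  have \<epsilon>: "\<epsilon> r * \<epsilon> r = 1" "cnj (\<epsilon> r) = \<epsilon> r" for r
    by (simp_all add: \<epsilon>_def of_real_mult[symmetric] del: of_real_mult)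
  define c where "c i = (\<Sum>r<m. \<epsilon> r * v r i)" for i
  show ?thesis
  proof (rule that)
    fix a assume a: "a \<in> C"
    have "(\<Sum>i\<in>?I. a i * c i) = (\<Sum>i\<in>?I. \<Sum>r<m. \<epsilon> r * (a i * v r i))"
      by (simp add: c_def sum_distrib_left mult_ac)
    also have "\<dots> = (\<Sum>r<m. \<epsilon> r * (\<Sum>i\<in>?I. a i * v r i))"
      by (subst sum.swap) (simp add: sum_distrib_left)
    also have "\<dots> = 0" by (simp add: v(1) a)
    finally show "(\<Sum>i\<in>?I. a i * c i) = 0" .
  next
    have "(\<Sum>i\<in>?I. c i * cnj (c i)) = (\<Sum>i\<in>?I. \<Sum>r<m. \<Sum>r'<m. \<epsilon> r * \<epsilon> r' * (v r i * cnj (v r' i)))"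
      by (simp add: c_def sum_product \<epsilon> mult_ac)
    also have "\<dots> = (\<Sum>r<m. \<Sum>i\<in>?I. \<Sum>r'<m. \<epsilon> r * \<epsilon> r' * (v r i * cnj (v r' i)))"
      by (rule sum.swap)
    also have "\<dots> = (\<Sum>r<m. \<Sum>r'<m. \<Sum>i\<in>?I. \<epsilon> r * \<epsilon> r' * (v r i * cnj (v r' i)))"
      by (intro sum.cong refl sum.swap)
    also have "\<dots> = (\<Sum>r<m. \<Sum>r'<m. if r = r' then 1 else 0)"
      by (intro sum.cong refl) (auto simp: sum_distrib_left[symmetric] v(2) \<epsilon>)
    also have "\<dots> = of_nat m" by simp
    finally show "(\<Sum>i\<in>?I. c i * cnj (c i)) = of_nat m" .
  next
    have "graded_sum N (\<lambda>i. c i / of_real (\<mu> (fst i))) z = (\<Sum>r<m. of_real (sgn_of A r) * h r z)" for z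
    proof -
      have "graded_sum N (\<lambda>i. c i / of_real (\<mu> (fst i))) z
          = (\<Sum>i\<in>?I. \<Sum>r<m. \<epsilon> r * (v r i / of_real (\<mu> (fst i)) * snd i z))"
        by (simp add: graded_sum_def c_def sum_distrib_left sum_distrib_right sum_divide_distrib mult_ac)
      also have "\<dots> = (\<Sum>r<m. \<epsilon> r * h r z)"
        by (subst sum.swap) (simp add: h_def graded_sum_def sum_distrib_left)
      finally show ?thesis by (simp add: \<epsilon>_def)
    qed
    then show "(\<integral>z. norm (graded_sum N (\<lambda>i. c i / of_real (\<mu> (fst i))) z) ^ (2 * j) \<partial>surface_measure)
       \<le> (sqrt (16 * exp 1 * real j) * \<tau>) ^ (2 * j) * area TYPE('d)"
      using A(2) by simp
  qed (rule \<tau>)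
qed

text \<open>Take the least integer \<open>j\<close> not below \<open>q' / 2\<close>, or not below \<open>ln s\<close> if \<open>q = 1\<close>. In both cases \<open>\<surd>j\<close> is at most
a constant times \<open>1 / vartheta q s\<close>.\<close>

lemma moment_order_exists:
  assumes q: "1 \<le> q" "q \<le> 2" and s: "2 \<le> s"
  obtains j :: nat where "j \<ge> 1" "q > 1 \<Longrightarrow> q / (q - 1) \<le> real (2 * j)"
    "q = 1 \<Longrightarrow> ln (real s) \<le> real j" "sqrt (16 * exp 1 * real j) * vartheta q s \<le> sqrt (48 * exp 1)"
proof (cases "q > 1")
  case True
  define r where "r = q / (q - 1)"
  have r: "r \<ge> 2" "1 - 1 / q = 1 / r" using True q by (auto simp: r_def field_simps)
  define j where "j = nat \<lceil>r / 2\<rceil>"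
  have j: "r / 2 \<le> real j" "real j \<le> r / 2 + 1" 
  proof -
    have "real j = of_int \<lceil>r / 2\<rceil>" using r by (simp add: j_def)
    then show "r / 2 \<le> real j" "real j \<le> r / 2 + 1" using ceiling_correct[of "r / 2"] by linarith+
  qed
  have "(vartheta q s)\<^sup>2 = 1 / r" using True r by (simp add: vartheta_def powr_half_sqrt)
  moreover have "real j * (1 / r) \<le> 3" using j r by (simp add: field_simps)
  ultimately have "real j * (vartheta q s)\<^sup>2 \<le> 3" by simp
  then have "(sqrt (16 * exp 1 * real j) * vartheta q s)\<^sup>2 \<le> (sqrt (48 * exp 1))\<^sup>2"
    by (simp add: power_mult_distrib)
  then have "sqrt (16 * exp 1 * real j) * vartheta q s \<le> sqrt (48 * exp 1)"
    by (rule power2_le_imp_le) simp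
  with j r True show ?thesis by (intro that[of j]) (auto simp: r_def[symmetric])
next
  case False
  define L where "L = ln (real s)"
  have "ln 2 \<le> L" using s by (simp add: L_def)
  then have L: "L \<ge> 1 / 2" using ln2_ge_two_thirds by linarith
  define j where "j = nat \<lceil>L\<rceil>"
  have j: "L \<le> real j" "real j \<le> L + 1" 
  proof -
    have "real j = of_int \<lceil>L\<rceil>" using L by (simp add: j_def)
    then show "L \<le> real j" "real j \<le> L + 1" using ceiling_correct[of L] by linarith+
  qed
  have "(vartheta q s)\<^sup>2 = 1 / L"
  proof -
    have "L > 0" using L by linarith
    then show ?thesis
      using False by (simp add: vartheta_def L_def[symmetric] powr_minus powr_half_sqrt inverse_eq_divide power_divide)
  qed
  moreover have "real j * (1 / L) \<le> 3" using j L by (simp add: field_simps)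
  ultimately have "real j * (vartheta q s)\<^sup>2 \<le> 3" by simp
  then have "(sqrt (16 * exp 1 * real j) * vartheta q s)\<^sup>2 \<le> (sqrt (48 * exp 1))\<^sup>2"
    by (simp add: power_mult_distrib)
  then have "sqrt (16 * exp 1 * real j) * vartheta q s \<le> sqrt (48 * exp 1)"
    by (rule power2_le_imp_le) simp
  with j L False q show ?thesis by (intro that[of j]) (auto simp: L_def[symmetric])
qed

text \<open>The number \<open>\<kappa>\<close> collects the constants of both cases: the factor \<open>1 + 2 area\<close> from Young's inequality
(\<open>q > 1\<close>), the exponential from passing to the supremum (\<open>q = 1\<close>), the root from the random
signs and the area from the kernels of the levels.\<close>

lemma dual_bound:
  fixes C :: "(nat \<times> (complex ^ 'd \<Rightarrow> complex) \<Rightarrow> complex) set" and \<mu> :: "nat \<Rightarrow> real"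
  assumes d: "CARD('d) \<ge> 2" and q: "1 \<le> q" "q \<le> 2" and N: "1 \<le> N" and \<mu>: "\<And>l. \<mu> l > 0" and C: "finite C"
  defines "s \<equiv> cfun.dim (harmonics_upto N :: (complex ^ 'd \<Rightarrow> complex) set)"
    and "S \<equiv> (\<Sum>l\<le>N. real (cfun.dim (harmonics_level l :: (complex ^ 'd \<Rightarrow> complex) set)) / (\<mu> l)\<^sup>2)"
    and "\<kappa> \<equiv> (1 + 2 * area TYPE('d)) * exp (2 * real CARD('d)) * sqrt (48 * exp 1) / sqrt (area TYPE('d))"
  assumes m: "m + card C \<le> s"
  obtains c where "\<And>a. a \<in> C \<Longrightarrow> (\<Sum>i\<in>graded_basis N. a i * c i) = 0"
    "(\<Sum>i\<in>graded_basis N. c i * cnj (c i)) = of_nat m"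
    "\<And>F. F \<in> Lp_space q \<Longrightarrow>
      norm (\<integral>z. F z * cnj (graded_sum N (\<lambda>i. c i / of_real (\<mu> (fst i))) z) \<partial>surface_measure) * vartheta q s
        \<le> \<kappa> * sqrt S * Lp_norm q F"
proof -
  let ?A = "area TYPE('d)"
  have A: "?A > 0" by (rule area_pos)
  have s: "N + 1 \<le> s" unfolding s_def by (rule dim_upto_ge[OF d])
  with N have "2 \<le> s" by simp
  then obtain j :: nat where j: "j \<ge> 1" "q > 1 \<Longrightarrow> q / (q - 1) \<le> real (2 * j)"
    "q = 1 \<Longrightarrow> ln (real s) \<le> real j" "sqrt (16 * exp 1 * real j) * vartheta q s \<le> sqrt (48 * exp 1)"
    using moment_order_exists[OF q] by blast
  obtain c where c: "\<And>a. a \<in> C \<Longrightarrow> (\<Sum>i\<in>graded_basis N. a i * c i) = 0"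
    "(\<Sum>i\<in>graded_basis N. c i * cnj (c i)) = of_nat m"
    "(\<integral>z. norm (graded_sum N (\<lambda>i. c i / of_real (\<mu> (fst i))) z) ^ (2 * j) \<partial>surface_measure)
       \<le> (sqrt (16 * exp 1 * real j) * sqrt (S / ?A)) ^ (2 * j) * ?A" "sqrt (S / ?A) > 0"
    by (rule good_coefficients[where \<mu> = \<mu>, OF d j(1) \<mu> C m[unfolded s_def], folded S_def]) (rule that, assumption+)
  define T where "T = sqrt (16 * exp 1 * real j) * sqrt (S / ?A)"
  define y where "y = graded_sum N (\<lambda>i. c i / of_real (\<mu> (fst i)))"
  have T: "T > 0" unfolding T_def using c(4) j(1) by (intro mult_pos_pos) auto
  have ys: "y \<in> sphere_polys" unfolding y_def by (rule graded_sum_sphere_polys)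
  have yT: "(\<integral>z. norm (y z) ^ (2 * j) \<partial>surface_measure) \<le> T ^ (2 * j) * ?A"
    using c(3) by (simp only: y_def T_def)
  have e1: "1 \<le> exp (2 * real CARD('d))" by simp
  have main: "norm (\<integral>z. F z * cnj (y z) \<partial>surface_measure)
      \<le> (1 + 2 * ?A) * exp (2 * real CARD('d)) * T * Lp_norm q F" if F: "F \<in> Lp_space q" for F
  proof (cases "q > 1")
    case True
    have "norm (\<integral>z. F z * cnj (y z) \<partial>surface_measure) \<le> (1 + 2 * ?A) * T * Lp_norm q F"
      by (rule pairing_le_Lp[OF True F ys T yT j(2)[OF True]])
    also have "\<dots> \<le> exp (2 * real CARD('d)) * ((1 + 2 * ?A) * T * Lp_norm q F)"
      using mult_right_mono[OF e1, of "(1 + 2 * ?A) * T * Lp_norm q F"] A T Lp_norm_nonneg[of q F] by simp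
    finally show ?thesis by (simp only: mult_ac)
  next
    case False
    then have q1: "q = 1" using q by simp
    obtain p where p: "p \<in> polys_upto N" "y = sphere_restrict p"
      using graded_sum_polys_upto[of N "\<lambda>i. c i / of_real (\<mu> (fst i))"] unfolding y_def by blast
    have "norm (y z) \<le> exp (2 * real CARD('d)) * T" if "z \<in> sphere 0 1" for z
      by (rule sup_le_of_moment[OF p j(1) j(3)[OF q1] s T yT that])
    from pairing_le_L1[OF F[unfolded q1] ys this]
    have "norm (\<integral>z. F z * cnj (y z) \<partial>surface_measure) \<le> exp (2 * real CARD('d)) * T * Lp_norm q F"
      by (simp only: q1)
    also have "\<dots> \<le> (1 + 2 * ?A) * (exp (2 * real CARD('d)) * T * Lp_norm q F)"
      using mult_right_mono[of 1 "1 + 2 * ?A" "exp (2 * real CARD('d)) * T * Lp_norm q F"] A T Lp_norm_nonneg[of q F]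
      by simp
    finally show ?thesis by (simp only: mult_ac)
  qed
  show ?thesis
  proof (rule that[OF c(1,2)])
    fix F :: "complex ^ 'd \<Rightarrow> complex" assume F: "F \<in> Lp_space q"
    let ?E = "(1 + 2 * ?A) * exp (2 * real CARD('d)) * Lp_norm q F * sqrt (S / ?A)"
    have E: "?E \<ge> 0" using A Lp_norm_nonneg[of q F] c(4) by simp
    have "norm (\<integral>z. F z * cnj (y z) \<partial>surface_measure) * vartheta q s
        \<le> ((1 + 2 * ?A) * exp (2 * real CARD('d)) * T * Lp_norm q F) * vartheta q s"
      by (rule mult_right_mono[OF main[OF F] vartheta_nonneg])
    also have "\<dots> = ?E * (sqrt (16 * exp 1 * real j) * vartheta q s)"
      unfolding T_def by (simp only: mult_ac)
    also have "\<dots> \<le> ?E * sqrt (48 * exp 1)" by (rule mult_left_mono[OF j(4) E])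
    also have "\<dots> = \<kappa> * sqrt S * Lp_norm q F"
      by (simp add: \<kappa>_def real_sqrt_divide)
    finally show "norm (\<integral>z. F z * cnj (graded_sum N (\<lambda>i. c i / of_real (\<mu> (fst i))) z) \<partial>surface_measure) * vartheta q s
        \<le> \<kappa> * sqrt S * Lp_norm q F" unfolding y_def .
  qed
qed

section \<open>Lower bounds for the widths\<close>

lemma span_finite_coeffs:
  assumes B: "finite B" and f: "f \<in> cfun.span B"
  shows "\<exists>u. f = (\<lambda>z. \<Sum>b\<in>B. u b * b z)"
  using f
proof (induction rule: span_cfun_induct)
  case zero
  show ?case by (intro exI[of _ "\<lambda>_. 0"]) simp
next
  case (step c g h)
  then obtain u where u: "h = (\<lambda>z. \<Sum>b\<in>B. u b * b z)" by blast
  have "(\<Sum>b\<in>B. (if b = g then c else 0) * b z) = c * g z" for z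
    using step.hyps B by (simp add: if_distrib[of "\<lambda>x. x * _"] cong: if_cong)
  then have "(\<lambda>z. c * g z + h z) = (\<lambda>z. \<Sum>b\<in>B. ((if b = g then c else 0) + u b) * b z)"
    by (simp add: u distrib_right sum.distrib)
  then show ?case by (rule exI[of _ "\<lambda>b. (if b = g then c else 0) + u b"])
qed

lemma Lp_pairing_integrable:
  assumes f: "f \<in> Lp_space q" and q: "q \<ge> 1" and y: "y \<in> sphere_polys"
  shows "integrable surface_measure (\<lambda>z. f z * cnj (y z))"
proof -
  have c: "continuous_on (sphere 0 1) y" by (rule sphere_polys_continuous[OF y])
  then have "compact (y ` sphere 0 1)" by (intro compact_continuous_image) auto
  then obtain K where K: "\<And>z. z \<in> sphere 0 1 \<Longrightarrow> norm (y z) \<le> K"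
    by (metis (no_types, lifting) bounded_iff compact_imp_bounded imageI)
  show ?thesis
  proof (rule Bochner_Integration.integrable_bound)
    show "integrable surface_measure (\<lambda>z. (1 + norm (f z) powr q) * K)"
      using f by (auto simp: Lp_space_def)
    show "(\<lambda>z. f z * cnj (y z)) \<in> borel_measurable surface_measure"
      using f surface_measurable_continuous[OF continuous_on_cnj[OF c]]
      by (auto simp: Lp_space_def intro!: borel_measurable_times)
    show "AE z in surface_measure. norm (f z * cnj (y z)) \<le> norm ((1 + norm (f z) powr q) * K)"
    proof (rule AE_I2)
      fix z :: "complex ^ 'a" assume "z \<in> space surface_measure"
      then have z: "z \<in> sphere 0 1" by simp
      have K0: "0 \<le> K" using K[OF z] norm_ge_zero[of "y z"] by linarith
      have "norm (f z) \<le> 1 + norm (f z) powr q"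
      proof (cases "norm (f z) \<le> 1")
        case True
        then show ?thesis by (simp add: add_increasing2)
      next
        case False
        then have "norm (f z) powr 1 \<le> norm (f z) powr q" using q by (intro powr_mono) auto
        then show ?thesis using False by simp
      qed
      then have "norm (f z) * norm (y z) \<le> (1 + norm (f z) powr q) * K"
        using K[OF z] by (intro mult_mono) auto
      then show "norm (f z * cnj (y z)) \<le> norm ((1 + norm (f z) powr q) * K)"
        using K0 by (simp add: norm_mult abs_mult)
    qed
  qed
qed

lemma vartheta_pos: "1 \<le> q \<Longrightarrow> 2 \<le> s \<Longrightarrow> vartheta q s > 0"
  by (simp add: vartheta_def)

lemma graded_sum_cmult: "graded_sum N (\<lambda>i. t * c i) = (\<lambda>z. t * graded_sum N c z)"
  by (simp add: graded_sum_def sum_distrib_left mult.assoc)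

text \<open>The scaling \<open>t\<close> brings the preimage of \<open>x\<close> into the unit ball of \<open>L\<^sup>p\<close>. A function \<open>F\<close> whose pairing with \<open>y\<close>
equals that of \<open>x\<close> may be \<open>x\<close> itself (Gelfand width) or \<open>x\<close> minus an element of a subspace that \<open>y\<close>
annihilates (Kolmogorov width). The statement on functions of norm zero is used for the null part of
such a subspace.\<close>

lemma test_element:
  fixes C :: "(nat \<times> (complex ^ 'd \<Rightarrow> complex) \<Rightarrow> complex) set" and \<mu> :: "nat \<Rightarrow> real"
  assumes d: "CARD('d) \<ge> 2" and q: "1 \<le> q" "q \<le> p" "p \<le> 2" and N: "1 \<le> N" and \<mu>: "\<And>l. \<mu> l > 0" and C: "finite C"
  defines "s \<equiv> cfun.dim (harmonics_upto N :: (complex ^ 'd \<Rightarrow> complex) set)"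
    and "S \<equiv> (\<Sum>l\<le>N. real (cfun.dim (harmonics_level l :: (complex ^ 'd \<Rightarrow> complex) set)) / (\<mu> l)\<^sup>2)"
    and "\<kappa> \<equiv> (1 + 2 * area TYPE('d)) * exp (2 * real CARD('d)) * sqrt (48 * exp 1) / sqrt (area TYPE('d))"
  assumes m: "m + card C \<le> s" "m \<ge> 1"
  obtains c where "\<And>a. a \<in> C \<Longrightarrow> (\<Sum>i\<in>graded_basis N. a i * c i) = 0"
    "graded_sum N (\<lambda>i. of_real (\<mu> (fst i)) * c i) \<in> multiplier_ball (\<lambda>m n. of_real (\<mu> (max m n))) p q"
    "\<And>F. F \<in> Lp_space q \<Longrightarrow> Lp_norm q F = 0 \<Longrightarrow>
       (\<integral>z. F z * cnj (graded_sum N (\<lambda>i. c i / of_real (\<mu> (fst i))) z) \<partial>surface_measure) = 0"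
    "\<And>F. F \<in> Lp_space q \<Longrightarrow>
       (\<integral>z. F z * cnj (graded_sum N (\<lambda>i. c i / of_real (\<mu> (fst i))) z) \<partial>surface_measure)
         = sip (graded_sum N (\<lambda>i. of_real (\<mu> (fst i)) * c i)) (graded_sum N (\<lambda>i. c i / of_real (\<mu> (fst i)))) \<Longrightarrow>
       sqrt (real m) * vartheta q s \<le> (1 + area TYPE('d)) * \<kappa> * sqrt S * Lp_norm q F"
proof -
  let ?A = "area TYPE('d)"
  have A: "?A > 0" by (rule area_pos)
  have "N + 1 \<le> s" unfolding s_def by (rule dim_upto_ge[OF d])
  then have s2: "2 \<le> s" using N by simp
  have q2: "q \<le> 2" using q by simp
  obtain c0 where c0: "\<And>a. a \<in> C \<Longrightarrow> (\<Sum>i\<in>graded_basis N. a i * c0 i) = 0"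
    "(\<Sum>i\<in>graded_basis N. c0 i * cnj (c0 i)) = of_nat m"
    "\<And>F. F \<in> Lp_space q \<Longrightarrow>
      norm (\<integral>z. F z * cnj (graded_sum N (\<lambda>i. c0 i / of_real (\<mu> (fst i))) z) \<partial>surface_measure) * vartheta q s
        \<le> \<kappa> * sqrt S * Lp_norm q F"
    by (rule dual_bound[where \<mu> = \<mu>, OF d q(1) q2 N \<mu> C m(1)[unfolded s_def], folded s_def S_def \<kappa>_def])
       (rule that, assumption+)
  define t where "t = 1 / (1 + ?A) * (1 / sqrt (real m))"
  have t: "t > 0" unfolding t_def using A m by (intro mult_pos_pos) auto
  define c where "c i = of_real t * c0 i" for i
  define y0 where "y0 = graded_sum N (\<lambda>i. c0 i / of_real (\<mu> (fst i)))"
  define y where "y = graded_sum N (\<lambda>i. c i / of_real (\<mu> (fst i)))"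
  define x where "x = graded_sum N (\<lambda>i. of_real (\<mu> (fst i)) * c i)"
  have y_eq: "y = (\<lambda>z. of_real t * y0 z)"
    unfolding y_def y0_def c_def graded_sum_cmult[symmetric] by simp
  have pair: "(\<integral>z. F z * cnj (y z) \<partial>surface_measure) = of_real t * (\<integral>z. F z * cnj (y0 z) \<partial>surface_measure)" for F
  proof -
    have "(\<lambda>z. F z * cnj (y z)) = (\<lambda>z. of_real t * (F z * cnj (y0 z)))"
      by (simp add: y_eq fun_eq_iff)
    then show ?thesis by simp
  qed
  show ?thesis
  proof (rule that[of c, folded x_def y_def])
    fix a assume a: "a \<in> C"
    have "(\<Sum>i\<in>graded_basis N. a i * c i) = of_real t * (\<Sum>i\<in>graded_basis N. a i * c0 i)"
      by (simp add: c_def sum_distrib_left mult_ac)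
    then show "(\<Sum>i\<in>graded_basis N. a i * c i) = 0" by (simp add: c0(1)[OF a])
  next
    define \<phi>0 where "\<phi>0 = graded_sum N (\<lambda>i. of_real (1 / sqrt (real m)) * c0 i)"
    have \<phi>0s: "\<phi>0 \<in> sphere_polys" unfolding \<phi>0_def by (rule graded_sum_sphere_polys)
    have "sip \<phi>0 \<phi>0 = (\<Sum>i\<in>graded_basis N. of_real (1 / sqrt (real m)) * c0 i * cnj (of_real (1 / sqrt (real m)) * c0 i))"
      unfolding \<phi>0_def by (rule sip_graded_sum[OF d])
    also have "\<dots> = of_real ((1 / sqrt (real m)) * (1 / sqrt (real m))) * (\<Sum>i\<in>graded_basis N. c0 i * cnj (c0 i))"
      by (simp only: sum_distrib_left complex_cnj_mult complex_cnj_complex_of_real of_real_mult mult_ac)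
    also have "\<dots> = of_real ((1 / sqrt (real m)) * (1 / sqrt (real m)) * real m)"
      by (simp only: c0(2) of_real_mult of_real_of_nat_eq)
    also have "(1 / sqrt (real m)) * (1 / sqrt (real m)) * real m = 1" using m(2) by simp
    finally have "(\<integral>z. (norm (\<phi>0 z))\<^sup>2 \<partial>surface_measure) = 1"
      unfolding sip_self of_real_eq_iff .
    then have "Lp_norm p \<phi>0 \<le> 1 + ?A" using q by (intro Lp_norm_le_of_L2 \<phi>0s) auto
    moreover have \<phi>: "graded_sum N c = (\<lambda>z. of_real (1 / (1 + ?A)) * \<phi>0 z)"
      unfolding \<phi>0_def graded_sum_cmult[symmetric] c_def[abs_def] t_def by (simp only: of_real_mult mult.assoc)
    moreover have "Lp_norm p (graded_sum N c) = 1 / (1 + ?A) * Lp_norm p \<phi>0"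
      unfolding \<phi> using A q by (intro Lp_norm_cmult) auto
    ultimately have "Lp_norm p (graded_sum N c) \<le> 1" using A by (simp add: pos_divide_le_eq)
    moreover have "graded_sum N c \<in> Lp_space p"
      using q by (intro sphere_polys_Lp graded_sum_sphere_polys) auto
    moreover have "multiplier_image (\<lambda>m n. of_real (\<mu> (max m n))) q (graded_sum N c) x"
      unfolding x_def using q multiplier_image_graded_sum[OF d, of q "\<lambda>l. of_real (\<mu> l)" N c] by simp
    ultimately show "x \<in> multiplier_ball (\<lambda>m n. of_real (\<mu> (max m n))) p q"
      by (auto simp: multiplier_ball_def Lp_ball_def)
  next
    fix F :: "complex ^ 'd \<Rightarrow> complex" assume F: "F \<in> Lp_space q" "Lp_norm q F = 0"
    from c0(3)[OF F(1)] F(2) have "norm (\<integral>z. F z * cnj (y0 z) \<partial>surface_measure) * vartheta q s \<le> 0"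
      by (simp add: y0_def)
    with vartheta_pos[OF q(1) s2] have "(\<integral>z. F z * cnj (y0 z) \<partial>surface_measure) = 0"
      by (simp add: mult_le_0_iff)
    then show "(\<integral>z. F z * cnj (y z) \<partial>surface_measure) = 0" by (simp add: pair)
  next
    fix F :: "complex ^ 'd \<Rightarrow> complex"
    assume F: "F \<in> Lp_space q" and eq: "(\<integral>z. F z * cnj (y z) \<partial>surface_measure) = sip x y"
    have "sip x y = (\<Sum>i\<in>graded_basis N. of_real (\<mu> (fst i)) * c i * cnj (c i / of_real (\<mu> (fst i))))"
      unfolding x_def y_def by (rule sip_graded_sum[OF d])
    also have "\<dots> = (\<Sum>i\<in>graded_basis N. of_real (t * t) * (c0 i * cnj (c0 i)))"
      using \<mu> by (intro sum.cong refl) (simp add: c_def less_imp_neq[OF \<mu>, symmetric])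
    also have "\<dots> = of_real t * of_real (t * real m)"
      by (simp add: sum_distrib_left[symmetric] c0(2))
    finally have "of_real t * (\<integral>z. F z * cnj (y0 z) \<partial>surface_measure) = of_real t * complex_of_real (t * real m)"
      using eq by (simp only: pair)
    then have "(\<integral>z. F z * cnj (y0 z) \<partial>surface_measure) = complex_of_real (t * real m)" using t by simp
    then have n: "norm (\<integral>z. F z * cnj (y0 z) \<partial>surface_measure) = t * real m" using t by (simp only: norm_of_real) simp
    have tm: "t * real m * (1 + ?A) = sqrt (real m)"
    proof -
      have "sqrt (real m) * sqrt (real m) = real m" by simp
      then have "real m / sqrt (real m) = sqrt (real m)" using m(2) by (simp add: real_div_sqrt)
      moreover have "t * real m * (1 + ?A) = real m / sqrt (real m)" using A by (simp add: t_def)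
      ultimately show ?thesis by simp
    qed
    have "t * real m * vartheta q s \<le> \<kappa> * sqrt S * Lp_norm q F"
      using c0(3)[OF F] n by (simp only: y0_def)
    then have "(1 + ?A) * (t * real m * vartheta q s) \<le> (1 + ?A) * (\<kappa> * sqrt S * Lp_norm q F)"
      using A by (intro mult_left_mono) auto
    moreover have "(1 + ?A) * (t * real m * vartheta q s) = sqrt (real m) * vartheta q s"
      unfolding tm[symmetric] by (simp only: mult_ac)
    ultimately show "sqrt (real m) * vartheta q s \<le> (1 + ?A) * \<kappa> * sqrt S * Lp_norm q F"
      by (simp only: mult.assoc)
  qed
qed

lemma gelfand_width_ge:
  fixes A X :: "(complex ^ 'd \<Rightarrow> complex) set"
  assumes "\<And>L. cfun.subspace L \<Longrightarrow> has_quotient_dim X L k \<Longrightarrow> \<exists>x\<in>A \<inter> L. R \<le> N x"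
  shows "ennreal R \<le> gelfand_width k A X N"
  unfolding gelfand_width_def
proof (rule INF_greatest)
  fix L assume "L \<in> {L. null_part X N \<subseteq> L \<and> has_quotient_dim X L k}"
  then obtain x where "x \<in> A \<inter> L" "R \<le> N x"
    using assms[of L] by (auto simp: has_quotient_dim_def)
  then show "ennreal R \<le> (SUP x\<in>A \<inter> L. ennreal (N x))"
    by (intro SUP_upper2[of x]) (auto intro: ennreal_leI)
qed

lemma kolmogorov_width_ge:
  fixes A X :: "(complex ^ 'd \<Rightarrow> complex) set"
  assumes "\<And>V. V \<subseteq> X \<Longrightarrow> has_quotient_dim V (null_part X N) k \<Longrightarrow> \<exists>x\<in>A. \<forall>y\<in>V. R \<le> N (x - y)"
  shows "ennreal R \<le> kolmogorov_width k A X N"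
  unfolding kolmogorov_width_def
proof (rule INF_greatest)
  fix V assume "V \<in> {V. V \<subseteq> X \<and> has_quotient_dim V (null_part X N) k}"
  then obtain x where "x \<in> A" "\<forall>y\<in>V. R \<le> N (x - y)" using assms[of V] by auto
  then show "ennreal R \<le> (SUP x\<in>A. INF y\<in>V. ennreal (N (x - y)))"
    by (intro SUP_upper2[of x] INF_greatest) (auto intro: ennreal_leI)
qed

text \<open>Both cases encode their subspace in \<open>k\<close> constraints on the coefficients. If \<open>L\<close> has codimension \<open>k\<close>, each
basis function is a combination of \<open>k\<close> fixed functions plus an element of \<open>L\<close>, and the \<open>k\<close> coefficients of
\<open>x\<close> must vanish. If \<open>V\<close> is spanned, modulo the null part, by \<open>k\<close> functions, then \<open>y\<close> must be orthogonal to
these.\<close>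

lemma widths_multiplier_ball_ge:
  fixes \<mu> :: "nat \<Rightarrow> real" and N k :: nat
  assumes d: "CARD('d::finite) \<ge> 2" and q: "1 \<le> q" "q \<le> p" "p \<le> 2" and N: "1 \<le> N" and \<mu>: "\<And>l. \<mu> l > 0"
  defines "s \<equiv> cfun.dim (harmonics_upto N :: (complex ^ 'd \<Rightarrow> complex) set)"
    and "S \<equiv> (\<Sum>l\<le>N. real (cfun.dim (harmonics_level l :: (complex ^ 'd \<Rightarrow> complex) set)) / (\<mu> l)\<^sup>2)"
    and "\<kappa> \<equiv> (1 + 2 * area TYPE('d)) * exp (2 * real CARD('d)) * sqrt (48 * exp 1) / sqrt (area TYPE('d))"
    and "A \<equiv> multiplier_ball (\<lambda>m n. of_real (\<mu> (max m n))) p q :: (complex ^ 'd \<Rightarrow> complex) set"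
  assumes k: "k < s" and R: "(1 + area TYPE('d)) * \<kappa> * sqrt S * R \<le> sqrt (real (s - k)) * vartheta q s"
    and pos: "(1 + area TYPE('d)) * \<kappa> * sqrt S > 0"
  shows "ennreal R \<le> gelfand_width k A (Lp_space q) (Lp_norm q)"
    and "ennreal R \<le> kolmogorov_width k A (Lp_space q) (Lp_norm q)"
proof -
  let ?I = "graded_basis N :: (nat \<times> (complex ^ 'd \<Rightarrow> complex)) set"
  let ?x = "\<lambda>c. graded_sum N (\<lambda>i. of_real (\<mu> (fst i)) * c i) :: complex ^ 'd \<Rightarrow> complex"
  let ?y = "\<lambda>c. graded_sum N (\<lambda>i. c i / of_real (\<mu> (fst i))) :: complex ^ 'd \<Rightarrow> complex"
  have m: "s - k \<ge> 1" using k by simp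
  have R_le: "R \<le> M" if "sqrt (real (s - k)) * vartheta q s \<le> (1 + area TYPE('d)) * \<kappa> * sqrt S * M" for M
    using order_trans[OF R that] pos by (simp only: mult_le_cancel_left_pos)
  have q0: "q > 0" "q \<ge> 0" using q by auto
  have ys: "?y c \<in> sphere_polys" for c by (rule graded_sum_sphere_polys)
  have xL: "?x c \<in> Lp_space q" for c by (rule sphere_polys_Lp[OF graded_sum_sphere_polys q0(1)])
  show "ennreal R \<le> gelfand_width k A (Lp_space q) (Lp_norm q)"
  proof (rule gelfand_width_ge)
    fix L :: "(complex ^ 'd \<Rightarrow> complex) set"
    assume L: "cfun.subspace L" and "has_quotient_dim (Lp_space q) L k"
    then obtain B where B: "finite B" "card B = k" "Lp_space q = {b + w | b w. b \<in> cfun.span B \<and> w \<in> L}"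
      unfolding has_quotient_dim_def by blast
    have "\<forall>i\<in>?I. \<exists>t. snd t \<in> L \<and> snd i = (\<lambda>z. (\<Sum>b\<in>B. fst t b * b z) + snd t z)"
    proof
      fix i assume i: "i \<in> ?I"
      have "snd i \<in> Lp_space q" by (rule sphere_polys_Lp[OF graded_basis_sphere_polys[OF i] q0(1)])
      then obtain b w where b: "snd i = b + w" "b \<in> cfun.span B" "w \<in> L" using B(3) by blast
      obtain u where "b = (\<lambda>z. \<Sum>b\<in>B. u b * b z)" using span_finite_coeffs[OF B(1) b(2)] by blast
      then show "\<exists>t. snd t \<in> L \<and> snd i = (\<lambda>z. (\<Sum>b\<in>B. fst t b * b z) + snd t z)"
        using b by (intro exI[of _ "(u, w)"]) (simp add: plus_fun_def)
    qed
    from bchoice[OF this] obtain t where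
      t: "\<forall>i\<in>?I. snd (t i) \<in> L \<and> snd i = (\<lambda>z. (\<Sum>b\<in>B. fst (t i) b * b z) + snd (t i) z)"
      by (elim exE)
    define u w where "u i = fst (t i)" and "w i = snd (t i)" for i
    have uw: "\<And>i. i \<in> ?I \<Longrightarrow> w i \<in> L"
      "\<And>i. i \<in> ?I \<Longrightarrow> snd i = (\<lambda>z. (\<Sum>b\<in>B. u i b * b z) + w i z)"
      using t unfolding u_def w_def by blast+
    define C where "C = (\<lambda>b i. of_real (\<mu> (fst i)) * u i b) ` B"
    have fC: "finite C" unfolding C_def using B by simp
    have "card C \<le> k" unfolding C_def B(2)[symmetric] by (rule card_image_le[OF B(1)])
    then have cC: "(s - k) + card C \<le> s" using k by linarith
    obtain c where c: "\<And>a. a \<in> C \<Longrightarrow> (\<Sum>i\<in>?I. a i * c i) = 0" "?x c \<in> A"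
      "\<And>F. F \<in> Lp_space q \<Longrightarrow> (\<integral>z. F z * cnj (?y c z) \<partial>surface_measure) = sip (?x c) (?y c) \<Longrightarrow>
       sqrt (real (s - k)) * vartheta q s \<le> (1 + area TYPE('d)) * \<kappa> * sqrt S * Lp_norm q F"
      by (rule test_element[where \<mu> = \<mu>, OF d q N \<mu> fC cC[unfolded s_def] m[unfolded s_def], folded s_def S_def \<kappa>_def A_def])
         (rule that, assumption+)
    have "?x c z = (\<Sum>i\<in>?I. (of_real (\<mu> (fst i)) * c i) * w i z)" for z
    proof -
      have "?x c z = (\<Sum>i\<in>?I. of_real (\<mu> (fst i)) * c i * ((\<Sum>b\<in>B. u i b * b z) + w i z))"
        unfolding graded_sum_def by (intro sum.cong refl arg_cong2[of _ _ _ _ "(*)"] fun_cong[OF uw(2)])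
      also have "\<dots> = (\<Sum>i\<in>?I. \<Sum>b\<in>B. b z * (of_real (\<mu> (fst i)) * u i b * c i))
          + (\<Sum>i\<in>?I. (of_real (\<mu> (fst i)) * c i) * w i z)"
        by (simp add: distrib_left sum.distrib sum_distrib_left mult_ac)
      also have "(\<Sum>i\<in>?I. \<Sum>b\<in>B. b z * (of_real (\<mu> (fst i)) * u i b * c i))
          = (\<Sum>b\<in>B. b z * (\<Sum>i\<in>?I. of_real (\<mu> (fst i)) * u i b * c i))"
        by (subst sum.swap) (simp add: sum_distrib_left)
      also have "\<dots> = 0"
        by (intro sum.neutral ballI) (use c(1) in \<open>auto simp: C_def\<close>)
      finally show ?thesis by simp
    qed
    then have "?x c = (\<lambda>z. \<Sum>i\<in>?I. (of_real (\<mu> (fst i)) * c i) * w i z)" by (rule ext)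
    also have "\<dots> \<in> L" by (intro subspace_sum_fun L uw(1))
    finally have "?x c \<in> A \<inter> L" using c(2) by blast
    moreover have "R \<le> Lp_norm q (?x c)"
      by (intro R_le c(3) xL) (simp add: sip_def)
    ultimately show "\<exists>x\<in>A \<inter> L. R \<le> Lp_norm q x" by blast
  qed
  show "ennreal R \<le> kolmogorov_width k A (Lp_space q) (Lp_norm q)"
  proof (rule kolmogorov_width_ge)
    fix V :: "(complex ^ 'd \<Rightarrow> complex) set"
    let ?W = "null_part (Lp_space q) (Lp_norm q) :: (complex ^ 'd \<Rightarrow> complex) set"
    assume VX: "V \<subseteq> Lp_space q" and V: "has_quotient_dim V ?W k"
    then obtain B where B: "finite B" "card B = k" "V = {b + w | b w. b \<in> cfun.span B \<and> w \<in> ?W}"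
      and W: "cfun.subspace ?W" unfolding has_quotient_dim_def by blast
    have BL: "b \<in> Lp_space q" if "b \<in> cfun.span B" for b
    proof -
      have "b + 0 \<in> V" unfolding B(3) using that cfun.subspace_0[OF W] by blast
      then show ?thesis using VX by auto
    qed
    define C where "C = (\<lambda>b i. cnj (\<integral>z. b z * cnj (snd i z) \<partial>surface_measure) / of_real (\<mu> (fst i))) ` B"
    have fC: "finite C" unfolding C_def using B by simp
    have "card C \<le> k" unfolding C_def B(2)[symmetric] by (rule card_image_le[OF B(1)])
    then have cC: "(s - k) + card C \<le> s" using k by linarith
    obtain c where c: "\<And>a. a \<in> C \<Longrightarrow> (\<Sum>i\<in>?I. a i * c i) = 0" "?x c \<in> A"
      "\<And>F. F \<in> Lp_space q \<Longrightarrow> Lp_norm q F = 0 \<Longrightarrow> (\<integral>z. F z * cnj (?y c z) \<partial>surface_measure) = 0"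
      "\<And>F. F \<in> Lp_space q \<Longrightarrow> (\<integral>z. F z * cnj (?y c z) \<partial>surface_measure) = sip (?x c) (?y c) \<Longrightarrow>
       sqrt (real (s - k)) * vartheta q s \<le> (1 + area TYPE('d)) * \<kappa> * sqrt S * Lp_norm q F"
      by (rule test_element[where \<mu> = \<mu>, OF d q N \<mu> fC cC[unfolded s_def] m[unfolded s_def], folded s_def S_def \<kappa>_def A_def])
         (rule that, assumption+)
    note int = Lp_pairing_integrable[OF _ q(1)]
    have orthB: "(\<integral>z. b z * cnj (?y c z) \<partial>surface_measure) = 0" if b: "b \<in> B" for b
    proof -
      have bL: "b \<in> Lp_space q" using BL cfun.span_base[OF b] by blast
      have "(\<integral>z. b z * cnj (?y c z) \<partial>surface_measure)
          = (\<integral>z. (\<Sum>i\<in>?I. cnj (c i / of_real (\<mu> (fst i))) * (b z * cnj (snd i z))) \<partial>surface_measure)"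
        by (rule Bochner_Integration.integral_cong) (simp_all add: graded_sum_def sum_distrib_left mult_ac)
      also have "\<dots> = (\<Sum>i\<in>?I. cnj (c i / of_real (\<mu> (fst i))) * (\<integral>z. b z * cnj (snd i z) \<partial>surface_measure))"
        by (subst Bochner_Integration.integral_sum)
           (auto intro!: integrable_mult_right int bL graded_basis_sphere_polys)
      also have "\<dots> = cnj (\<Sum>i\<in>?I. cnj (\<integral>z. b z * cnj (snd i z) \<partial>surface_measure) / of_real (\<mu> (fst i)) * c i)"
        by (simp only: cnj_sum complex_cnj_mult complex_cnj_divide complex_cnj_cnj complex_cnj_complex_of_real
            times_divide_eq_left times_divide_eq_right mult.commute)
      also have "(\<Sum>i\<in>?I. cnj (\<integral>z. b z * cnj (snd i z) \<partial>surface_measure) / of_real (\<mu> (fst i)) * c i) = 0"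
        by (rule c(1)) (use b in \<open>auto simp: C_def\<close>)
      finally show ?thesis by simp
    qed
    have orthV: "(\<integral>z. v z * cnj (?y c z) \<partial>surface_measure) = 0" if vV: "v \<in> V" for v
    proof -
      obtain b w where b: "v = b + w" "b \<in> cfun.span B" "w \<in> ?W" using vV B(3) by blast
      have w: "w \<in> Lp_space q" "Lp_norm q w = 0" using b(3) by (auto simp: null_part_def)
      obtain u where u: "b = (\<lambda>z. \<Sum>b\<in>B. u b * b z)" using span_finite_coeffs[OF B(1) b(2)] by blast
      have "(\<integral>z. v z * cnj (?y c z) \<partial>surface_measure)
          = (\<integral>z. b z * cnj (?y c z) + w z * cnj (?y c z) \<partial>surface_measure)"
        by (simp add: b(1) distrib_right)
      also have "\<dots> = (\<integral>z. b z * cnj (?y c z) \<partial>surface_measure) + (\<integral>z. w z * cnj (?y c z) \<partial>surface_measure)"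
        by (rule Bochner_Integration.integral_add) (intro int BL b(2) w ys)+
      also have "(\<integral>z. w z * cnj (?y c z) \<partial>surface_measure) = 0" by (rule c(3)[OF w])
      also have "(\<integral>z. b z * cnj (?y c z) \<partial>surface_measure)
          = (\<integral>z. (\<Sum>b\<in>B. u b * (b z * cnj (?y c z))) \<partial>surface_measure)"
        by (rule Bochner_Integration.integral_cong) (simp_all add: u sum_distrib_right mult.assoc)
      also have "\<dots> = (\<Sum>b\<in>B. u b * (\<integral>z. b z * cnj (?y c z) \<partial>surface_measure))"
        by (subst Bochner_Integration.integral_sum)
           (auto intro!: integrable_mult_right int BL cfun.span_base ys)
      also have "\<dots> = 0" by (simp add: orthB)
      finally show ?thesis by simp
    qed
    show "\<exists>x\<in>A. \<forall>y\<in>V. R \<le> Lp_norm q (x - y)"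
    proof (intro bexI[OF _ c(2)] ballI)
      fix v assume v: "v \<in> V"
      then have vL: "v \<in> Lp_space q" using VX by blast
      have e: "?x c - v = (\<lambda>z. ?x c z - v z)" by (simp add: fun_diff_def)
      show "R \<le> Lp_norm q (?x c - v)"
        unfolding e
      proof (intro R_le c(4))
        show "(\<lambda>z. ?x c z - v z) \<in> Lp_space q" by (rule Lp_space_diff[OF xL vL q0(2)])
        have "(\<integral>z. (?x c z - v z) * cnj (?y c z) \<partial>surface_measure)
            = (\<integral>z. ?x c z * cnj (?y c z) \<partial>surface_measure) - (\<integral>z. v z * cnj (?y c z) \<partial>surface_measure)"
          unfolding left_diff_distrib by (rule Bochner_Integration.integral_diff) (intro int xL vL ys)+
        then show "(\<integral>z. (?x c z - v z) * cnj (?y c z) \<partial>surface_measure) = sip (?x c) (?y c)"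
          by (simp add: orthV[OF v] sip_def)
      qed
    qed
  qed
qed

theorem theorem5p2:
  assumes "CARD('d::finite) \<ge> 2"
  shows "\<exists>C>0. \<forall>(p::real) (q::real) (\<rho>::real) (N::nat) (lam :: real \<Rightarrow> real).
    let s = cfun.dim (harmonics_upto N :: (complex ^ 'd \<Rightarrow> complex) set);
        a = (\<lambda>m n. complex_of_real (lam (real (max m n))));
        A = (multiplier_ball a p q :: (complex ^ 'd \<Rightarrow> complex) set);
        k = nat \<lfloor>\<rho> * real s - 1\<rfloor>
    in 1 \<le> q \<and> q \<le> p \<and> p \<le> 2 \<and> 0 < \<rho> \<and> \<rho> < 1 \<and> 1 \<le> N \<and> \<rho> * real s \<ge> 1 \<and>
       (\<forall>t\<ge>0. lam t > 0) \<and> antimono_on {0..} lam \<and>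
       bounded_multiplier TYPE('d) a p q \<longrightarrow>
       min (kolmogorov_width k A (Lp_space q) (Lp_norm q))
           (gelfand_width k A (Lp_space q) (Lp_norm q))
       \<ge> ennreal (C * (1 - \<rho>) powr (1 / 2) * real s powr (1 / 2) *
            (\<Sum>l=1..N. lam (real l) powi (-2) *
               real (cfun.dim (harmonics_level l :: (complex ^ 'd \<Rightarrow> complex) set))) powr (- 1 / 2) *
            vartheta q s)"
proof -
  let ?dl = "\<lambda>l. real (cfun.dim (harmonics_level l :: (complex ^ 'd \<Rightarrow> complex) set))"
  define K where "K = (1 + area TYPE('d)) *
    ((1 + 2 * area TYPE('d)) * exp (2 * real CARD('d)) * sqrt (48 * exp 1) / sqrt (area TYPE('d)))"
  have K: "K > 0" unfolding K_def using area_pos[where 'd='d]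
    by (intro mult_pos_pos divide_pos_pos) auto
  define C where "C = 1 / (K * sqrt (1 + ?dl 0))"
  have C: "C > 0" unfolding C_def using K by (intro divide_pos_pos mult_pos_pos) auto
  show ?thesis
  proof (intro exI[of _ C] conjI C allI, unfold Let_def, intro impI, elim conjE)
    fix p q \<rho> :: real and N :: nat and lam :: "real \<Rightarrow> real"
    define s where "s = cfun.dim (harmonics_upto N :: (complex ^ 'd \<Rightarrow> complex) set)"
    define k where "k = nat \<lfloor>\<rho> * real s - 1\<rfloor>"
    define S1 where "S1 = (\<Sum>l=1..N. lam (real l) powi (-2) * ?dl l)"
    define S where "S = (\<Sum>l\<le>N. ?dl l / (lam (real l))\<^sup>2)"
    assume q: "1 \<le> q" "q \<le> p" "p \<le> 2" and \<rho>: "0 < \<rho>" "\<rho> < 1" and N: "1 \<le> N"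
      and "1 \<le> \<rho> * real (cfun.dim (harmonics_upto N :: (complex ^ 'd \<Rightarrow> complex) set))"
      and lam: "\<forall>t\<ge>0. lam t > 0" and anti: "antimono_on {0..} lam"
    then have \<rho>s: "1 \<le> \<rho> * real s" by (simp add: s_def)
    define R where "R = C * (1 - \<rho>) powr (1 / 2) * real s powr (1 / 2) * S1 powr (- 1 / 2) * vartheta q s"
    have lp: "lam (real l) > 0" for l using lam by simp
    have kr: "real k \<le> \<rho> * real s - 1" unfolding k_def using \<rho>s by simp
    have s0: "real s > 0" using \<rho>s by (cases "s = 0") auto
    have "\<rho> * real s \<le> 1 * real s" using \<rho> s0 by (intro mult_right_mono) auto
    with kr have k: "k < s" by simp
    \<comment> \<open>The index \<open>k\<close> is at most \<open>\<rho> s - 1\<close>, so more than \<open>(1 - \<rho>) s\<close> dimensions remain.\<close>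
    have mk: "(1 - \<rho>) * real s \<le> real (s - k)"
      using kr k by (simp add: of_nat_diff algebra_simps)
    have S1: "S1 = (\<Sum>l=1..N. ?dl l / (lam (real l))\<^sup>2)"
      unfolding S1_def by (simp add: power_int_minus divide_inverse mult.commute)
    have "?dl 1 / (lam (real 1))\<^sup>2 \<le> S1"
      unfolding S1 using N by (intro member_le_sum) auto
    moreover have "1 / (lam (real 1))\<^sup>2 \<le> ?dl 1 / (lam (real 1))\<^sup>2"
      using dim_level_pos[of 1, where 'd='d] by (intro divide_right_mono) auto
    ultimately have l1: "1 / (lam 1)\<^sup>2 \<le> S1" by simp
    moreover have "1 / (lam 1)\<^sup>2 > 0" using lp[of 1] by simp
    ultimately have S1pos: "S1 > 0" by linarith
    have "lam 1 \<le> lam 0" using monotone_onD[OF anti, of 0 1] by simp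
    then have "(lam 1)\<^sup>2 \<le> (lam 0)\<^sup>2" using lp[of 1] by (intro power_mono) auto
    then have "1 / (lam 0)\<^sup>2 \<le> 1 / (lam 1)\<^sup>2" using lp[of 0] lp[of 1] by (intro divide_left_mono) auto
    with l1 have "1 / (lam 0)\<^sup>2 \<le> S1" by linarith
    then have "?dl 0 * (1 / (lam 0)\<^sup>2) \<le> ?dl 0 * S1" by (intro mult_left_mono) auto
    moreover have Seq: "S = ?dl 0 * (1 / (lam 0)\<^sup>2) + S1"
      unfolding S_def S1 atMost_atLeast0 by (simp add: sum.atLeast_Suc_atMost)
    ultimately have SS: "S \<le> (1 + ?dl 0) * S1" by (simp add: distrib_right)
    have S: "S > 0" using Seq S1pos by (simp add: add_nonneg_pos)
    have R_eq: "R = sqrt ((1 - \<rho>) * real s) / (K * sqrt ((1 + ?dl 0) * S1)) * vartheta q s"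
      unfolding R_def C_def using \<rho> S1pos s0
      by (simp add: powr_half_sqrt real_sqrt_mult powr_minus_divide)
    \<comment> \<open>The sum in \<open>S\<close> starts at level \<open>0\<close>, the one in \<open>S1\<close> at level \<open>1\<close>; \<open>C\<close> contains the price of the difference.\<close>
    have KSR: "K * sqrt S * R \<le> sqrt (real (s - k)) * vartheta q s"
    proof -
      have "K * sqrt S * R = sqrt ((1 - \<rho>) * real s) * (sqrt S / sqrt ((1 + ?dl 0) * S1)) * vartheta q s"
        unfolding R_eq using K by simp
      also have "\<dots> \<le> sqrt (real (s - k)) * 1 * vartheta q s"
      proof (intro mult_right_mono mult_mono)
        show "sqrt ((1 - \<rho>) * real s) \<le> sqrt (real (s - k))" using mk by simp
        show "sqrt S / sqrt ((1 + ?dl 0) * S1) \<le> 1" using SS S by simp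
      qed (use S S1pos vartheta_nonneg in auto)
      finally show ?thesis by simp
    qed
    have "K * sqrt S > 0" using K S by simp
    note W = widths_multiplier_ball_ge[where 'd = 'd and \<mu> = "\<lambda>l. lam (real l)", OF assms q N lp k[unfolded s_def],
        folded s_def, folded S_def, folded K_def, OF KSR this]
    have "ennreal R \<le> gelfand_width k (multiplier_ball (\<lambda>m n. complex_of_real (lam (real (max m n)))) p q
        :: (complex ^ 'd \<Rightarrow> complex) set) (Lp_space q) (Lp_norm q)"
      "ennreal R \<le> kolmogorov_width k (multiplier_ball (\<lambda>m n. complex_of_real (lam (real (max m n)))) p q
        :: (complex ^ 'd \<Rightarrow> complex) set) (Lp_space q) (Lp_norm q)"
      by (rule W)+
    then show "ennreal (C * (1 - \<rho>) powr (1 / 2) * real (cfun.dim (harmonics_upto N :: (complex ^ 'd \<Rightarrow> complex) set)) powr (1 / 2) *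
            (\<Sum>l=1..N. lam (real l) powi (-2) * ?dl l) powr (- 1 / 2) *
            vartheta q (cfun.dim (harmonics_upto N :: (complex ^ 'd \<Rightarrow> complex) set)))
      \<le> min (kolmogorov_width (nat \<lfloor>\<rho> * real (cfun.dim (harmonics_upto N :: (complex ^ 'd \<Rightarrow> complex) set)) - 1\<rfloor>)
           (multiplier_ball (\<lambda>m n. complex_of_real (lam (real (max m n)))) p q :: (complex ^ 'd \<Rightarrow> complex) set)
           (Lp_space q) (Lp_norm q))
         (gelfand_width (nat \<lfloor>\<rho> * real (cfun.dim (harmonics_upto N :: (complex ^ 'd \<Rightarrow> complex) set)) - 1\<rfloor>)
           (multiplier_ball (\<lambda>m n. complex_of_real (lam (real (max m n)))) p q :: (complex ^ 'd \<Rightarrow> complex) set)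
           (Lp_space q) (Lp_norm q))"
      unfolding R_def k_def S1_def s_def by simp
  qed
qed

end
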